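(* Let $R$ be a (not necessarily commutative) ring whose additive group is finitely generated and let $\mathbf{k}$ be a noetherian commutative ring. Then the category of $\mathbf{OVI}(R)$-modules over $\mathbf{k}$ is locally noetherian, that is, any submodule of a finitely generated $\mathbf{OVI}(R)$-module over $\mathbf{k}$ is finitely generated.
   Context: Rings are associative and unital with $1\ne 0$. For a category $\mathcal{C}$, a $\mathcal{C}$-module over $\mathbf{k}$ is a functor $M\colon \mathcal{C} \to \mathrm{Mod}_{\mathbf{k}}$. For $x \in \mathcal{C}$, the principal projective $P_x$ is the $\mathcal{C}$-module $(P_x)_y = \mathbf{k}[\mathrm{Hom}_{\mathcal{C}}(x,y)]$. A $\mathcal{C}$-module $M$ is finitely generated if there is a surjection $\bigoplus_{i=1}^k P_{x_i} \to M$ for some finitely many $x_1,\dots,x_k \in \mathcal{C}$. $\mathbf{OVI}(R)$ is the following category. Objects are pairs $(V,\{v_i\}_{i\in I})$ where $V$ is a finite rank free left $R$-module and $\{v_i\}$ is a basis indexed by a totally ordered set $I$. A morphism $(V,\{v_i\}_{i \in I}) \to (W,\{w_j\}_{j\in J})$ is a pair $(f,f_0)$ with $f\colon V \to W$ an $R$-linear map and $f_0\colon I \to J$ an order-preserving injection such that $f(v_i) = w_{f_0(i)} + \sum_{j<f_0(i)} a_{i,j} w_j$ for some scalars $a_{i,j}\in R$. *)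

theory Defs
  imports "HOL-Algebra.Algebra"
begin

section \<open>Left modules and linear maps\<close>

text \<open>
  The locale \<^locale>\<open>module\<close> of HOL-Algebra requires commutative scalars.  The locale below has the
  same axioms over an arbitrary ring and uses the same record type.
\<close>

locale left_module = R?: ring R + V?: abelian_group V
  for R :: "('r, 'p) ring_scheme" (structure) and V :: "('r, 'v) module" (structure) +
  assumes smult_closed [simp, intro]:
      "\<lbrakk>a \<in> carrier R; x \<in> carrier V\<rbrakk> \<Longrightarrow> a \<odot>\<^bsub>V\<^esub> x \<in> carrier V"
    and smult_l_distr:
      "\<lbrakk>a \<in> carrier R; b \<in> carrier R; x \<in> carrier V\<rbrakk>
        \<Longrightarrow> (a \<oplus>\<^bsub>R\<^esub> b) \<odot>\<^bsub>V\<^esub> x = a \<odot>\<^bsub>V\<^esub> x \<oplus>\<^bsub>V\<^esub> b \<odot>\<^bsub>V\<^esub> x"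
    and smult_r_distr:
      "\<lbrakk>a \<in> carrier R; x \<in> carrier V; y \<in> carrier V\<rbrakk>
        \<Longrightarrow> a \<odot>\<^bsub>V\<^esub> (x \<oplus>\<^bsub>V\<^esub> y) = a \<odot>\<^bsub>V\<^esub> x \<oplus>\<^bsub>V\<^esub> a \<odot>\<^bsub>V\<^esub> y"
    and smult_assoc1:
      "\<lbrakk>a \<in> carrier R; b \<in> carrier R; x \<in> carrier V\<rbrakk>
        \<Longrightarrow> (a \<otimes>\<^bsub>R\<^esub> b) \<odot>\<^bsub>V\<^esub> x = a \<odot>\<^bsub>V\<^esub> (b \<odot>\<^bsub>V\<^esub> x)"
    and smult_one [simp]: "x \<in> carrier V \<Longrightarrow> \<one>\<^bsub>R\<^esub> \<odot>\<^bsub>V\<^esub> x = x"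

text \<open>
  The underlying functions of linear maps are required to be \<^const>\<open>undefined\<close> outside the carrier
  of their domain, so that equality in HOL is equality of maps.
\<close>

definition linear_maps ::
  "('r, 'p) ring_scheme \<Rightarrow> ('r, 'v) module \<Rightarrow> ('r, 'w) module \<Rightarrow> ('v \<Rightarrow> 'w) set" where
  "linear_maps R V W = {f \<in> carrier V \<rightarrow>\<^sub>E carrier W.
     (\<forall>x\<in>carrier V. \<forall>y\<in>carrier V. f (x \<oplus>\<^bsub>V\<^esub> y) = f x \<oplus>\<^bsub>W\<^esub> f y) \<and>
     (\<forall>a\<in>carrier R. \<forall>x\<in>carrier V. f (a \<odot>\<^bsub>V\<^esub> x) = a \<odot>\<^bsub>W\<^esub> f x)}"

definition is_basis ::
  "('r, 'p) ring_scheme \<Rightarrow> ('r, 'v) module \<Rightarrow> 'i set \<Rightarrow> ('i \<Rightarrow> 'v) \<Rightarrow> bool" where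
  "is_basis R V I v \<longleftrightarrow> finite I \<and> v \<in> I \<rightarrow> carrier V \<and>
     (\<forall>x\<in>carrier V. \<exists>!a. a \<in> I \<rightarrow>\<^sub>E carrier R \<and> x = (\<Oplus>\<^bsub>V\<^esub>i\<in>I. a i \<odot>\<^bsub>V\<^esub> v i))"

definition additively_finitely_generated :: "('r, 'p) ring_scheme \<Rightarrow> bool" where
  "additively_finitely_generated R \<longleftrightarrow>
     (\<exists>S \<subseteq> carrier R. finite S \<and> generate (add_monoid R) S = carrier R)"


section \<open>Categories\<close>

text \<open>
  Hom-sets need not be disjoint, so composition carries its three objects:
  \<open>composite C x y z g f\<close> is the composite of \<open>f\<close> from \<open>x\<close> to \<open>y\<close> and \<open>g\<close> from \<open>y\<close> to \<open>z\<close>.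
\<close>

record ('o, 'h) cat =
  obj :: "'o set"
  homset :: "'o \<Rightarrow> 'o \<Rightarrow> 'h set"
  ident :: "'o \<Rightarrow> 'h"
  composite :: "'o \<Rightarrow> 'o \<Rightarrow> 'o \<Rightarrow> 'h \<Rightarrow> 'h \<Rightarrow> 'h"

locale category =
  fixes C :: "('o, 'h) cat"
  assumes ident_closed: "x \<in> obj C \<Longrightarrow> ident C x \<in> homset C x x"
    and comp_closed:
      "\<lbrakk>x \<in> obj C; y \<in> obj C; z \<in> obj C; f \<in> homset C x y; g \<in> homset C y z\<rbrakk>
        \<Longrightarrow> composite C x y z g f \<in> homset C x z"
    and comp_ident_left:
      "\<lbrakk>x \<in> obj C; y \<in> obj C; f \<in> homset C x y\<rbrakk> \<Longrightarrow> composite C x y y (ident C y) f = f"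
    and comp_ident_right:
      "\<lbrakk>x \<in> obj C; y \<in> obj C; f \<in> homset C x y\<rbrakk> \<Longrightarrow> composite C x x y f (ident C x) = f"
    and comp_assoc:
      "\<lbrakk>x \<in> obj C; y \<in> obj C; z \<in> obj C; w \<in> obj C;
        f \<in> homset C x y; g \<in> homset C y z; h \<in> homset C z w\<rbrakk>
        \<Longrightarrow> composite C x z w h (composite C x y z g f) =
            composite C x y w (composite C y z w h g) f"


section \<open>Modules over a category\<close>

record ('o, 'h, 'k, 'a) cat_module =
  mobj :: "'o \<Rightarrow> ('k, 'a) module"
  mmap :: "'o \<Rightarrow> 'o \<Rightarrow> 'h \<Rightarrow> 'a \<Rightarrow> 'a"

definition is_cat_module ::
  "('k, 'q) ring_scheme \<Rightarrow> ('o, 'h) cat \<Rightarrow> ('o, 'h, 'k, 'a) cat_module \<Rightarrow> bool" where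
  "is_cat_module K C M \<longleftrightarrow>
     (\<forall>x\<in>obj C. module K (mobj M x)) \<and>
     (\<forall>x\<in>obj C. \<forall>y\<in>obj C. \<forall>f\<in>homset C x y.
        mmap M x y f \<in> linear_maps K (mobj M x) (mobj M y)) \<and>
     (\<forall>x\<in>obj C. \<forall>m\<in>carrier (mobj M x). mmap M x x (ident C x) m = m) \<and>
     (\<forall>x\<in>obj C. \<forall>y\<in>obj C. \<forall>z\<in>obj C. \<forall>f\<in>homset C x y. \<forall>g\<in>homset C y z.
        \<forall>m\<in>carrier (mobj M x).
          mmap M x z (composite C x y z g f) m = mmap M y z g (mmap M x y f m))"

definition is_cat_submodule ::
  "('k, 'q) ring_scheme \<Rightarrow> ('o, 'h) cat \<Rightarrow> ('o, 'h, 'k, 'a) cat_module \<Rightarrow> ('o \<Rightarrow> 'a set) \<Rightarrow> bool"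
  where
  "is_cat_submodule K C M N \<longleftrightarrow>
     (\<forall>x\<in>obj C. submodule (N x) K (mobj M x)) \<and>
     (\<forall>x\<in>obj C. \<forall>y\<in>obj C. \<forall>f\<in>homset C x y. mmap M x y f ` N x \<subseteq> N y)"

definition cat_submodule ::
  "('o, 'h, 'k, 'a) cat_module \<Rightarrow> ('o \<Rightarrow> 'a set) \<Rightarrow> ('o, 'h, 'k, 'a) cat_module" where
  "cat_submodule M N =
     \<lparr>mobj = (\<lambda>x. (mobj M x)\<lparr>carrier := N x\<rparr>),
      mmap = (\<lambda>x y f. restrict (mmap M x y f) (N x))\<rparr>"

text \<open>Morphisms of modules over \<open>C\<close> are natural transformations.\<close>

definition cat_module_maps ::
  "('k, 'q) ring_scheme \<Rightarrow> ('o, 'h) cat \<Rightarrow> ('o, 'h, 'k, 'a) cat_module \<Rightarrow>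
   ('o, 'h, 'k, 'b) cat_module \<Rightarrow> ('o \<Rightarrow> 'a \<Rightarrow> 'b) set" where
  "cat_module_maps K C M N = {\<phi>.
     (\<forall>x\<in>obj C. \<phi> x \<in> linear_maps K (mobj M x) (mobj N x)) \<and>
     (\<forall>x\<in>obj C. \<forall>y\<in>obj C. \<forall>f\<in>homset C x y. \<forall>m\<in>carrier (mobj M x).
        \<phi> y (mmap M x y f m) = mmap N x y f (\<phi> x m))}"

text \<open>
  Formal sums are coefficient functions of finite support.  In \<open>free_map\<close> the sum over a fibre is
  restricted to the support because \<^const>\<open>finsum\<close> is zero on infinite index sets.
\<close>

definition free_module :: "('k, 'q) ring_scheme \<Rightarrow> 's set \<Rightarrow> ('k, 's \<Rightarrow> 'k) module" where
  "free_module K S =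
     \<lparr>carrier = {c \<in> S \<rightarrow>\<^sub>E carrier K. finite {s \<in> S. c s \<noteq> \<zero>\<^bsub>K\<^esub>}},
      monoid.mult = undefined, one = undefined,
      ring.zero = (\<lambda>s\<in>S. \<zero>\<^bsub>K\<^esub>),
      ring.add = (\<lambda>c d. \<lambda>s\<in>S. c s \<oplus>\<^bsub>K\<^esub> d s),
      smult = (\<lambda>a c. \<lambda>s\<in>S. a \<otimes>\<^bsub>K\<^esub> c s)\<rparr>"

definition free_map ::
  "('k, 'q) ring_scheme \<Rightarrow> 's set \<Rightarrow> 't set \<Rightarrow> ('s \<Rightarrow> 't) \<Rightarrow> ('s \<Rightarrow> 'k) \<Rightarrow> ('t \<Rightarrow> 'k)" where
  "free_map K S T f =
     (\<lambda>c\<in>carrier (free_module K S). \<lambda>t\<in>T. \<Oplus>\<^bsub>K\<^esub>s\<in>{s \<in> S. c s \<noteq> \<zero>\<^bsub>K\<^esub> \<and> f s = t}. c s)"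

definition principal_projective ::
  "('k, 'q) ring_scheme \<Rightarrow> ('o, 'h) cat \<Rightarrow> 'o \<Rightarrow> ('o, 'h, 'k, 'h \<Rightarrow> 'k) cat_module" where
  "principal_projective K C x =
     \<lparr>mobj = (\<lambda>y. free_module K (homset C x y)),
      mmap = (\<lambda>y z g. free_map K (homset C x y) (homset C x z) (composite C x y z g))\<rparr>"

text \<open>Finite direct sums, constructed as finite products.\<close>

definition sum_module :: "nat \<Rightarrow> (nat \<Rightarrow> ('k, 'a) module) \<Rightarrow> ('k, nat \<Rightarrow> 'a) module" where
  "sum_module n V =
     \<lparr>carrier = (\<Pi>\<^sub>E i\<in>{..<n}. carrier (V i)),
      monoid.mult = undefined, one = undefined,
      ring.zero = (\<lambda>i\<in>{..<n}. \<zero>\<^bsub>V i\<^esub>),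
      ring.add = (\<lambda>u w. \<lambda>i\<in>{..<n}. u i \<oplus>\<^bsub>V i\<^esub> w i),
      smult = (\<lambda>a u. \<lambda>i\<in>{..<n}. a \<odot>\<^bsub>V i\<^esub> u i)\<rparr>"

definition direct_sum ::
  "nat \<Rightarrow> (nat \<Rightarrow> ('o, 'h, 'k, 'a) cat_module) \<Rightarrow> ('o, 'h, 'k, nat \<Rightarrow> 'a) cat_module" where
  "direct_sum n M =
     \<lparr>mobj = (\<lambda>x. sum_module n (\<lambda>i. mobj (M i) x)),
      mmap = (\<lambda>x y f. \<lambda>u\<in>carrier (sum_module n (\<lambda>i. mobj (M i) x)).
        \<lambda>i\<in>{..<n}. mmap (M i) x y f (u i))\<rparr>"

definition finitely_generated ::
  "('k, 'q) ring_scheme \<Rightarrow> ('o, 'h) cat \<Rightarrow> ('o, 'h, 'k, 'a) cat_module \<Rightarrow> bool" where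
  "finitely_generated K C M \<longleftrightarrow>
     (\<exists>n p \<phi>. p \<in> {..<n} \<rightarrow> obj C \<and>
        \<phi> \<in> cat_module_maps K C (direct_sum n (\<lambda>i. principal_projective K C (p i))) M \<and>
        (\<forall>x\<in>obj C.
           \<phi> x ` carrier (mobj (direct_sum n (\<lambda>i. principal_projective K C (p i))) x)
             = carrier (mobj M x)))"


section \<open>The category \<open>OVI(R)\<close>\<close>

text \<open>
  An object consists of a module, a finite index set, a total order on the index set (as a reflexive
  relation), and a basis.  Its elements and its indices range over the arbitrary types \<open>'v\<close> and \<open>'i\<close>.
\<close>

record ('r, 'v, 'i) based_module =
  underlying :: "('r, 'v) module"
  index_set :: "'i set"
  index_order :: "('i \<times> 'i) set"
  basis_vector :: "'i \<Rightarrow> 'v"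

definition OVI_objects :: "('r, 'p) ring_scheme \<Rightarrow> ('r, 'v, 'i) based_module set" where
  "OVI_objects R = {A. left_module R (underlying A) \<and>
     linear_order_on (index_set A) (index_order A) \<and>
     is_basis R (underlying A) (index_set A) (basis_vector A)}"

definition below :: "('r, 'v, 'i) based_module \<Rightarrow> 'i \<Rightarrow> 'i set" where
  "below A i = {j \<in> index_set A. (j, i) \<in> index_order A \<and> j \<noteq> i}"

definition OVI_hom ::
  "('r, 'p) ring_scheme \<Rightarrow> ('r, 'v, 'i) based_module \<Rightarrow> ('r, 'v, 'i) based_module \<Rightarrow>
   (('v \<Rightarrow> 'v) \<times> ('i \<Rightarrow> 'i)) set" where
  "OVI_hom R A B = {(f, f0).
     f \<in> linear_maps R (underlying A) (underlying B) \<and>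
     f0 \<in> index_set A \<rightarrow>\<^sub>E index_set B \<and> inj_on f0 (index_set A) \<and>
     (\<forall>i\<in>index_set A. \<forall>j\<in>index_set A.
        (i, j) \<in> index_order A \<longrightarrow> (f0 i, f0 j) \<in> index_order B) \<and>
     (\<forall>i\<in>index_set A. \<exists>a \<in> below B (f0 i) \<rightarrow> carrier R.
        f (basis_vector A i) =
          basis_vector B (f0 i) \<oplus>\<^bsub>underlying B\<^esub>
            (\<Oplus>\<^bsub>underlying B\<^esub>j\<in>below B (f0 i). a j \<odot>\<^bsub>underlying B\<^esub> basis_vector B j))}"

definition OVI ::
  "('r, 'p) ring_scheme \<Rightarrow> (('r, 'v, 'i) based_module, ('v \<Rightarrow> 'v) \<times> ('i \<Rightarrow> 'i)) cat" where
  "OVI R =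
     \<lparr>obj = OVI_objects R,
      homset = OVI_hom R,
      ident = (\<lambda>A. (\<lambda>x\<in>carrier (underlying A). x, \<lambda>i\<in>index_set A. i)),
      composite = (\<lambda>A B D (g, g0) (f, f0).
        (compose (carrier (underlying A)) g f, compose (index_set A) g0 f0))\<rparr>"


section \<open>Well-definedness\<close>

context left_module
begin

lemma smult_l_null [simp]:
  assumes "x \<in> carrier V" shows "\<zero>\<^bsub>R\<^esub> \<odot>\<^bsub>V\<^esub> x = \<zero>\<^bsub>V\<^esub>"
proof -
  have "\<zero>\<^bsub>R\<^esub> \<odot>\<^bsub>V\<^esub> x = (\<zero>\<^bsub>R\<^esub> \<oplus>\<^bsub>R\<^esub> \<zero>\<^bsub>R\<^esub>) \<odot>\<^bsub>V\<^esub> x"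
    by simp
  also have "\<dots> = \<zero>\<^bsub>R\<^esub> \<odot>\<^bsub>V\<^esub> x \<oplus>\<^bsub>V\<^esub> \<zero>\<^bsub>R\<^esub> \<odot>\<^bsub>V\<^esub> x"
    using assms by (intro smult_l_distr) auto
  finally show ?thesis
    using assms V.add.l_cancel_one'[of "\<zero>\<^bsub>R\<^esub> \<odot>\<^bsub>V\<^esub> x" "\<zero>\<^bsub>R\<^esub> \<odot>\<^bsub>V\<^esub> x"] by auto
qed

definition combinations :: "'i set \<Rightarrow> ('i \<Rightarrow> 'v) \<Rightarrow> 'v set" where
  "combinations J v = {\<Oplus>\<^bsub>V\<^esub>j\<in>J. a j \<odot>\<^bsub>V\<^esub> v j |a. a \<in> J \<rightarrow> carrier R}"

lemma combinations_closed:
  assumes "v \<in> J \<rightarrow> carrier V" shows "combinations J v \<subseteq> carrier V"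
  using assms by (auto simp: combinations_def Pi_def intro!: V.finsum_closed)

lemma zero_combinations:
  assumes "v \<in> J \<rightarrow> carrier V" shows "\<zero>\<^bsub>V\<^esub> \<in> combinations J v"
proof -
  have "(\<Oplus>\<^bsub>V\<^esub>j\<in>J. \<zero>\<^bsub>R\<^esub> \<odot>\<^bsub>V\<^esub> v j) = (\<Oplus>\<^bsub>V\<^esub>j\<in>J. \<zero>\<^bsub>V\<^esub>)"
    using assms by (intro V.finsum_cong') (auto simp: Pi_def)
  then show ?thesis
    unfolding combinations_def by (auto intro!: exI[of _ "\<lambda>_. \<zero>\<^bsub>R\<^esub>"])
qed

lemma add_combinations:
  assumes v: "v \<in> J \<rightarrow> carrier V" and "x \<in> combinations J v" "y \<in> combinations J v"
  shows "x \<oplus>\<^bsub>V\<^esub> y \<in> combinations J v"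
proof -
  from assms obtain a b where a: "a \<in> J \<rightarrow> carrier R" "x = (\<Oplus>\<^bsub>V\<^esub>j\<in>J. a j \<odot>\<^bsub>V\<^esub> v j)"
    and b: "b \<in> J \<rightarrow> carrier R" "y = (\<Oplus>\<^bsub>V\<^esub>j\<in>J. b j \<odot>\<^bsub>V\<^esub> v j)"
    by (auto simp: combinations_def)
  have "x \<oplus>\<^bsub>V\<^esub> y = (\<Oplus>\<^bsub>V\<^esub>j\<in>J. a j \<odot>\<^bsub>V\<^esub> v j \<oplus>\<^bsub>V\<^esub> b j \<odot>\<^bsub>V\<^esub> v j)"
    unfolding a(2) b(2) using a(1) b(1) v by (subst V.finsum_addf) (auto simp: Pi_def)
  also have "\<dots> = (\<Oplus>\<^bsub>V\<^esub>j\<in>J. (a j \<oplus>\<^bsub>R\<^esub> b j) \<odot>\<^bsub>V\<^esub> v j)"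
    using a(1) b(1) v by (intro V.finsum_cong') (auto simp: Pi_def smult_l_distr)
  finally show ?thesis
    unfolding combinations_def using a(1) b(1)
    by (auto intro!: exI[of _ "\<lambda>j. a j \<oplus>\<^bsub>R\<^esub> b j"] simp: Pi_def)
qed

lemma finsum_combinations:
  assumes v: "v \<in> J \<rightarrow> carrier V" and "finite S" "\<And>s. s \<in> S \<Longrightarrow> g s \<in> combinations J v"
  shows "(\<Oplus>\<^bsub>V\<^esub>s\<in>S. g s) \<in> combinations J v"
  using assms(2,3)
proof (induction S rule: finite_induct)
  case empty
  then show ?case by (simp add: zero_combinations v)
next
  case (insert s S)
  then have "g \<in> insert s S \<rightarrow> carrier V"
    using combinations_closed[OF v] by auto
  with insert show ?case
    by (simp add: V.finsum_insert add_combinations v)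
qed

lemma smult_finsum:
  assumes "finite S" "a \<in> carrier R" "g \<in> S \<rightarrow> carrier V"
  shows "a \<odot>\<^bsub>V\<^esub> (\<Oplus>\<^bsub>V\<^esub>s\<in>S. g s) = (\<Oplus>\<^bsub>V\<^esub>s\<in>S. a \<odot>\<^bsub>V\<^esub> g s)"
  using assms(1,3)
proof (induction S rule: finite_induct)
  case empty
  have "a \<odot>\<^bsub>V\<^esub> \<zero>\<^bsub>V\<^esub> \<oplus>\<^bsub>V\<^esub> a \<odot>\<^bsub>V\<^esub> \<zero>\<^bsub>V\<^esub> = a \<odot>\<^bsub>V\<^esub> \<zero>\<^bsub>V\<^esub>"
    using assms(2) smult_r_distr[of a "\<zero>\<^bsub>V\<^esub>" "\<zero>\<^bsub>V\<^esub>"] by simp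
  then show ?case
    using assms(2) V.add.l_cancel_one[of "a \<odot>\<^bsub>V\<^esub> \<zero>\<^bsub>V\<^esub>" "a \<odot>\<^bsub>V\<^esub> \<zero>\<^bsub>V\<^esub>"] by simp
next
  case (insert s S)
  then have "g \<in> S \<rightarrow> carrier V" "g s \<in> carrier V"
    by auto
  with insert assms(2) show ?case
    by (simp add: V.finsum_insert Pi_def smult_r_distr)
qed

lemma smult_combinations:
  assumes "finite J" and v: "v \<in> J \<rightarrow> carrier V" and "x \<in> combinations J v" "a \<in> carrier R"
  shows "a \<odot>\<^bsub>V\<^esub> x \<in> combinations J v"
proof -
  from assms obtain b where b: "b \<in> J \<rightarrow> carrier R" "x = (\<Oplus>\<^bsub>V\<^esub>j\<in>J. b j \<odot>\<^bsub>V\<^esub> v j)"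
    by (auto simp: combinations_def)
  have "a \<odot>\<^bsub>V\<^esub> x = (\<Oplus>\<^bsub>V\<^esub>j\<in>J. a \<odot>\<^bsub>V\<^esub> (b j \<odot>\<^bsub>V\<^esub> v j))"
    unfolding b(2) using b(1) v assms by (intro smult_finsum) auto
  also have "\<dots> = (\<Oplus>\<^bsub>V\<^esub>j\<in>J. (a \<otimes>\<^bsub>R\<^esub> b j) \<odot>\<^bsub>V\<^esub> v j)"
    using b(1) v assms(4) by (intro V.finsum_cong') (auto simp: Pi_def smult_assoc1)
  finally show ?thesis
    unfolding combinations_def using b(1) assms(4)
    by (auto intro!: exI[of _ "\<lambda>j. a \<otimes>\<^bsub>R\<^esub> b j"] simp: Pi_def)
qed

lemma combinations_mono:
  assumes "finite J" "J' \<subseteq> J" and v: "v \<in> J \<rightarrow> carrier V"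
  shows "combinations J' v \<subseteq> combinations J v"
proof
  fix x assume "x \<in> combinations J' v"
  then obtain b where b: "b \<in> J' \<rightarrow> carrier R" "x = (\<Oplus>\<^bsub>V\<^esub>j\<in>J'. b j \<odot>\<^bsub>V\<^esub> v j)"
    by (auto simp: combinations_def)
  let ?b = "\<lambda>j. if j \<in> J' then b j else \<zero>\<^bsub>R\<^esub>"
  have "x = (\<Oplus>\<^bsub>V\<^esub>j\<in>J. ?b j \<odot>\<^bsub>V\<^esub> v j)"
    unfolding b(2) using assms b(1)
    by (intro V.add.finprod_mono_neutral_cong_left) (auto simp: Pi_def subset_iff)
  moreover have "?b \<in> J \<rightarrow> carrier R"
    using b(1) by auto
  ultimately show "x \<in> combinations J v"
    unfolding combinations_def by (intro CollectI exI[of _ ?b]) simp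
qed

lemma basis_combinations:
  assumes "finite J" "j \<in> J" and v: "v \<in> J \<rightarrow> carrier V"
  shows "v j \<in> combinations J v"
proof -
  have "(\<Oplus>\<^bsub>V\<^esub>i\<in>{j}. \<one>\<^bsub>R\<^esub> \<odot>\<^bsub>V\<^esub> v i) = v j"
    using assms by (subst V.finsum_insert) (auto simp: Pi_def)
  then have "v j \<in> combinations {j} v"
    unfolding combinations_def by (force intro!: exI[of _ "\<lambda>_. \<one>\<^bsub>R\<^esub>"])
  with combinations_mono[of J "{j}" v] assms show ?thesis
    by auto
qed

end

lemma linear_maps_finsum:
  assumes V: "left_module R V" and W: "left_module R W" and f: "f \<in> linear_maps R V W"
    and S: "finite S" "g \<in> S \<rightarrow> carrier V"
  shows "f (\<Oplus>\<^bsub>V\<^esub>s\<in>S. g s) = (\<Oplus>\<^bsub>W\<^esub>s\<in>S. f (g s))"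
proof -
  interpret V: left_module R V by (rule V)
  interpret W: left_module R W by (rule W)
  have clo: "f x \<in> carrier W" if "x \<in> carrier V" for x
    using f that by (auto simp: linear_maps_def)
  have add: "f (x \<oplus>\<^bsub>V\<^esub> y) = f x \<oplus>\<^bsub>W\<^esub> f y" if "x \<in> carrier V" "y \<in> carrier V" for x y
    using f that by (auto simp: linear_maps_def)
  have "f \<zero>\<^bsub>V\<^esub> \<oplus>\<^bsub>W\<^esub> f \<zero>\<^bsub>V\<^esub> = f \<zero>\<^bsub>V\<^esub>"
    using add[of "\<zero>\<^bsub>V\<^esub>" "\<zero>\<^bsub>V\<^esub>"] by simp
  then have zero: "f \<zero>\<^bsub>V\<^esub> = \<zero>\<^bsub>W\<^esub>"
    using W.V.add.l_cancel_one[of "f \<zero>\<^bsub>V\<^esub>" "f \<zero>\<^bsub>V\<^esub>"] clo by simp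
  from S show ?thesis
  proof (induction S rule: finite_induct)
    case empty
    then show ?case by (simp add: zero)
  next
    case (insert s S)
    then have "g \<in> S \<rightarrow> carrier V" "g s \<in> carrier V"
      by auto
    with insert show ?case
      by (simp add: V.V.finsum_insert W.V.finsum_insert Pi_def clo add)
  qed
qed

lemma linear_maps_compose:
  assumes "f \<in> linear_maps R U V" "g \<in> linear_maps R V W"
    and "\<And>x y. x \<in> carrier U \<Longrightarrow> y \<in> carrier U \<Longrightarrow> x \<oplus>\<^bsub>U\<^esub> y \<in> carrier U"
    and "\<And>a x. a \<in> carrier R \<Longrightarrow> x \<in> carrier U \<Longrightarrow> a \<odot>\<^bsub>U\<^esub> x \<in> carrier U"
  shows "compose (carrier U) g f \<in> linear_maps R U W"
  using assms unfolding linear_maps_def by (auto simp: compose_eq compose_def PiE_iff)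

lemma OVI_hom_iff:
  assumes "B \<in> OVI_objects R"
  shows "(f, f0) \<in> OVI_hom R A B \<longleftrightarrow>
     f \<in> linear_maps R (underlying A) (underlying B) \<and>
     f0 \<in> index_set A \<rightarrow>\<^sub>E index_set B \<and> inj_on f0 (index_set A) \<and>
     (\<forall>i\<in>index_set A. \<forall>j\<in>index_set A. (i, j) \<in> index_order A \<longrightarrow> (f0 i, f0 j) \<in> index_order B) \<and>
     (\<forall>i\<in>index_set A. \<exists>x \<in> left_module.combinations R (underlying B) (below B (f0 i)) (basis_vector B).
        f (basis_vector A i) = basis_vector B (f0 i) \<oplus>\<^bsub>underlying B\<^esub> x)"
proof -
  interpret left_module R "underlying B"
    using assms by (simp add: OVI_objects_def)
  show ?thesis
    unfolding OVI_hom_def combinations_def by (simp add: Bex_def) blast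
qed

theorem category_OVI:
  fixes R :: "('r, 'p) ring_scheme"
  shows "category (OVI R :: (('r, 'v, 'i) based_module, _) cat)"
proof
  fix A :: "('r, 'v, 'i) based_module" assume "A \<in> obj (OVI R)"
  then have A: "A \<in> OVI_objects R"
    by (simp add: OVI_def)
  interpret A: left_module R "underlying A"
    using A by (simp add: OVI_objects_def)
  have bas: "basis_vector A \<in> index_set A \<rightarrow> carrier (underlying A)"
    using A by (simp add: OVI_objects_def is_basis_def)
  show "ident (OVI R) A \<in> homset (OVI R) A A"
    unfolding OVI_def using bas
    by (auto simp: OVI_hom_iff[OF A] linear_maps_def below_def Pi_def
        intro!: bexI[OF _ A.zero_combinations] inj_onI)
next
  fix A B D :: "('r, 'v, 'i) based_module" and f g
  assume "A \<in> obj (OVI R)" "B \<in> obj (OVI R)" "D \<in> obj (OVI R)"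
    and "f \<in> homset (OVI R) A B" "g \<in> homset (OVI R) B D"
  then obtain p p0 q q0 where f: "f = (p, p0)" "(p, p0) \<in> OVI_hom R A B"
    and g: "g = (q, q0)" "(q, q0) \<in> OVI_hom R B D"
    and A: "A \<in> OVI_objects R" and B: "B \<in> OVI_objects R" and D: "D \<in> OVI_objects R"
    by (cases f; cases g) (auto simp: OVI_def)
  interpret A: left_module R "underlying A"
    using A by (simp add: OVI_objects_def)
  interpret B: left_module R "underlying B"
    using B by (simp add: OVI_objects_def)
  interpret D: left_module R "underlying D"
    using D by (simp add: OVI_objects_def)
  note p = f(2)[unfolded OVI_hom_iff[OF B]] and q = g(2)[unfolded OVI_hom_iff[OF D]]
  have bA: "basis_vector A \<in> index_set A \<rightarrow> carrier (underlying A)"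
    and bB: "basis_vector B \<in> index_set B \<rightarrow> carrier (underlying B)"
    and bD: "basis_vector D \<in> index_set D \<rightarrow> carrier (underlying D)"
    and finB: "finite (index_set B)" and finD: "finite (index_set D)"
    using A B D by (auto simp: OVI_objects_def is_basis_def)
  have belowD: "below D k \<subseteq> index_set D" "finite (below D k)"
    and belowB: "below B k \<subseteq> index_set B" "finite (below B k)" for k
    using finD finB by (auto simp: below_def)
  have bD': "basis_vector D \<in> below D k \<rightarrow> carrier (underlying D)"
    and bB': "basis_vector B \<in> below B k \<rightarrow> carrier (underlying B)" for k
    using bD bB belowD(1) belowB(1) by (auto simp: Pi_def subset_iff)
  have transD: "below D j \<subseteq> below D k" if "j \<in> below D k" for j k
    using D that unfolding OVI_objects_def linear_order_on_def partial_order_on_def preorder_on_def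
    by (auto simp: below_def dest: transD antisymD)
  have qbelow: "q0 j \<in> below D (q0 k)" if "j \<in> below B k" "k \<in> index_set B" for j k
    using q that unfolding below_def by (auto dest: inj_onD)
  have qclo: "q x \<in> carrier (underlying D)" if "x \<in> carrier (underlying B)" for x
    using q that by (auto simp: linear_maps_def)
  have qcomb: "q x \<in> D.combinations (below D (q0 k)) (basis_vector D)"
    if x: "x \<in> B.combinations (below B k) (basis_vector B)" and k: "k \<in> index_set B" for x k
  proof -
    obtain a where a: "a \<in> below B k \<rightarrow> carrier R"
      "x = (\<Oplus>\<^bsub>underlying B\<^esub>j\<in>below B k. a j \<odot>\<^bsub>underlying B\<^esub> basis_vector B j)"
      using x by (auto simp: B.combinations_def)
    have "q x = (\<Oplus>\<^bsub>underlying D\<^esub>j\<in>below B k. q (a j \<odot>\<^bsub>underlying B\<^esub> basis_vector B j))"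
      unfolding a(2) using q belowB a(1) bB'
      by (intro linear_maps_finsum[OF B.left_module_axioms D.left_module_axioms]) (auto simp: Pi_def)
    also have "\<dots> = (\<Oplus>\<^bsub>underlying D\<^esub>j\<in>below B k. a j \<odot>\<^bsub>underlying D\<^esub> q (basis_vector B j))"
      using q a(1) bB'[of k] qclo by (intro D.V.finsum_cong') (auto simp: linear_maps_def Pi_def)
    also have "\<dots> \<in> D.combinations (below D (q0 k)) (basis_vector D)"
    proof (rule D.finsum_combinations[OF bD' belowB(2)])
      fix j assume j: "j \<in> below B k"
      then obtain y where y: "y \<in> D.combinations (below D (q0 j)) (basis_vector D)"
        "q (basis_vector B j) = basis_vector D (q0 j) \<oplus>\<^bsub>underlying D\<^esub> y"
        using q belowB by blast
      have "y \<in> D.combinations (below D (q0 k)) (basis_vector D)"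
        using D.combinations_mono[OF belowD(2) transD bD', OF qbelow[OF j k]] y by auto
      then show "a j \<odot>\<^bsub>underlying D\<^esub> q (basis_vector B j)
          \<in> D.combinations (below D (q0 k)) (basis_vector D)"
        using y a(1) j D.basis_combinations[OF belowD(2) qbelow[OF j k] bD']
        by (auto simp: Pi_def intro!: D.smult_combinations D.add_combinations belowD bD')
    qed
    finally show ?thesis .
  qed
  have "\<exists>z \<in> D.combinations (below D (q0 (p0 i))) (basis_vector D).
      q (p (basis_vector A i)) = basis_vector D (q0 (p0 i)) \<oplus>\<^bsub>underlying D\<^esub> z"
    if i: "i \<in> index_set A" for i
  proof -
    have k: "p0 i \<in> index_set B" using p i by auto
    obtain x where x: "x \<in> B.combinations (below B (p0 i)) (basis_vector B)"
      "p (basis_vector A i) = basis_vector B (p0 i) \<oplus>\<^bsub>underlying B\<^esub> x"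
      using p i by blast
    obtain y where y: "y \<in> D.combinations (below D (q0 (p0 i))) (basis_vector D)"
      "q (basis_vector B (p0 i)) = basis_vector D (q0 (p0 i)) \<oplus>\<^bsub>underlying D\<^esub> y"
      using q k by blast
    have xc: "x \<in> carrier (underlying B)"
      using x(1) B.combinations_closed[OF bB'] by auto
    have yc: "y \<in> carrier (underlying D)"
      using y(1) D.combinations_closed[OF bD'] by auto
    have "q (p (basis_vector A i)) = q (basis_vector B (p0 i)) \<oplus>\<^bsub>underlying D\<^esub> q x"
      using q xc k bB unfolding x(2) by (auto simp: linear_maps_def)
    also have "\<dots> = basis_vector D (q0 (p0 i)) \<oplus>\<^bsub>underlying D\<^esub> (y \<oplus>\<^bsub>underlying D\<^esub> q x)"
    proof -
      have "basis_vector D (q0 (p0 i)) \<in> carrier (underlying D)"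
        using q k bD by auto
      then show ?thesis unfolding y(2) using yc qclo[OF xc] by (simp add: D.V.a_assoc)
    qed
    finally show ?thesis
      using D.add_combinations[OF bD' y(1) qcomb[OF x(1) k]] by blast
  qed
  moreover have "compose (carrier (underlying A)) q p \<in> linear_maps R (underlying A) (underlying D)"
    using p q by (intro linear_maps_compose) auto
  moreover have "inj_on (compose (index_set A) q0 p0) (index_set A)"
    using p q by (auto simp: inj_on_def compose_eq PiE_iff)
  moreover have "compose (index_set A) q0 p0 \<in> index_set A \<rightarrow>\<^sub>E index_set D"
    using p q by (auto simp: compose_def PiE_iff)
  moreover have "(compose (index_set A) q0 p0 i, compose (index_set A) q0 p0 j) \<in> index_order D"
    if "i \<in> index_set A" "j \<in> index_set A" "(i, j) \<in> index_order A" for i j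
    using p q that by (auto simp: compose_eq PiE_iff)
  ultimately show "composite (OVI R) A B D g f \<in> homset (OVI R) A D"
    using bA unfolding f(1) g(1) OVI_def
    by (auto simp: OVI_hom_iff[OF D] compose_eq Pi_def)
next
  fix A B :: "('r, 'v, 'i) based_module" and f
  assume "f \<in> homset (OVI R) A B"
  then show "composite (OVI R) A B B (ident (OVI R) B) f = f"
    and "composite (OVI R) A A B f (ident (OVI R) A) = f"
    unfolding OVI_def OVI_hom_def linear_maps_def
    by (auto simp: PiE_iff Pi_def intro!: Id_compose compose_Id)
next
  fix A B D E :: "('r, 'v, 'i) based_module" and f g h
  assume "f \<in> homset (OVI R) A B" "g \<in> homset (OVI R) B D" "h \<in> homset (OVI R) D E"
  then show "composite (OVI R) A D E h (composite (OVI R) A B D g f) =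
             composite (OVI R) A B E (composite (OVI R) B D E h g) f"
    unfolding OVI_def OVI_hom_def linear_maps_def
    by (auto simp: PiE_iff Pi_def intro!: compose_assoc)
qed

lemma free_module_carrierD:
  assumes "c \<in> carrier (free_module K S)"
  shows "s \<in> S \<Longrightarrow> c s \<in> carrier K" "finite {s \<in> S. c s \<noteq> \<zero>\<^bsub>K\<^esub>}" "c \<in> extensional S"
  using assms by (auto simp: free_module_def PiE_iff)

lemma module_free_module:
  assumes "cring K" shows "module K (free_module K S)"
proof -
  interpret K: cring K by (rule assms)
  have add: "(\<lambda>s\<in>S. c s \<oplus>\<^bsub>K\<^esub> d s) \<in> carrier (free_module K S)"
    if "c \<in> carrier (free_module K S)" "d \<in> carrier (free_module K S)" for c d
  proof -
    have "finite {s \<in> S. c s \<oplus>\<^bsub>K\<^esub> d s \<noteq> \<zero>\<^bsub>K\<^esub>}"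
      by (rule finite_subset[of _ "{s \<in> S. c s \<noteq> \<zero>\<^bsub>K\<^esub>} \<union> {s \<in> S. d s \<noteq> \<zero>\<^bsub>K\<^esub>}"])
        (use that in \<open>auto simp: free_module_def\<close>)
    with that show ?thesis
      by (auto simp: free_module_def PiE_iff cong: conj_cong)
  qed
  have smult: "(\<lambda>s\<in>S. a \<otimes>\<^bsub>K\<^esub> c s) \<in> carrier (free_module K S)"
    if "c \<in> carrier (free_module K S)" "a \<in> carrier K" for a c
  proof -
    have "finite {s \<in> S. a \<otimes>\<^bsub>K\<^esub> c s \<noteq> \<zero>\<^bsub>K\<^esub>}"
      by (rule finite_subset[of _ "{s \<in> S. c s \<noteq> \<zero>\<^bsub>K\<^esub>}"])
        (use that in \<open>auto simp: free_module_def\<close>)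
    with that show ?thesis
      by (auto simp: free_module_def PiE_iff cong: conj_cong)
  qed
  have neg: "\<exists>d\<in>carrier (free_module K S). (\<lambda>s\<in>S. d s \<oplus>\<^bsub>K\<^esub> c s) = (\<lambda>s\<in>S. \<zero>\<^bsub>K\<^esub>)"
    if c: "c \<in> carrier (free_module K S)" for c
  proof (rule bexI[of _ "\<lambda>s\<in>S. (\<ominus>\<^bsub>K\<^esub> \<one>\<^bsub>K\<^esub>) \<otimes>\<^bsub>K\<^esub> c s"])
    show "(\<lambda>s\<in>S. (\<lambda>s\<in>S. (\<ominus>\<^bsub>K\<^esub> \<one>\<^bsub>K\<^esub>) \<otimes>\<^bsub>K\<^esub> c s) s \<oplus>\<^bsub>K\<^esub> c s) = (\<lambda>s\<in>S. \<zero>\<^bsub>K\<^esub>)"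
      using free_module_carrierD(1)[OF c] by (auto simp: K.l_minus K.l_neg intro!: restrict_ext)
  qed (use smult[OF c] in auto)
  have ab: "abelian_group (free_module K S)"
  proof (rule abelian_groupI)
    show "\<zero>\<^bsub>free_module K S\<^esub> \<in> carrier (free_module K S)"
      by (auto simp: free_module_def cong: conj_cong)
  next
    fix c assume "c \<in> carrier (free_module K S)"
    then show "\<exists>d\<in>carrier (free_module K S). d \<oplus>\<^bsub>free_module K S\<^esub> c = \<zero>\<^bsub>free_module K S\<^esub>"
      using neg[of c] by (simp add: free_module_def)
  next
    fix c d assume "c \<in> carrier (free_module K S)" "d \<in> carrier (free_module K S)"
    then show "c \<oplus>\<^bsub>free_module K S\<^esub> d \<in> carrier (free_module K S)"
      using add[of c d] by (simp add: free_module_def)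
  qed (auto simp: free_module_def PiE_iff K.add.m_ac extensional_def restrict_def fun_eq_iff)
  show ?thesis
  proof (rule moduleI[OF assms ab])
    fix a c assume "a \<in> carrier K" "c \<in> carrier (free_module K S)"
    then show "a \<odot>\<^bsub>free_module K S\<^esub> c \<in> carrier (free_module K S)"
      using smult[of c a] by (simp add: free_module_def)
  qed (auto simp: free_module_def PiE_iff K.m_assoc K.l_distr K.r_distr extensional_def
      restrict_def fun_eq_iff)
qed

lemma free_map_eq:
  assumes "cring K" "c \<in> carrier (free_module K S)" "t \<in> T"
    and "finite S'" "{s \<in> S. c s \<noteq> \<zero>\<^bsub>K\<^esub>} \<subseteq> S'" "S' \<subseteq> S"
  shows "free_map K S T f c t = (\<Oplus>\<^bsub>K\<^esub>s\<in>{s \<in> S'. f s = t}. c s)"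
proof -
  interpret K: cring K by (rule assms)
  have "(\<Oplus>\<^bsub>K\<^esub>s\<in>{s \<in> S. c s \<noteq> \<zero>\<^bsub>K\<^esub> \<and> f s = t}. c s) = (\<Oplus>\<^bsub>K\<^esub>s\<in>{s \<in> S'. f s = t}. c s)"
    using assms free_module_carrierD[OF assms(2)]
    by (intro K.add.finprod_mono_neutral_cong_left) auto
  with assms show ?thesis
    by (simp add: free_map_def)
qed

lemma free_map_closed:
  assumes "cring K" "f \<in> S \<rightarrow> T" "c \<in> carrier (free_module K S)"
  shows "free_map K S T f c \<in> carrier (free_module K T)"
    and "{t \<in> T. free_map K S T f c t \<noteq> \<zero>\<^bsub>K\<^esub>} \<subseteq> f ` {s \<in> S. c s \<noteq> \<zero>\<^bsub>K\<^esub>}"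
proof -
  interpret K: cring K by (rule assms)
  show *: "{t \<in> T. free_map K S T f c t \<noteq> \<zero>\<^bsub>K\<^esub>} \<subseteq> f ` {s \<in> S. c s \<noteq> \<zero>\<^bsub>K\<^esub>}"
  proof
    fix t assume t: "t \<in> {t \<in> T. free_map K S T f c t \<noteq> \<zero>\<^bsub>K\<^esub>}"
    show "t \<in> f ` {s \<in> S. c s \<noteq> \<zero>\<^bsub>K\<^esub>}"
    proof (rule ccontr)
      assume "t \<notin> f ` {s \<in> S. c s \<noteq> \<zero>\<^bsub>K\<^esub>}"
      then have empty: "{s \<in> S. c s \<noteq> \<zero>\<^bsub>K\<^esub> \<and> f s = t} = {}"
        by auto
      have "free_map K S T f c t = (\<Oplus>\<^bsub>K\<^esub>s\<in>{s \<in> S. c s \<noteq> \<zero>\<^bsub>K\<^esub> \<and> f s = t}. c s)"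
        using t assms(3) by (simp add: free_map_def)
      with t show False
        unfolding empty by simp
    qed
  qed
  have "finite {t \<in> T. free_map K S T f c t \<noteq> \<zero>\<^bsub>K\<^esub>}"
    using finite_subset[OF *] free_module_carrierD(2)[OF assms(3)] by blast
  moreover have "free_map K S T f c \<in> T \<rightarrow>\<^sub>E carrier K"
    using assms(3) free_module_carrierD(1)[OF assms(3)]
    by (auto simp: free_map_def Pi_def intro!: K.finsum_closed)
  ultimately show "free_map K S T f c \<in> carrier (free_module K T)"
    by (simp add: free_module_def)
qed

lemma free_map_linear:
  assumes "cring K" "f \<in> S \<rightarrow> T"
  shows "free_map K S T f \<in> linear_maps K (free_module K S) (free_module K T)"
proof -
  interpret K: cring K by (rule assms)
  interpret S: module K "free_module K S" by (rule module_free_module[OF assms(1)])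
  have "free_map K S T f (c \<oplus>\<^bsub>free_module K S\<^esub> d)
      = free_map K S T f c \<oplus>\<^bsub>free_module K T\<^esub> free_map K S T f d"
    if c: "c \<in> carrier (free_module K S)" and d: "d \<in> carrier (free_module K S)" for c d
  proof -
    define S' where "S' = {s \<in> S. c s \<noteq> \<zero>\<^bsub>K\<^esub>} \<union> {s \<in> S. d s \<noteq> \<zero>\<^bsub>K\<^esub>}"
    have S': "finite S'" "S' \<subseteq> S" "{s \<in> S. c s \<noteq> \<zero>\<^bsub>K\<^esub>} \<subseteq> S'" "{s \<in> S. d s \<noteq> \<zero>\<^bsub>K\<^esub>} \<subseteq> S'"
      using free_module_carrierD(2)[OF c] free_module_carrierD(2)[OF d] by (auto simp: S'_def)
    have cd: "c \<oplus>\<^bsub>free_module K S\<^esub> d \<in> carrier (free_module K S)"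
      using c d by simp
    have cS': "c s \<in> carrier K" "d s \<in> carrier K" if "s \<in> S'" for s
      using that S'(2) free_module_carrierD(1)[OF c] free_module_carrierD(1)[OF d] by blast+
    have pt: "(c \<oplus>\<^bsub>free_module K S\<^esub> d) s = c s \<oplus>\<^bsub>K\<^esub> d s" if "s \<in> S'" for s
      using that S'(2) by (auto simp: free_module_def)
    have S'': "{s \<in> S. (c \<oplus>\<^bsub>free_module K S\<^esub> d) s \<noteq> \<zero>\<^bsub>K\<^esub>} \<subseteq> S'"
      by (auto simp: S'_def free_module_def)
    have "free_map K S T f (c \<oplus>\<^bsub>free_module K S\<^esub> d) t
        = free_map K S T f c t \<oplus>\<^bsub>K\<^esub> free_map K S T f d t" if t: "t \<in> T" for t
    proof -
      have "free_map K S T f (c \<oplus>\<^bsub>free_module K S\<^esub> d) t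
          = (\<Oplus>\<^bsub>K\<^esub>s\<in>{s \<in> S'. f s = t}. (c \<oplus>\<^bsub>free_module K S\<^esub> d) s)"
        by (rule free_map_eq[OF assms(1) cd t S'(1) S'' S'(2)])
      also have "\<dots> = (\<Oplus>\<^bsub>K\<^esub>s\<in>{s \<in> S'. f s = t}. c s \<oplus>\<^bsub>K\<^esub> d s)"
        by (rule K.finsum_cong') (use pt cS' in auto)
      also have "\<dots> = (\<Oplus>\<^bsub>K\<^esub>s\<in>{s \<in> S'. f s = t}. c s) \<oplus>\<^bsub>K\<^esub> (\<Oplus>\<^bsub>K\<^esub>s\<in>{s \<in> S'. f s = t}. d s)"
        by (rule K.finsum_addf) (use cS' in auto)
      also have "\<dots> = free_map K S T f c t \<oplus>\<^bsub>K\<^esub> free_map K S T f d t"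
        using free_map_eq[OF assms(1) c t S'(1,3,2)] free_map_eq[OF assms(1) d t S'(1,4,2)] by simp
      finally show ?thesis .
    qed
    note eq = this
    show ?thesis
    proof (rule extensionalityI[of _ T])
      show "free_map K S T f (c \<oplus>\<^bsub>free_module K S\<^esub> d) \<in> extensional T"
        by (rule free_module_carrierD(3)[OF free_map_closed(1)[OF assms cd]])
      show "free_map K S T f c \<oplus>\<^bsub>free_module K T\<^esub> free_map K S T f d \<in> extensional T"
        by (simp add: free_module_def)
      fix t assume t: "t \<in> T"
      show "free_map K S T f (c \<oplus>\<^bsub>free_module K S\<^esub> d) t
          = (free_map K S T f c \<oplus>\<^bsub>free_module K T\<^esub> free_map K S T f d) t"
        unfolding eq[OF t] using t by (simp add: free_module_def)
    qed
  qed
  moreover have "free_map K S T f (a \<odot>\<^bsub>free_module K S\<^esub> c) = a \<odot>\<^bsub>free_module K T\<^esub> free_map K S T f c"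
    if a: "a \<in> carrier K" and c: "c \<in> carrier (free_module K S)" for a c
  proof -
    define S' where "S' = {s \<in> S. c s \<noteq> \<zero>\<^bsub>K\<^esub>}"
    have S': "finite S'" "S' \<subseteq> S" "{s \<in> S. c s \<noteq> \<zero>\<^bsub>K\<^esub>} \<subseteq> S'"
      using free_module_carrierD(2)[OF c] by (auto simp: S'_def)
    have ac: "a \<odot>\<^bsub>free_module K S\<^esub> c \<in> carrier (free_module K S)"
      using a c by simp
    have cS': "c s \<in> carrier K" if "s \<in> S'" for s
      using that S'(2) free_module_carrierD(1)[OF c] by blast
    have pt: "(a \<odot>\<^bsub>free_module K S\<^esub> c) s = a \<otimes>\<^bsub>K\<^esub> c s" if "s \<in> S'" for s
      using that S'(2) by (auto simp: free_module_def)
    have S'': "{s \<in> S. (a \<odot>\<^bsub>free_module K S\<^esub> c) s \<noteq> \<zero>\<^bsub>K\<^esub>} \<subseteq> S'"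
      using a by (auto simp: S'_def free_module_def)
    have "free_map K S T f (a \<odot>\<^bsub>free_module K S\<^esub> c) t = a \<otimes>\<^bsub>K\<^esub> free_map K S T f c t"
      if t: "t \<in> T" for t
    proof -
      have "free_map K S T f (a \<odot>\<^bsub>free_module K S\<^esub> c) t
          = (\<Oplus>\<^bsub>K\<^esub>s\<in>{s \<in> S'. f s = t}. (a \<odot>\<^bsub>free_module K S\<^esub> c) s)"
        by (rule free_map_eq[OF assms(1) ac t S'(1) S'' S'(2)])
      also have "\<dots> = (\<Oplus>\<^bsub>K\<^esub>s\<in>{s \<in> S'. f s = t}. a \<otimes>\<^bsub>K\<^esub> c s)"
        by (rule K.finsum_cong') (use pt cS' a in auto)
      also have "\<dots> = a \<otimes>\<^bsub>K\<^esub> (\<Oplus>\<^bsub>K\<^esub>s\<in>{s \<in> S'. f s = t}. c s)"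
        by (rule K.finsum_rdistr[symmetric]) (use S' cS' a in auto)
      also have "\<dots> = a \<otimes>\<^bsub>K\<^esub> free_map K S T f c t"
        using free_map_eq[OF assms(1) c t S'(1,3,2)] by simp
      finally show ?thesis .
    qed
    note eq = this
    show ?thesis
    proof (rule extensionalityI[of _ T])
      show "free_map K S T f (a \<odot>\<^bsub>free_module K S\<^esub> c) \<in> extensional T"
        by (rule free_module_carrierD(3)[OF free_map_closed(1)[OF assms ac]])
      show "a \<odot>\<^bsub>free_module K T\<^esub> free_map K S T f c \<in> extensional T"
        by (simp add: free_module_def)
      fix t assume t: "t \<in> T"
      show "free_map K S T f (a \<odot>\<^bsub>free_module K S\<^esub> c) t
          = (a \<odot>\<^bsub>free_module K T\<^esub> free_map K S T f c) t"
        unfolding eq[OF t] using t by (simp add: free_module_def)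
    qed
  qed
  moreover have "free_map K S T f \<in> extensional (carrier (free_module K S))"
    by (simp add: free_map_def)
  ultimately show ?thesis
    using free_map_closed(1)[OF assms] by (auto simp: linear_maps_def PiE_iff)
qed

lemma free_map_compose:
  assumes "cring K" and f: "f \<in> S \<rightarrow> T" and g: "g \<in> T \<rightarrow> U"
    and h: "\<And>s. s \<in> S \<Longrightarrow> h s = g (f s)" and c: "c \<in> carrier (free_module K S)"
  shows "free_map K S U h c = free_map K T U g (free_map K S T f c)"
proof -
  interpret K: cring K by (rule assms)
  define S' where "S' = {s \<in> S. c s \<noteq> \<zero>\<^bsub>K\<^esub>}"
  have S': "finite S'" "S' \<subseteq> S" "{s \<in> S. c s \<noteq> \<zero>\<^bsub>K\<^esub>} \<subseteq> S'"
    using free_module_carrierD(2)[OF c] by (auto simp: S'_def)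
  have cS': "c s \<in> carrier K" if "s \<in> S'" for s
    using that S' free_module_carrierD(1)[OF c] by auto
  note closed = free_map_closed[OF assms(1) f c]
  have T': "finite (f ` S')" "{t \<in> T. free_map K S T f c t \<noteq> \<zero>\<^bsub>K\<^esub>} \<subseteq> f ` S'" "f ` S' \<subseteq> T"
    using S' closed(2) f by (auto simp: S'_def)
  have "free_map K S U h c u = free_map K T U g (free_map K S T f c) u" if u: "u \<in> U" for u
  proof -
    have "free_map K T U g (free_map K S T f c) u
        = (\<Oplus>\<^bsub>K\<^esub>t\<in>{t \<in> f ` S'. g t = u}. free_map K S T f c t)"
      by (rule free_map_eq[OF assms(1) closed(1) u T'])
    also have "\<dots> = (\<Oplus>\<^bsub>K\<^esub>t\<in>{t \<in> f ` S'. g t = u}. \<Oplus>\<^bsub>K\<^esub>s\<in>{s \<in> S'. f s = t}. c s)"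
      using T' free_map_eq[OF assms(1) c _ S'(1,3,2), of _ T f] cS'
      by (intro K.finsum_cong') (auto intro!: K.finsum_closed)
    also have "\<dots> = (\<Oplus>\<^bsub>K\<^esub>s\<in>(\<Union>t\<in>{t \<in> f ` S'. g t = u}. {s \<in> S'. f s = t}). c s)"
      using S' cS' by (intro K.add.finprod_UN_disjoint[symmetric]) (auto simp: pairwise_def disjnt_def)
    also have "(\<Union>t\<in>{t \<in> f ` S'. g t = u}. {s \<in> S'. f s = t}) = {s \<in> S'. h s = u}"
      using S' h by auto
    also have "(\<Oplus>\<^bsub>K\<^esub>s\<in>{s \<in> S'. h s = u}. c s) = free_map K S U h c u"
      by (rule free_map_eq[OF assms(1) c u S'(1,3,2), symmetric])
    finally show ?thesis by simp
  qed
  moreover have "free_map K S U h c \<in> extensional U"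
    using c by (simp add: free_map_def)
  moreover have "free_map K T U g (free_map K S T f c) \<in> extensional U"
    by (rule free_module_carrierD(3)[OF free_map_closed(1)[OF assms(1) g closed(1)]])
  ultimately show ?thesis
    by (metis extensionalityI)
qed

lemma free_map_id:
  assumes "cring K" and c: "c \<in> carrier (free_module K S)" and h: "\<And>s. s \<in> S \<Longrightarrow> h s = s"
  shows "free_map K S S h c = c"
proof -
  interpret K: cring K by (rule assms)
  have "free_map K S S h c s = c s" if s: "s \<in> S" for s
  proof -
    let ?S' = "insert s {s \<in> S. c s \<noteq> \<zero>\<^bsub>K\<^esub>}"
    have "free_map K S S h c s = (\<Oplus>\<^bsub>K\<^esub>s\<in>{s' \<in> ?S'. h s' = s}. c s)"
      using free_module_carrierD(2)[OF c] s by (intro free_map_eq[OF assms(1) c s]) auto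
    also have "{s' \<in> ?S'. h s' = s} = {s}"
      using h s by auto
    finally show ?thesis
      using free_module_carrierD(1)[OF c s] by simp
  qed
  moreover have "free_map K S S h c \<in> extensional S"
    using c by (simp add: free_map_def)
  ultimately show ?thesis
    using free_module_carrierD(3)[OF c] by (metis extensionalityI)
qed

theorem principal_projective_is_cat_module:
  assumes "cring K" and "category C" and x: "x \<in> obj C"
  shows "is_cat_module K C (principal_projective K C x)"
proof -
  interpret category C by (rule assms)
  have clo: "composite C x y z g \<in> homset C x y \<rightarrow> homset C x z"
    if "y \<in> obj C" "z \<in> obj C" "g \<in> homset C y z" for y z g
    using that x comp_closed by auto
  show ?thesis
    unfolding is_cat_module_def principal_projective_def
    using x clo comp_ident_left comp_assoc
    by (auto intro!: module_free_module free_map_linear free_map_id free_map_compose \<open>cring K\<close>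
        simp del: restrict_apply)
qed

lemma module_sum_module:
  fixes V :: "nat \<Rightarrow> ('k, 'a) module"
  assumes "cring K" and V: "\<And>i. i < n \<Longrightarrow> module K (V i)"
  shows "module K (sum_module n V)"
proof -
  have A: "abelian_group (V i)" if "i < n" for i
    using V[OF that] by (simp add: module_def)
  have ab: "abelian_group (sum_module n V)"
  proof (rule abelian_groupI)
    fix u assume u: "u \<in> carrier (sum_module n V)"
    show "\<exists>w\<in>carrier (sum_module n V). w \<oplus>\<^bsub>sum_module n V\<^esub> u = \<zero>\<^bsub>sum_module n V\<^esub>"
      by (rule bexI[of _ "\<lambda>i\<in>{..<n}. \<ominus>\<^bsub>V i\<^esub> u i"])
        (use u A in \<open>auto simp: sum_module_def PiE_iff abelian_group.l_neg abelian_group.a_inv_closed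
            intro!: restrict_ext\<close>)
  qed (use A in \<open>auto simp: sum_module_def PiE_iff extensional_def restrict_def fun_eq_iff
        abelian_group.axioms abelian_monoid.a_closed abelian_monoid.zero_closed
        abelian_monoid.a_assoc abelian_monoid.l_zero intro: abelian_monoid.a_comm\<close>)
  show ?thesis
    by (rule moduleI[OF \<open>cring K\<close> ab])
      (use V in \<open>auto simp: sum_module_def PiE_iff extensional_def restrict_def fun_eq_iff
        module.smult_closed[of K] module.smult_l_distr[of K] module.smult_r_distr[of K]
        module.smult_assoc1[of K] module.smult_one[of K]\<close>)
qed

theorem direct_sum_is_cat_module:
  assumes "cring K" and "category C" and M: "\<And>i. i < n \<Longrightarrow> is_cat_module K C (M i)"
  shows "is_cat_module K C (direct_sum n M)"
proof -
  interpret category C by (rule assms)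
  have M1: "module K (mobj (M i) x)" if "i < n" "x \<in> obj C" for i x
    using M[OF that(1)] that(2) by (simp add: is_cat_module_def)
  have M2: "mmap (M i) x y f \<in> linear_maps K (mobj (M i) x) (mobj (M i) y)"
    if "i < n" "x \<in> obj C" "y \<in> obj C" "f \<in> homset C x y" for i x y f
    using M[OF that(1)] that by (simp add: is_cat_module_def)
  have M3: "mmap (M i) x x (ident C x) m = m" if "i < n" "x \<in> obj C" "m \<in> carrier (mobj (M i) x)"
    for i x m
    using M[OF that(1)] that by (simp add: is_cat_module_def)
  have M4: "mmap (M i) x z (composite C x y z g f) m = mmap (M i) y z g (mmap (M i) x y f m)"
    if "i < n" "x \<in> obj C" "y \<in> obj C" "z \<in> obj C" "f \<in> homset C x y" "g \<in> homset C y z"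
      "m \<in> carrier (mobj (M i) x)" for i x y z f g m
    using M[OF that(1)] that by (simp add: is_cat_module_def)
  have mod': "module K (sum_module n (\<lambda>i. mobj (M i) x))" if "x \<in> obj C" for x
    using M1 that assms(1) by (intro module_sum_module) auto
  have clo: "mmap (M i) x y f m \<in> carrier (mobj (M i) y)"
    if "i < n" "x \<in> obj C" "y \<in> obj C" "f \<in> homset C x y" "m \<in> carrier (mobj (M i) x)" for i x y f m
    using M2[OF that(1-4)] that(5) by (auto simp: linear_maps_def)
  have "mmap (direct_sum n M) x y f \<in> linear_maps K (mobj (direct_sum n M) x) (mobj (direct_sum n M) y)"
    if xy: "x \<in> obj C" "y \<in> obj C" "f \<in> homset C x y" for x y f
  proof -
    let ?V = "sum_module n (\<lambda>i. mobj (M i) x)"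
    have "u \<oplus>\<^bsub>?V\<^esub> w \<in> carrier ?V" "a \<odot>\<^bsub>?V\<^esub> u \<in> carrier ?V"
      if "u \<in> carrier ?V" "w \<in> carrier ?V" "a \<in> carrier K" for u w a
      using mod'[OF xy(1)] that
      by (auto simp: module_def abelian_group_def intro!: abelian_monoid.a_closed module.smult_closed)
    note V = this
    have lin: "mmap (M i) x y f (m \<oplus>\<^bsub>mobj (M i) x\<^esub> m')
          = mmap (M i) x y f m \<oplus>\<^bsub>mobj (M i) y\<^esub> mmap (M i) x y f m'"
        "mmap (M i) x y f (a \<odot>\<^bsub>mobj (M i) x\<^esub> m) = a \<odot>\<^bsub>mobj (M i) y\<^esub> mmap (M i) x y f m"
      if "i < n" "m \<in> carrier (mobj (M i) x)" "m' \<in> carrier (mobj (M i) x)" "a \<in> carrier K" for i m m' a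
      using M2[OF that(1) xy] that by (auto simp: linear_maps_def)
    have K: "\<zero>\<^bsub>K\<^esub> \<in> carrier K"
      using \<open>cring K\<close> by (simp add: cring.axioms(1) ring.ring_simprules(2))
    have F: "mmap (direct_sum n M) x y f u = (\<lambda>i\<in>{..<n}. mmap (M i) x y f (u i))"
      if "u \<in> carrier ?V" for u
      using that by (simp add: direct_sum_def)
    have Vi: "u i \<in> carrier (mobj (M i) x)" if "u \<in> carrier ?V" "i < n" for u i
      using that by (auto simp: sum_module_def)
    have "mmap (direct_sum n M) x y f \<in> extensional (carrier ?V)"
      by (simp add: direct_sum_def)
    moreover have "mmap (direct_sum n M) x y f u \<in> carrier (sum_module n (\<lambda>i. mobj (M i) y))"
      if "u \<in> carrier ?V" for u
      unfolding F[OF that] using clo[OF _ xy] Vi[OF that] by (auto simp: sum_module_def)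
    moreover have "mmap (direct_sum n M) x y f (u \<oplus>\<^bsub>?V\<^esub> w) = mmap (direct_sum n M) x y f u
        \<oplus>\<^bsub>sum_module n (\<lambda>i. mobj (M i) y)\<^esub> mmap (direct_sum n M) x y f w"
      if u: "u \<in> carrier ?V" and w: "w \<in> carrier ?V" for u w
      unfolding F[OF u] F[OF w] F[OF V(1)[OF u w K]] using lin(1) Vi[OF u] Vi[OF w] K
      by (auto simp: sum_module_def intro!: restrict_ext)
    moreover have "mmap (direct_sum n M) x y f (a \<odot>\<^bsub>?V\<^esub> u)
        = a \<odot>\<^bsub>sum_module n (\<lambda>i. mobj (M i) y)\<^esub> mmap (direct_sum n M) x y f u"
      if u: "u \<in> carrier ?V" and a: "a \<in> carrier K" for u a
      unfolding F[OF u] F[OF V(2)[OF u u a]] using lin(2)[OF _ Vi[OF u] Vi[OF u] a] a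
      by (auto simp: sum_module_def intro!: restrict_ext)
    ultimately show ?thesis
      by (auto simp: linear_maps_def PiE_iff direct_sum_def)
  qed
  moreover have "mmap (direct_sum n M) x x (ident C x) u = u"
    if "x \<in> obj C" "u \<in> carrier (mobj (direct_sum n M) x)" for x u
    using that M3 by (auto simp: direct_sum_def sum_module_def PiE_iff extensional_def fun_eq_iff)
  moreover have "mmap (direct_sum n M) x z (composite C x y z g f) u
      = mmap (direct_sum n M) y z g (mmap (direct_sum n M) x y f u)"
    if "x \<in> obj C" "y \<in> obj C" "z \<in> obj C" "f \<in> homset C x y" "g \<in> homset C y z"
      "u \<in> carrier (mobj (direct_sum n M) x)" for x y z f g u
    using that M4 clo by (auto simp: direct_sum_def sum_module_def PiE_iff intro!: restrict_ext)
  ultimately show ?thesis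
    using mod' unfolding is_cat_module_def by (auto simp: direct_sum_def)
qed

theorem cat_submodule_is_cat_module:
  assumes M: "is_cat_module K C M" and N: "is_cat_submodule K C M N" and "category C"
  shows "is_cat_module K C (cat_submodule M N)"
proof -
  interpret category C by (rule assms)
  have sub: "submodule (N x) K (mobj M x)" and mod: "module K (mobj M x)" if "x \<in> obj C" for x
    using M N that by (auto simp: is_cat_submodule_def is_cat_module_def)
  have N1: "N x \<subseteq> carrier (mobj M x)"
    "\<And>u w. u \<in> N x \<Longrightarrow> w \<in> N x \<Longrightarrow> u \<oplus>\<^bsub>mobj M x\<^esub> w \<in> N x"
    "\<And>a u. a \<in> carrier K \<Longrightarrow> u \<in> N x \<Longrightarrow> a \<odot>\<^bsub>mobj M x\<^esub> u \<in> N x" if "x \<in> obj C" for x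
    using module.submoduleE[OF mod[OF that] sub[OF that]] by auto
  have N2: "mmap M x y f u \<in> N y"
    if "x \<in> obj C" "y \<in> obj C" "f \<in> homset C x y" "u \<in> N x" for x y f u
    using N that by (auto simp: is_cat_submodule_def image_subset_iff)
  have N3: "restrict (mmap M x y f) (N x)
      \<in> linear_maps K ((mobj M x)\<lparr>carrier := N x\<rparr>) ((mobj M y)\<lparr>carrier := N y\<rparr>)"
    if xy: "x \<in> obj C" "y \<in> obj C" "f \<in> homset C x y" for x y f
  proof -
    have "mmap M x y f \<in> linear_maps K (mobj M x) (mobj M y)"
      using M xy by (auto simp: is_cat_module_def)
    with N1[OF xy(1)] N2[OF xy] show ?thesis
      by (auto simp: linear_maps_def subset_iff)
  qed
  have N4: "module K ((mobj M x)\<lparr>carrier := N x\<rparr>)" if "x \<in> obj C" for x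
    using submodule.submodule_is_module[OF sub mod] that by blast
  have "mmap M x x (ident C x) u = u" if "x \<in> obj C" "u \<in> N x" for x u
    using M N1(1)[OF that(1)] that by (auto simp: is_cat_module_def)
  moreover have "mmap M x z (composite C x y z g f) u = mmap M y z g (mmap M x y f u)"
    if "x \<in> obj C" "y \<in> obj C" "z \<in> obj C" "f \<in> homset C x y" "g \<in> homset C y z" "u \<in> N x"
    for x y z f g u
    using M N1(1)[OF that(1)] that by (auto simp: is_cat_module_def)
  ultimately show ?thesis
    using N2 N3 N4 unfolding is_cat_module_def cat_submodule_def by (simp add: comp_closed)
qed

end

(*
  Fix generators of a finitely generated module, so that a submodule pulls back to a submodule of a
  sum of principal projectives.  Numbering basis vectors from the largest index downwards turns
  morphisms into echelon matrices over R, that is, into words whose letters are rows.  Rows are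
  totally ordered through coordinates phi_k : R -> Z and a finite-index ideal J on which the phi_k
  are jointly injective; the order is invariant under translation by J.  Comparing words from the
  first row on gives a total order preserved by all morphisms which, modulo J, only insert rows:
  such a morphism translates the first rows in which two words differ by the same element of J.

  The order is not well-founded, since the coordinates may be negative, and no useful set of
  positive words is preserved by enough morphisms.  It suffices to control an element relative to
  its leading word v: every term that agrees with v in the earlier rows must have a nonnegative next
  row.  Unipotent automorphisms bring every element into this form, proceeding row by row, and
  subtracting a translate of an element of this form with the same leading word does not affect it
  up to the first row in which the leading word drops.  Hence nonnegative leading words, which are
  well-ordered, can be used as in Groebner theory.  Higman's lemma makes their embeddability almost
  full, an embedding of leading words is realised by a morphism because the pivot rows span all rows
  that may occur below them, and the leading coefficients are controlled by the noetherian ring K.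
*)

theory Submission
  imports Defs "HOL-Library.Ramsey" "HOL-Library.Sublist" "HOL-Library.List_Lexorder"
begin

section \<open>Almost full relations and Higman's lemma\<close>

text \<open>Two constraints dictate the coordinates. Additive maps from R to the integers do not see
  torsion, so they separate elements only on J = mR, where m kills their common kernel; residues
  modulo J are recorded by a separate number, which translation by J leaves alone. Moreover,
  automorphisms change an entry of a matrix only after the pivot of its column: the 1 at the pivot
  and the zeros before it are rigid. Hence \<phi>_k(1) must be nonnegative from the start, while an
  element of J that is large in all coordinates at once moves the other entries. Both are achieved
  by choosing the signs of the \<phi>_k. Coefficients multiply rows from the right, and the
  resulting shifts stay in J because J is an ideal.

  The Groebner argument is a minimal counterexample rather than a division algorithm: each new
  generator has the smallest leading word among all elements in relative normal form that are not
  generated so far, and a remainder, once normalized again, contradicts this choice.\<close>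

definition almost_full_on :: "('a \<Rightarrow> 'a \<Rightarrow> bool) \<Rightarrow> 'a set \<Rightarrow> bool" where
  "almost_full_on P A \<longleftrightarrow> (\<forall>f :: nat \<Rightarrow> 'a. (\<forall>i. f i \<in> A) \<longrightarrow> (\<exists>i j. i < j \<and> P (f i) (f j)))"

lemma almost_full_onD:
  assumes "almost_full_on P A" "\<And>i. f i \<in> A"
  obtains i j :: nat where "i < j" "P (f i) (f j)"
  using assms unfolding almost_full_on_def by blast

text \<open>Colour a pair of indices by whether P holds along it. A homogeneous set of the failing
  colour would be a sequence without a good pair, so Ramsey's theorem leaves only the other colour.
  Chaining good pairs would not do, as P need not be transitive.\<close>

lemma almost_full_on_subsequence:
  fixes f :: "nat \<Rightarrow> 'a"
  assumes "almost_full_on P A" and f: "\<And>i. f i \<in> A"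
  obtains \<kappa> :: "nat \<Rightarrow> nat" where "strict_mono \<kappa>" "\<And>i j. i < j \<Longrightarrow> P (f (\<kappa> i)) (f (\<kappa> j))"
proof -
  \<comment> \<open>Ramsey's theorem colours unordered pairs; \<open>Min\<close> and
    \<open>Max\<close> recover which index comes first.\<close>
  define c where "c U = (if P (f (Min U)) (f (Max U)) then 0 else (1::nat))" for U
  have "\<forall>x\<in>(UNIV :: nat set). \<forall>y\<in>UNIV. x \<noteq> y \<longrightarrow> c {x, y} < 2"
    by (simp add: c_def)
  from Ramsey2[OF infinite_UNIV_nat this] obtain Y t where Y: "infinite Y" "t < 2"
    and t: "\<And>x y. x \<in> Y \<Longrightarrow> y \<in> Y \<Longrightarrow> x \<noteq> y \<Longrightarrow> c {x, y} = t"
    by blast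
  define \<kappa> where "\<kappa> = enumerate Y"
  have \<kappa>: "strict_mono \<kappa>" "\<And>i. \<kappa> i \<in> Y"
    using Y(1) by (auto simp: \<kappa>_def strict_mono_enumerate enumerate_in_set)
  have c: "c {\<kappa> i, \<kappa> j} = (if P (f (\<kappa> i)) (f (\<kappa> j)) then 0 else 1)" if "i < j" for i j
    using strict_monoD[OF \<kappa>(1) that] by (simp add: c_def min_def max_def)
  have ct: "c {\<kappa> i, \<kappa> j} = t" if "i < j" for i j
    using t[OF \<kappa>(2) \<kappa>(2)] strict_monoD[OF \<kappa>(1) that] by simp
  \<comment> \<open>One good pair inside the homogeneous subsequence decides the common
    colour.\<close>
  obtain i j where ij: "i < j" "P (f (\<kappa> i)) (f (\<kappa> j))"
    by (rule almost_full_onD[OF assms(1), of "\<lambda>i. f (\<kappa> i)"]) (use f in auto)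
  have "t = 0"
    using c[OF ij(1)] ct[OF ij(1)] ij(2) by simp
  then have "P (f (\<kappa> i)) (f (\<kappa> j))" if "i < j" for i j
    using c[OF that] ct[OF that] by (metis zero_neq_one)
  with \<kappa>(1) show ?thesis
    using that by blast
qed

text \<open>Thin out the sequence until P holds between any two first components; then any good pair
  of second components is good for both.\<close>

lemma almost_full_on_prod:
  assumes "almost_full_on P A" "almost_full_on Q B"
  shows "almost_full_on (\<lambda>(a, b) (a', b'). P a a' \<and> Q b b') (A \<times> B)"
  unfolding almost_full_on_def
proof (intro allI impI)
  fix f :: "nat \<Rightarrow> _"
  assume f: "\<forall>i. f i \<in> A \<times> B"
  obtain \<kappa> :: "nat \<Rightarrow> nat" where \<kappa>: "strict_mono \<kappa>" "\<And>i j. i < j \<Longrightarrow> P (fst (f (\<kappa> i))) (fst (f (\<kappa> j)))"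
    using almost_full_on_subsequence[OF assms(1), of "\<lambda>i. fst (f i)"] f by (metis mem_Times_iff)
  obtain i j where "i < j" "Q (snd (f (\<kappa> i))) (snd (f (\<kappa> j)))"
    by (rule almost_full_onD[OF assms(2), of "\<lambda>i. snd (f (\<kappa> i))"]) (use f in \<open>auto simp: mem_Times_iff\<close>)
  with \<kappa> show "\<exists>i j. i < j \<and> (case f i of (a, b) \<Rightarrow> \<lambda>(a', b'). P a a' \<and> Q b b') (f j)"
    by (intro exI[of _ "\<kappa> i"] exI[of _ "\<kappa> j"])
      (auto simp: strict_mono_def case_prod_beta)
qed

text \<open>Serves to code objects by simpler data: a good pair of codes has to give a good pair of
  objects, not conversely.\<close>

lemma almost_full_on_vimage:
  assumes "almost_full_on P B" and "\<And>a. a \<in> A \<Longrightarrow> h a \<in> B"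
    and "\<And>a b. a \<in> A \<Longrightarrow> b \<in> A \<Longrightarrow> P (h a) (h b) \<Longrightarrow> Q a b"
  shows "almost_full_on Q A"
  unfolding almost_full_on_def
proof (intro allI impI)
  fix f :: "nat \<Rightarrow> _"
  assume f: "\<forall>i. f i \<in> A"
  obtain i j where "i < j" "P (h (f i)) (h (f j))"
    by (rule almost_full_onD[OF assms(1), of "\<lambda>i. h (f i)"]) (use f assms(2) in auto)
  with f assms(3) show "\<exists>i j. i < j \<and> Q (f i) (f j)"
    by blast
qed

lemma almost_full_on_nat_le: "almost_full_on (\<le>) (UNIV :: nat set)"
  unfolding almost_full_on_def
proof (intro allI impI)
  fix f :: "nat \<Rightarrow> nat"
  define k where "k = (ARG_MIN f i. True)"
  have "f k \<le> f (Suc k)"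
    unfolding k_def by (rule arg_min_nat_le) simp
  then show "\<exists>i j. i < j \<and> f i \<le> f j"
    by blast
qed

lemma almost_full_on_finite_eq:
  assumes "finite A" shows "almost_full_on (=) A"
  unfolding almost_full_on_def
proof (intro allI impI)
  fix f :: "nat \<Rightarrow> 'a"
  assume "\<forall>i. f i \<in> A"
  then have "finite (range f)"
    using assms by (meson finite_subset image_subsetI)
  then have "\<not> inj f"
    using finite_imageD infinite_UNIV_nat by blast
  then obtain i j where "i \<noteq> j" "f i = f j"
    by (auto simp: inj_def)
  then show "\<exists>i j. i < j \<and> f i = f j"
    by (metis linorder_neqE_nat)
qed

text \<open>Closure under products, applied once per entry. For natural numbers this is Dickson's
  lemma.\<close>

lemma almost_full_on_list_all2:
  assumes "almost_full_on P A"
  shows "almost_full_on (list_all2 P) {xs. set xs \<subseteq> A \<and> length xs = n}"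
proof (induction n)
  case 0
  then show ?case by (auto simp: almost_full_on_def)
next
  case (Suc n)
  show ?case
  proof (rule almost_full_on_vimage[OF almost_full_on_prod[OF assms Suc.IH], of _ "\<lambda>xs. (hd xs, tl xs)"])
    show "(hd xs, tl xs) \<in> A \<times> {xs. set xs \<subseteq> A \<and> length xs = n}"
      if "xs \<in> {xs. set xs \<subseteq> A \<and> length xs = Suc n}" for xs
      using that by (cases xs) auto
    show "list_all2 P xs ys"
      if "xs \<in> {xs. set xs \<subseteq> A \<and> length xs = Suc n}" "ys \<in> {xs. set xs \<subseteq> A \<and> length xs = Suc n}"
        "(case (hd xs, tl xs) of (a, b) \<Rightarrow> \<lambda>(a', b'). P a a' \<and> list_all2 P b b') (hd ys, tl ys)" for xs ys
      using that by (cases xs; cases ys) auto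
  qed
qed

text \<open>The Nash-Williams minimal bad sequence argument.\<close>

theorem higman:
  assumes A: "almost_full_on P A"
  shows "almost_full_on (list_emb P) (lists A)"
proof (rule ccontr)
  define bad where "bad g \<longleftrightarrow> (\<forall>i. g i \<in> lists A) \<and> (\<forall>i j. i < j \<longrightarrow> \<not> list_emb P (g i) (g j))"
    for g :: "nat \<Rightarrow> 'a list"
  \<comment> \<open>The first n entries of g are settled, each as short as any bad sequence with the
    same earlier entries allows.\<close>
  define mini where "mini n g \<longleftrightarrow> bad g \<and>
      (\<forall>k<n. \<forall>h. bad h \<and> (\<forall>i<k. h i = g i) \<longrightarrow> length (g k) \<le> length (h k))"
    for n and g :: "nat \<Rightarrow> 'a list"
  assume "\<not> almost_full_on (list_emb P) (lists A)"
  then have "\<exists>g. bad g"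
    unfolding almost_full_on_def bad_def by blast
  then have 0: "\<exists>g. mini 0 g"
    by (simp add: mini_def)
  have step: "\<exists>h. mini (Suc n) h \<and> (\<forall>i<n. h i = g i)" if g: "mini n g" for n g
  proof -
    define h where "h = arg_min (\<lambda>h. length (h n)) (\<lambda>h. bad h \<and> (\<forall>i<n. h i = g i))"
    have "bad g \<and> (\<forall>i<n. g i = g i)"
      using g by (simp add: mini_def)
    note h = arg_min_nat_lemma[where m = "\<lambda>h. length (h n)" and P = "\<lambda>h. bad h \<and> (\<forall>i<n. h i = g i)",
        OF this, folded h_def]
    have "length (h k) \<le> length (h' k)" if "k < Suc n" "bad h'" "\<forall>i<k. h' i = h i" for k h'
    proof (cases "k = n")
      case True
      with h that show ?thesis by auto
    next
      case False
      with that have "k < n" by simp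
      with h that g show ?thesis
        unfolding mini_def by (metis order.strict_trans)
    qed
    with h show ?thesis
      by (auto simp: mini_def)
  qed
  obtain G where G: "\<And>n. mini n (G n)" "\<And>n i. i < n \<Longrightarrow> G (Suc n) i = G n i"
    using dependent_nat_choice[of mini "\<lambda>n g h. \<forall>i<n. h i = g i", OF 0 step] by blast
  define m where "m n = G (Suc n) n" for n
  \<comment> \<open>Entry i no longer changes from stage \<open>Suc i\<close> on, so the diagonal
    sequence inherits both badness and minimality from the stages.\<close>
  have Gm: "G n i = m i" if "i < n" for n i
    using that by (induction n) (auto simp: m_def G(2) less_Suc_eq)
  have badm: "bad m"
    unfolding bad_def
  proof (intro conjI allI impI)
    show "m i \<in> lists A" for i
      using G(1)[of "Suc i"] by (simp add: m_def mini_def bad_def)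
    show "\<not> list_emb P (m i) (m j)" if "i < j" for i j
    proof -
      have "bad (G (Suc j))"
        using G(1)[of "Suc j"] by (simp add: mini_def)
      then have "\<not> list_emb P (G (Suc j) i) (G (Suc j) j)"
        using that by (simp add: bad_def)
      then show ?thesis
        using that by (simp add: Gm)
    qed
  qed
  have minm: "length (m k) \<le> length (h k)" if "bad h" "\<And>i. i < k \<Longrightarrow> h i = m i" for h k
    using G(1)[of "Suc k"] that Gm[of _ "Suc k"] unfolding mini_def by auto
  have ne: "m i \<noteq> []" for i
    using badm lessI unfolding bad_def by (metis list_emb_Nil)
  have mA: "hd (m i) \<in> A" "tl (m i) \<in> lists A" for i
    using badm ne[of i] by (auto simp: bad_def) (metis list.set_sel in_listsD)+
  obtain \<kappa> :: "nat \<Rightarrow> nat" where \<kappa>: "strict_mono \<kappa>"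
    "\<And>i j. i < j \<Longrightarrow> P (hd (m (\<kappa> i))) (hd (m (\<kappa> j)))"
    using almost_full_on_subsequence[OF A, of "\<lambda>i. hd (m i)"] mA by blast
  \<comment> \<open>Dropping the heads along a subsequence with pairwise comparable heads cannot
    create a good pair, yet it shortens the entry at position \<open>\<kappa> 0\<close>, against the
    minimal choice made there.\<close>
  define h where "h i = (if i < \<kappa> 0 then m i else tl (m (\<kappa> (i - \<kappa> 0))))" for i
  have "bad h"
    unfolding bad_def
  proof (intro conjI allI impI)
    show "h i \<in> lists A" for i
      using badm mA by (auto simp: h_def bad_def)
    show "\<not> list_emb P (h i) (h j)" if ij: "i < j" for i j
    proof
      assume emb: "list_emb P (h i) (h j)"
      consider "j < \<kappa> 0" | "i < \<kappa> 0" "\<kappa> 0 \<le> j" | "\<kappa> 0 \<le> i"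
        by linarith
      then show False
      proof cases
        case 1
        with emb ij badm show False by (auto simp: h_def bad_def)
      next
        case 2
        have "list_emb P (m i) (m (\<kappa> (j - \<kappa> 0)))"
          using emb 2 ne[of "\<kappa> (j - \<kappa> 0)"] by (cases "m (\<kappa> (j - \<kappa> 0))") (auto simp: h_def)
        moreover have "i < \<kappa> (j - \<kappa> 0)"
          using 2(1) \<kappa>(1) by (metis le0 order.strict_trans2 strict_mono_less_eq)
        ultimately show False
          using badm by (auto simp: bad_def)
      next
        case 3
        define a b where "a = i - \<kappa> 0" and "b = j - \<kappa> 0"
        have ab: "a < b" using 3 ij by (auto simp: a_def b_def)
        have "list_emb P (tl (m (\<kappa> a))) (tl (m (\<kappa> b)))"
          using emb 3 ij by (simp add: h_def a_def b_def)
        with \<kappa>(2)[OF ab] have "list_emb P (m (\<kappa> a)) (m (\<kappa> b))"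
          using ne[of "\<kappa> a"] ne[of "\<kappa> b"] by (cases "m (\<kappa> a)"; cases "m (\<kappa> b)") auto
        with strict_monoD[OF \<kappa>(1) ab] badm show False
          by (auto simp: bad_def)
      qed
    qed
  qed
  then have "length (m (\<kappa> 0)) \<le> length (h (\<kappa> 0))"
    by (rule minm) (simp add: h_def)
  with ne[of "\<kappa> 0"] show False
    by (cases "m (\<kappa> 0)") (auto simp: h_def)
qed

text \<open>Skipping a letter of \<open>ys\<close> shifts p by one; matching two letters also sends
  0 to 0. In this form an embedding tells which row of the larger matrix each row of the smaller one
  goes to.\<close>

lemma list_emb_index_map:
  assumes "list_emb P xs ys"
  obtains p :: "nat \<Rightarrow> nat" where "\<And>i j. i < j \<Longrightarrow> j < length xs \<Longrightarrow> p i < p j"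
    "\<And>i. i < length xs \<Longrightarrow> p i < length ys \<and> P (xs ! i) (ys ! p i)"
  using assms
proof (induction arbitrary: thesis)
  case (list_emb_Nil ys)
  then show ?case by auto
next
  case (list_emb_Cons xs ys y)
  obtain p where p: "\<And>i j. i < j \<Longrightarrow> j < length xs \<Longrightarrow> p i < p j"
    "\<And>i. i < length xs \<Longrightarrow> p i < length ys \<and> P (xs ! i) (ys ! p i)"
    using list_emb_Cons.IH by blast
  show ?case
    by (rule list_emb_Cons.prems[of "\<lambda>i. Suc (p i)"]) (use p in auto)
next
  case (list_emb_Cons2 x y xs ys)
  obtain p where p: "\<And>i j. i < j \<Longrightarrow> j < length xs \<Longrightarrow> p i < p j"
    "\<And>i. i < length xs \<Longrightarrow> p i < length ys \<and> P (xs ! i) (ys ! p i)"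
    using list_emb_Cons2.IH by blast
  define p' where "p' i = (case i of 0 \<Rightarrow> 0 | Suc i \<Rightarrow> Suc (p i))" for i
  show ?case
  proof (rule list_emb_Cons2.prems[of p'])
    show "p' i < p' j" if "i < j" "j < length (x # xs)" for i j
      using that p(1) by (cases i; cases j) (auto simp: p'_def)
    show "p' i < length (y # ys) \<and> P ((x # xs) ! i) ((y # ys) ! p' i)" if "i < length (x # xs)" for i
      using that p(2) list_emb_Cons2.hyps by (cases i) (auto simp: p'_def)
  qed
qed

section \<open>Lexicographic order on words of equal length\<close>

lemma list_less_iff_first_difference:
  fixes xs ys :: "'a :: linorder list"
  assumes "length xs = length ys"
  shows "xs < ys \<longleftrightarrow> (\<exists>p<length xs. take p xs = take p ys \<and> xs ! p < ys ! p)"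
  unfolding list_less_def lexord_take_index_conv using assms by auto

text \<open>Fixing the length is essential: over letters a < b there is the descending chain b > ab
  > aab > ... of words of growing length.\<close>

lemma wf_list_less_fixed_length:
  fixes A :: "'a :: linorder set"
  assumes "wf {(a, b). a \<in> A \<and> b \<in> A \<and> a < b}"
  shows "wf {(xs, ys). xs \<in> lists A \<and> ys \<in> lists A \<and> length xs = n \<and> length ys = n \<and> xs < ys}"
proof (rule wf_subset[OF wf_lexn[OF assms, of n]], rule subrelI)
  fix xs ys :: "'a list"
  assume *: "(xs, ys) \<in> {(xs, ys). xs \<in> lists A \<and> ys \<in> lists A \<and> length xs = n \<and> length ys = n \<and> xs < ys}"
  then obtain us a b vs ws where "xs = us @ a # vs" "ys = us @ b # ws" "a < b"
    by (auto simp: list_less_def lexord_def)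
  with * show "(xs, ys) \<in> lexn {(a, b). a \<in> A \<and> b \<in> A \<and> a < b} n"
    unfolding lexn_conv by auto
qed

section \<open>Coordinates on a finitely generated abelian group\<close>

context comm_group
begin

lemma additive_int_pow:
  fixes \<phi> :: "'a \<Rightarrow> int" and n :: int
  assumes H: "subgroup H G" and add: "\<And>a b. a \<in> H \<Longrightarrow> b \<in> H \<Longrightarrow> \<phi> (a \<otimes> b) = \<phi> a + \<phi> b"
    and a: "a \<in> H"
  shows "\<phi> (a [^] n) = n * \<phi> a"
proof -
  have ac: "a \<in> carrier G"
    using H a by (rule subgroup.mem_carrier)
  have one: "\<phi> \<one> = 0"
    using add[of \<one> \<one>] subgroup.one_closed[OF H] by simp
  have nat: "a [^] (k :: nat) \<in> H \<and> \<phi> (a [^] k) = int k * \<phi> a" for k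
  proof (induction k)
    case 0
    then show ?case using one subgroup.one_closed[OF H] by simp
  next
    case (Suc k)
    then show ?case
      using add[of "a [^] k" a] a subgroup.m_closed[OF H] by (simp add: algebra_simps)
  qed
  have inv: "\<phi> (inv b) = - \<phi> b" if "b \<in> H" for b
    using add[OF that subgroup.m_inv_closed[OF H that]] one subgroup.mem_carrier[OF H that] by simp
  obtain k where "n = int k \<or> n = - int k"
    by (metis int_cases2)
  then show ?thesis
    using nat[of k] inv[of "a [^] k"] ac by (auto simp: int_pow_int int_pow_neg_int)
qed

lemma subgroup_adjoin:
  assumes H: "subgroup H G" and g: "g \<in> carrier G"
  shows "subgroup {h \<otimes> g [^] (n :: int) |h n. h \<in> H} G" (is "subgroup ?H' G")
proof (rule subgroupI)
  note Hc = subgroup.mem_carrier[OF H]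
  show "?H' \<subseteq> carrier G"
    using Hc g by auto
  show "?H' \<noteq> {}"
    using subgroup.one_closed[OF H] by blast
  fix a assume "a \<in> ?H'"
  then obtain h n where a: "a = h \<otimes> g [^] (n :: int)" "h \<in> H" by blast
  have "inv a = inv h \<otimes> g [^] (- n)"
    using a Hc g by (simp add: inv_mult int_pow_neg)
  then show "inv a \<in> ?H'"
    using subgroup.m_inv_closed[OF H a(2)] by blast
  fix b assume "b \<in> ?H'"
  then obtain h' n' where b: "b = h' \<otimes> g [^] (n' :: int)" "h' \<in> H" by blast
  have "a \<otimes> b = (h \<otimes> h') \<otimes> g [^] (n + n')"
    using a b Hc g by (simp add: int_pow_mult m_ac)
  then show "a \<otimes> b \<in> ?H'"
    using subgroup.m_closed[OF H a(2) b(2)] by blast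
qed

text \<open>Adjoining one generator at a time takes the place of the structure theorem for finitely
  generated abelian groups.\<close>

lemma finitely_generated_subgroup_induct:
  assumes one: "P {\<one>}"
    and adjoin: "\<And>H g. subgroup H G \<Longrightarrow> P H \<Longrightarrow> g \<in> carrier G \<Longrightarrow> P {h \<otimes> g [^] (n :: int) |h n. h \<in> H}"
    and S: "finite S" "S \<subseteq> carrier G" and gen: "generate G S = carrier G"
  shows "P (carrier G)"
proof -
  have "\<exists>H. subgroup H G \<and> S \<subseteq> H \<and> P H"
    using S
  proof (induction S rule: finite_induct)
    case empty
    then show ?case using one triv_subgroup by auto
  next
    case (insert g S)
    then obtain H where H: "subgroup H G" "S \<subseteq> H" "P H" by auto
    define H' where "H' = {h \<otimes> g [^] (n :: int) |h n. h \<in> H}"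
    have g: "g \<in> carrier G" using insert by auto
    have "h \<in> H'" if "h \<in> H" for h
      unfolding H'_def using that subgroup.mem_carrier[OF H(1) that]
      by (intro CollectI exI[of _ h] exI[of _ "0 :: int"]) simp
    moreover have "g \<in> H'"
      unfolding H'_def using g subgroup.one_closed[OF H(1)]
      by (intro CollectI exI[of _ \<one>] exI[of _ "1 :: int"]) simp
    ultimately show ?case
      using subgroup_adjoin[OF H(1) g] adjoin[OF H(1,3) g] H(2) unfolding H'_def by blast
  qed
  then obtain H where H: "subgroup H G" "S \<subseteq> H" "P H" by auto
  have "generate G S \<subseteq> H"
    using H by (intro generate_subgroup_incl) auto
  with gen H(1) have "H = carrier G"
    using subgroup.subset by blast
  with H(3) show ?thesis by simp
qed

text \<open>The maps \<phi> are coordinates up to torsion: their common kernel is killed by m. The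
  element z, at which no coordinate vanishes, is carried along because it later allows all
  coordinates to be made positive at one element. When g is adjoined to H, either a positive power
  of g lies in H, or g spans an infinite cyclic complement of H.\<close>

lemma finitely_generated_coordinates:
  assumes "finite S" "S \<subseteq> carrier G" "generate G S = carrier G"
  shows "\<exists>(m :: int) (r :: nat) \<phi> z. m > 0 \<and> z \<in> carrier G \<and>
    (\<forall>k<r. \<forall>a\<in>carrier G. \<forall>b\<in>carrier G. \<phi> k (a \<otimes> b) = \<phi> k a + (\<phi> k b :: int)) \<and>
    (\<forall>a\<in>carrier G. (\<forall>k<r. \<phi> k a = 0) \<longrightarrow> a [^] m = \<one>) \<and> (\<forall>k<r. \<phi> k z \<noteq> 0)"
proof (rule finitely_generated_subgroup_induct[OF _ _ assms])
  show "\<exists>(m :: int) (r :: nat) \<phi> z. m > 0 \<and> z \<in> {\<one>} \<and>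
    (\<forall>k<r. \<forall>a\<in>{\<one>}. \<forall>b\<in>{\<one>}. \<phi> k (a \<otimes> b) = \<phi> k a + (\<phi> k b :: int)) \<and>
    (\<forall>a\<in>{\<one>}. (\<forall>k<r. \<phi> k a = 0) \<longrightarrow> a [^] m = \<one>) \<and> (\<forall>k<r. \<phi> k z \<noteq> 0)"
    by (rule exI[of _ "1 :: int"], rule exI[of _ "0 :: nat"], rule exI[of _ "\<lambda>_ _. 0"],
        rule exI[of _ \<one>]) simp
next
  fix H g
  assume H: "subgroup H G" and g: "g \<in> carrier G"
  assume "\<exists>(m :: int) (r :: nat) \<phi> z. m > 0 \<and> z \<in> H \<and>
    (\<forall>k<r. \<forall>a\<in>H. \<forall>b\<in>H. \<phi> k (a \<otimes> b) = \<phi> k a + (\<phi> k b :: int)) \<and>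
    (\<forall>a\<in>H. (\<forall>k<r. \<phi> k a = 0) \<longrightarrow> a [^] m = \<one>) \<and> (\<forall>k<r. \<phi> k z \<noteq> 0)"
  then obtain m :: int and r :: nat and \<phi> z where m: "m > 0" and z: "z \<in> H"
    and *: "\<forall>k<r. \<forall>a\<in>H. \<forall>b\<in>H. \<phi> k (a \<otimes> b) = \<phi> k a + (\<phi> k b :: int)"
    and **: "\<forall>a\<in>H. (\<forall>k<r. \<phi> k a = 0) \<longrightarrow> a [^] m = \<one>" and ***: "\<forall>k<r. \<phi> k z \<noteq> 0"
    by (elim exE conjE) (rule that)
  note add = *[rule_format] and ker = **[rule_format]
    and z0 = ***[rule_format]
  note Hc = subgroup.mem_carrier[OF H]
  let ?H' = "{h \<otimes> g [^] (n :: int) |h n. h \<in> H}"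
  have H': "subgroup ?H' G"
    by (rule subgroup_adjoin[OF H g])
  note H'c = subgroup.mem_carrier[OF H']
  have HH': "h \<in> ?H'" if "h \<in> H" for h
    using that Hc[OF that] by (intro CollectI exI[of _ h] exI[of _ "0 :: int"]) simp
  have Hpow: "a [^] (n :: int) \<in> H" if "a \<in> H" for a n
    using H that by (rule subgroup_int_pow_closed)
  show "\<exists>(m :: int) (r :: nat) \<phi> z. m > 0 \<and> z \<in> ?H' \<and>
    (\<forall>k<r. \<forall>a\<in>?H'. \<forall>b\<in>?H'. \<phi> k (a \<otimes> b) = \<phi> k a + (\<phi> k b :: int)) \<and>
    (\<forall>a\<in>?H'. (\<forall>k<r. \<phi> k a = 0) \<longrightarrow> a [^] m = \<one>) \<and> (\<forall>k<r. \<phi> k z \<noteq> 0)"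
  proof (cases "\<exists>k>0. g [^] (k :: int) \<in> H")
    case True
    then obtain k :: int where k: "k > 0" "g [^] k \<in> H" by blast
    \<comment> \<open>The k-th power map sends the larger group into H. Composing the coordinates
      with it defines them there, at the price of replacing m by \<open>k * m\<close>.\<close>
    have kH: "a [^] k \<in> H" if "a \<in> ?H'" for a
    proof -
      from that obtain h and n :: int where a: "a = h \<otimes> g [^] n" "h \<in> H" by blast
      then have "a [^] k = h [^] k \<otimes> (g [^] k) [^] n"
        using Hc[OF a(2)] g by (simp add: int_pow_distrib int_pow_pow mult.commute)
      then show ?thesis
        using Hpow[OF a(2)] Hpow[OF k(2)] subgroup.m_closed[OF H] by simp
    qed
    show ?thesis
    proof (intro exI conjI ballI impI allI)
      show "k * m > 0" using k m by simp
      show "z \<in> ?H'" using HH'[OF z] .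
      fix i a b assume i: "i < r" and a: "a \<in> ?H'" and b: "b \<in> ?H'"
      have "(a \<otimes> b) [^] k = a [^] k \<otimes> b [^] k"
        using H'c[OF a] H'c[OF b] by (simp add: int_pow_distrib)
      then show "\<phi> i ((a \<otimes> b) [^] k) = \<phi> i (a [^] k) + \<phi> i (b [^] k)"
        using add[OF i kH[OF a] kH[OF b]] by simp
    next
      fix a assume a: "a \<in> ?H'" and 0: "\<forall>i<r. \<phi> i (a [^] k) = 0"
      show "a [^] (k * m) = \<one>"
        using ker[OF kH[OF a]] 0 H'c[OF a] by (simp add: int_pow_pow mult.commute)
    next
      fix i assume i: "i < r"
      have "\<phi> i (z [^] k) = k * \<phi> i z"
        by (rule additive_int_pow[OF H add[OF i] z])
      then show "\<phi> i (z [^] k) \<noteq> 0"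
        using z0[OF i] k by simp
    qed
  next
    case False
    \<comment> \<open>Now only the trivial power of g lies in H, so the exponent of g in an element
      is well defined and serves as one more coordinate.\<close>
    have uniq: "n = n'" "h = h'"
      if eq: "h \<otimes> g [^] n = h' \<otimes> g [^] n'" and h: "h \<in> H" "h' \<in> H" for h h' and n n' :: int
    proof -
      have d: "g [^] (n - n') = h' \<otimes> inv h"
      proof -
        note hc = h[THEN Hc]
        have "h' \<otimes> inv h = h' \<otimes> (g [^] n' \<otimes> inv (g [^] n')) \<otimes> inv h"
          using hc g by simp
        also have "\<dots> = (h' \<otimes> g [^] n') \<otimes> (inv (g [^] n') \<otimes> inv h)"
          using hc g by (simp add: m_assoc) (simp flip: m_assoc)
        also have "\<dots> = (h \<otimes> g [^] n) \<otimes> (inv (g [^] n') \<otimes> inv h)"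
          by (simp only: eq)
        also have "\<dots> = g [^] n \<otimes> inv (g [^] n') \<otimes> (h \<otimes> inv h)"
          using hc g by (simp add: m_ac) (simp flip: m_assoc)
        also have "\<dots> = g [^] (n - n')"
          using hc g by (simp add: int_pow_diff)
        finally show ?thesis ..
      qed
      then have d1: "g [^] (n - n') \<in> H"
        using h H by (simp add: subgroup.m_closed subgroup.m_inv_closed)
      then have d2: "g [^] (n' - n) \<in> H"
        using subgroup.m_inv_closed[OF H d1] g int_pow_neg[OF g, of "n - n'"] by simp
      show "n = n'"
        using False d1 d2 by (metis diff_gt_0_iff_gt linorder_neqE_linordered_idom)
      with eq h[THEN Hc] g show "h = h'"
        by simp
    qed
    define part where "part a = (SOME p :: 'a \<times> int. fst p \<in> H \<and> a = fst p \<otimes> g [^] snd p)" for a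
    define hp np where "hp a = fst (part a)" and "np a = snd (part a)" for a
    have hn: "hp (h \<otimes> g [^] n) = h \<and> np (h \<otimes> g [^] n) = n" if "h \<in> H" for h and n :: int
    proof -
      have "\<exists>p :: 'a \<times> int. fst p \<in> H \<and> h \<otimes> g [^] n = fst p \<otimes> g [^] snd p"
        using that by (intro exI[of _ "(h, n)"]) simp
      from someI_ex[OF this] have p: "hp (h \<otimes> g [^] n) \<in> H"
        "h \<otimes> g [^] n = hp (h \<otimes> g [^] n) \<otimes> g [^] np (h \<otimes> g [^] n)"
        by (simp_all add: hp_def np_def part_def)
      show ?thesis
        using uniq[OF p(2) that p(1)] by simp
    qed
    define \<phi>' where "\<phi>' k a = (if k < r then \<phi> k (hp a) else np a)" for k a
    have mult: "(h \<otimes> g [^] n) \<otimes> (h' \<otimes> g [^] n') = (h \<otimes> h') \<otimes> g [^] (n + n')"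
      if "h \<in> H" "h' \<in> H" for h h' and n n' :: int
      using that[THEN Hc] g by (simp add: int_pow_mult m_ac)
    show ?thesis
    proof (intro exI conjI ballI impI allI)
      show "m > 0" by fact
      \<comment> \<open>The factor g gives the new coordinate the value 1 and does not affect the
        old ones.\<close>
      show "z \<otimes> g [^] (1 :: int) \<in> ?H'" using z by blast
      fix i a b assume "i < Suc r" and a: "a \<in> ?H'" and b: "b \<in> ?H'"
      then obtain h h' and n n' :: int where ab: "a = h \<otimes> g [^] n" "b = h' \<otimes> g [^] n'" "h \<in> H" "h' \<in> H"
        by blast
      show "\<phi>' i (a \<otimes> b) = \<phi>' i a + \<phi>' i b"
        unfolding ab(1,2) mult[OF ab(3,4)] \<phi>'_def
        using hn ab(3,4) subgroup.m_closed[OF H ab(3,4)] add by auto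
    next
      fix a assume a: "a \<in> ?H'" and 0: "\<forall>i<Suc r. \<phi>' i a = 0"
      from a obtain h and n :: int where ab: "a = h \<otimes> g [^] n" "h \<in> H" by blast
      have "n = 0"
        using 0[rule_format, of r] hn[OF ab(2)] unfolding ab(1) \<phi>'_def by simp
      moreover have "\<forall>i<r. \<phi> i h = 0"
        using 0 hn[OF ab(2)] unfolding ab(1) \<phi>'_def by (metis less_SucI)
      ultimately show "a [^] m = \<one>"
        using ker[OF ab(2)] ab Hc[OF ab(2)] by simp
    next
      fix i assume "i < Suc r"
      then show "\<phi>' i (z \<otimes> g [^] (1 :: int)) \<noteq> 0"
        using hn[OF z, of 1] z0 unfolding \<phi>'_def by auto
    qed
  qed
qed

text \<open>Modulo m-th powers, the exponent of each adjoined generator can be reduced modulo m, so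
  every step multiplies the number of representatives by at most m.\<close>

lemma finitely_generated_powers_finite_index:
  fixes m :: int
  assumes "finite S" "S \<subseteq> carrier G" "generate G S = carrier G" and m: "m > 0"
  obtains T where "finite T" "T \<subseteq> carrier G"
    "\<And>a. a \<in> carrier G \<Longrightarrow> \<exists>t\<in>T. \<exists>b\<in>carrier G. a = t \<otimes> b [^] m"
proof -
  have "\<exists>T. finite T \<and> T \<subseteq> carrier G \<and> (\<forall>a\<in>carrier G. \<exists>t\<in>T. \<exists>b\<in>carrier G. a = t \<otimes> b [^] m)"
  proof (rule finitely_generated_subgroup_induct[OF _ _ assms(1-3), where
        P = "\<lambda>H. \<exists>T. finite T \<and> T \<subseteq> carrier G \<and> (\<forall>a\<in>H. \<exists>t\<in>T. \<exists>b\<in>carrier G. a = t \<otimes> b [^] m)"])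
    show "\<exists>T. finite T \<and> T \<subseteq> carrier G \<and> (\<forall>a\<in>{\<one>}. \<exists>t\<in>T. \<exists>b\<in>carrier G. a = t \<otimes> b [^] m)"
      by (intro exI[of _ "{\<one>}"]) (auto intro!: bexI[of _ \<one>])
  next
    fix H g assume H: "subgroup H G" and g: "g \<in> carrier G"
      and "\<exists>T. finite T \<and> T \<subseteq> carrier G \<and> (\<forall>a\<in>H. \<exists>t\<in>T. \<exists>b\<in>carrier G. a = t \<otimes> b [^] m)"
    then obtain T where T: "finite T" "T \<subseteq> carrier G"
      "\<And>a. a \<in> H \<Longrightarrow> \<exists>t\<in>T. \<exists>b\<in>carrier G. a = t \<otimes> b [^] m" by auto
    let ?T' = "(\<lambda>(t, n). t \<otimes> g [^] (n :: int)) ` (T \<times> {0..<m})"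
    have "\<exists>t\<in>?T'. \<exists>b\<in>carrier G. h \<otimes> g [^] n = t \<otimes> b [^] m" if h: "h \<in> H" for h and n :: int
    proof -
      obtain t b where tb: "t \<in> T" "b \<in> carrier G" "h = t \<otimes> b [^] m"
        using T(3)[OF h] by blast
      have "g [^] n = g [^] (n mod m) \<otimes> (g [^] (n div m)) [^] m"
        using g by (simp add: int_pow_pow flip: int_pow_mult)
      then have "h \<otimes> g [^] n = (t \<otimes> g [^] (n mod m)) \<otimes> (b \<otimes> g [^] (n div m)) [^] m"
        using tb T(2) g by (simp add: subset_iff int_pow_distrib m_ac)
      moreover have "t \<otimes> g [^] (n mod m) \<in> ?T'"
        using tb(1) m by (intro image_eqI[of _ _ "(t, n mod m)"]) auto
      ultimately show ?thesis
        using tb(2) g by blast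
    qed
    moreover have "finite ?T'" "?T' \<subseteq> carrier G"
      using T g by auto
    ultimately show "\<exists>T. finite T \<and> T \<subseteq> carrier G \<and>
        (\<forall>a\<in>{h \<otimes> g [^] (n :: int) |h n. h \<in> H}. \<exists>t\<in>T. \<exists>b\<in>carrier G. a = t \<otimes> b [^] m)"
      by blast
  qed
  with that show ?thesis by blast
qed

end

text \<open>The coordinates separate only elements of J; \<open>idx\<close> numbers the finitely
  many cosets of J. Nonnegativity at 1 takes care of the pivot entries, which cannot be altered;
  positivity at z makes multiples of z large in all coordinates, so that they can push the remaining
  entries into the nonnegative range.\<close>

locale ring_coordinates = ring R for R (structure) +
  fixes rk :: nat and \<phi> :: "nat \<Rightarrow> 'a \<Rightarrow> int" and J :: "'a set" and z :: 'a
    and idx :: "'a \<Rightarrow> nat" and bound :: nat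
  assumes one_neq_zero: "\<one> \<noteq> \<zero>"
    and J: "ideal J R"
    and \<phi>_add: "\<lbrakk>k < rk; a \<in> carrier R; b \<in> carrier R\<rbrakk> \<Longrightarrow> \<phi> k (a \<oplus> b) = \<phi> k a + \<phi> k b"
    and \<phi>_one: "k < rk \<Longrightarrow> 0 \<le> \<phi> k \<one>"
    and z: "z \<in> J" and \<phi>_z: "k < rk \<Longrightarrow> 0 < \<phi> k z"
    and \<phi>_inj: "\<lbrakk>a \<in> J; \<And>k. k < rk \<Longrightarrow> \<phi> k a = 0\<rbrakk> \<Longrightarrow> a = \<zero>"
    and idx_bound: "a \<in> carrier R \<Longrightarrow> idx a < bound"
    and idx_eq: "\<lbrakk>a \<in> carrier R; b \<in> carrier R\<rbrakk> \<Longrightarrow> idx a = idx b \<longleftrightarrow> a \<ominus> b \<in> J"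

text \<open>For large t no coordinate vanishes at t 1 + y, and wherever \<phi>_k(1) is nonzero the
  two values \<phi>_k(t 1 + y) and \<phi>_k(1) have the same sign. Changing the signs of the
  coordinates accordingly makes this element positive and 1 nonnegative.\<close>

lemma ring_coordinates_exist:
  assumes "ring R" "\<one>\<^bsub>R\<^esub> \<noteq> \<zero>\<^bsub>R\<^esub>" "additively_finitely_generated R"
  obtains rk \<phi> J z idx bound where "ring_coordinates R rk \<phi> J z idx bound"
proof -
  interpret ring R by (rule assms)
  note A = a_comm_group and A' = a_group
  obtain S where S: "finite S" "S \<subseteq> carrier (add_monoid R)" "generate (add_monoid R) S = carrier (add_monoid R)"
    using assms(3) by (auto simp: additively_finitely_generated_def)
  let ?p = "\<lambda>m a. a [^]\<^bsub>add_monoid R\<^esub> (m :: int)"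
  obtain m :: int and rk :: nat and \<phi> y where m: "m > 0" and y: "y \<in> carrier R"
    and *: "\<forall>k<rk. \<forall>a\<in>carrier R. \<forall>b\<in>carrier R. \<phi> k (a \<oplus>\<^bsub>R\<^esub> b) = \<phi> k a + (\<phi> k b :: int)"
    and **: "\<forall>a\<in>carrier R. (\<forall>k<rk. \<phi> k a = 0) \<longrightarrow> ?p m a = \<zero>\<^bsub>R\<^esub>" and ***: "\<forall>k<rk. \<phi> k y \<noteq> 0"
    using comm_group.finitely_generated_coordinates[OF A S] by (elim exE conjE) (rule that, simp_all)
  note \<phi>_add = *[rule_format] and \<phi>_ker = **[rule_format] and y0 = ***[rule_format]
  obtain T where T: "finite T" "T \<subseteq> carrier R"
    "\<And>a. a \<in> carrier R \<Longrightarrow> \<exists>t\<in>T. \<exists>b\<in>carrier R. a = t \<oplus>\<^bsub>R\<^esub> ?p m b"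
    using comm_group.finitely_generated_powers_finite_index[OF A S m] by auto
  have \<phi>_pow: "\<phi> k (?p n a) = n * \<phi> k a" if "k < rk" "a \<in> carrier R" for k n a
    by (rule comm_group.additive_int_pow[OF A, where H = "carrier R"])
      (use that \<phi>_add group.subgroup_self[OF A'] in auto)
  have pc: "?p n a \<in> carrier R" if "a \<in> carrier R" for n a
    using group.int_pow_closed[OF A', of a n] that by simp
  \<comment> \<open>The summand 1 makes t exceed every |\<phi>_k(y)| strictly, so a nonzero
    \<phi>_k(1) outweighs \<phi>_k(y); if \<phi>_k(1) = 0, the nonzero value \<phi>_k(y)
    remains.\<close>
  define t where "t = 1 + (\<Sum>k<rk. \<bar>\<phi> k y\<bar>)"
  have t: "\<bar>\<phi> k y\<bar> < t" if "k < rk" for k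
    using member_le_sum[of k "{..<rk}" "\<lambda>k. \<bar>\<phi> k y\<bar>"] that by (simp add: t_def)
  define e where "e = ?p t \<one>\<^bsub>R\<^esub> \<oplus>\<^bsub>R\<^esub> y"
  have e: "e \<in> carrier R"
    using pc y by (simp add: e_def)
  have \<phi>e: "\<phi> k e = t * \<phi> k \<one>\<^bsub>R\<^esub> + \<phi> k y" if "k < rk" for k
    using that \<phi>_add pc y by (simp add: e_def \<phi>_pow)
  have sign: "\<phi> k e \<noteq> 0 \<and> 0 \<le> sgn (\<phi> k e) * \<phi> k \<one>\<^bsub>R\<^esub>" if k: "k < rk" for k
  proof -
    consider "\<phi> k \<one>\<^bsub>R\<^esub> = 0" | "\<phi> k \<one>\<^bsub>R\<^esub> \<ge> 1" | "\<phi> k \<one>\<^bsub>R\<^esub> \<le> -1"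
      by linarith
    then show ?thesis
    proof cases
      case 1
      then show ?thesis using \<phi>e[OF k] y0[OF k] by simp
    next
      case 2
      then have "t * \<phi> k \<one>\<^bsub>R\<^esub> \<ge> t" using t[OF k] by (simp add: mult_le_cancel_left1)
      then have "\<phi> k e > 0" using \<phi>e[OF k] t[OF k] by linarith
      with 2 show ?thesis by simp
    next
      case 3
      then have "t * (- \<phi> k \<one>\<^bsub>R\<^esub>) \<ge> t * 1" using t[OF k] by (intro mult_left_mono) auto
      then have "\<phi> k e < 0" using \<phi>e[OF k] t[OF k] by simp
      with 3 show ?thesis by simp
    qed
  qed
  define \<psi> where "\<psi> k a = sgn (\<phi> k e) * \<phi> k a" for k a
  \<comment> \<open>J = mR is an ideal on both sides, since additive multiples commute with
    multiplication in R, and it has finite index by the choice of T.\<close>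
  define J where "J = ?p m ` carrier R"
  have J: "ideal J R"
  proof (rule idealI)
    show "ring R" by fact
    show "subgroup J (add_monoid R)"
    proof (rule group.subgroupI[OF A'])
      show "J \<subseteq> carrier (add_monoid R)"
        using pc by (auto simp: J_def)
      show "J \<noteq> {}" by (auto simp: J_def)
      fix a assume "a \<in> J"
      then obtain a' where a: "a' \<in> carrier R" "a = ?p m a'" by (auto simp: J_def)
      have "inv\<^bsub>add_monoid R\<^esub> a = ?p m (inv\<^bsub>add_monoid R\<^esub> a')"
        using a by (simp add: group.int_pow_inv[OF A'])
      then show "inv\<^bsub>add_monoid R\<^esub> a \<in> J"
        using group.inv_closed[OF A', of a'] a by (auto simp: J_def)
      fix b assume "b \<in> J"
      then obtain b' where b: "b' \<in> carrier R" "b = ?p m b'" by (auto simp: J_def)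
      have "a \<otimes>\<^bsub>add_monoid R\<^esub> b = ?p m (a' \<otimes>\<^bsub>add_monoid R\<^esub> b')"
        using a b by (subst comm_group.int_pow_distrib[OF A]) auto
      then show "a \<otimes>\<^bsub>add_monoid R\<^esub> b \<in> J"
        using a b by (auto simp: J_def)
    qed
    fix a x assume "a \<in> J" and x: "x \<in> carrier R"
    then obtain a' where a: "a' \<in> carrier R" "a = ?p m a'" by (auto simp: J_def)
    have "x \<otimes>\<^bsub>R\<^esub> a = ?p m (x \<otimes>\<^bsub>R\<^esub> a')" "a \<otimes>\<^bsub>R\<^esub> x = ?p m (a' \<otimes>\<^bsub>R\<^esub> x)"
      using add_pow_rdistr_int[OF x a(1), of m] add_pow_ldistr_int[OF a(1) x, of m] a(2)
      by (simp_all add: add_pow_def)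
    then show "x \<otimes>\<^bsub>R\<^esub> a \<in> J" "a \<otimes>\<^bsub>R\<^esub> x \<in> J"
      using a x by (auto simp: J_def)
  qed
  interpret J: ideal J R by (rule J)
  have "finite ((\<lambda>a. J +>\<^bsub>R\<^esub> a) ` carrier R)"
  proof (rule finite_subset)
    show "(\<lambda>a. J +>\<^bsub>R\<^esub> a) ` carrier R \<subseteq> (\<lambda>a. J +>\<^bsub>R\<^esub> a) ` T"
    proof
      fix Y assume "Y \<in> (\<lambda>a. J +>\<^bsub>R\<^esub> a) ` carrier R"
      then obtain a where a: "a \<in> carrier R" "Y = J +>\<^bsub>R\<^esub> a" by auto
      obtain u b where u: "u \<in> T" "b \<in> carrier R" "a = u \<oplus>\<^bsub>R\<^esub> ?p m b"
        using T(3)[OF a(1)] by blast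
      have uc: "u \<in> carrier R" using u(1) T(2) by auto
      have "a \<ominus>\<^bsub>R\<^esub> u = ?p m b"
        using u uc pc[OF u(2)] by (simp add: minus_eq a_ac r_neg2 r_neg)
      then have "a \<ominus>\<^bsub>R\<^esub> u \<in> J" using u(2) by (simp add: J_def)
      then have "J +>\<^bsub>R\<^esub> a = J +>\<^bsub>R\<^esub> u"
        using quotient_eq_iff_same_a_r_cos[OF J a(1) uc] by simp
      with a(2) u(1) show "Y \<in> (\<lambda>a. J +>\<^bsub>R\<^esub> a) ` T" by auto
    qed
  qed (use T(1) in simp)
  then obtain f :: "'a set \<Rightarrow> nat" and n where f: "f ` (\<lambda>a. J +>\<^bsub>R\<^esub> a) ` carrier R = {i. i < n}"
    "inj_on f ((\<lambda>a. J +>\<^bsub>R\<^esub> a) ` carrier R)"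
    using finite_imp_inj_to_nat_seg by metis
  have "ring_coordinates R rk \<psi> J (?p m e) (\<lambda>a. f (J +>\<^bsub>R\<^esub> a)) n"
  proof
    show "\<one>\<^bsub>R\<^esub> \<noteq> \<zero>\<^bsub>R\<^esub>" by fact
    show "\<psi> k (a \<oplus>\<^bsub>R\<^esub> b) = \<psi> k a + \<psi> k b" if "k < rk" "a \<in> carrier R" "b \<in> carrier R" for k a b
      using that by (simp add: \<psi>_def \<phi>_add algebra_simps)
    show "0 \<le> \<psi> k \<one>\<^bsub>R\<^esub>" if "k < rk" for k
      using sign[OF that] by (simp add: \<psi>_def)
    show "?p m e \<in> J"
      using e by (simp add: J_def)
    show "0 < \<psi> k (?p m e)" if "k < rk" for k
      using sign[OF that] m e that by (simp add: \<psi>_def \<phi>_pow sgn_if zero_less_mult_iff mult_less_0_iff)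
    \<comment> \<open>If all coordinates of m b vanish, so do those of b, and m kills the common
      kernel.\<close>
    show "a = \<zero>\<^bsub>R\<^esub>" if a: "a \<in> J" and 0: "\<And>k. k < rk \<Longrightarrow> \<psi> k a = 0" for a
    proof -
      obtain b where b: "b \<in> carrier R" "a = ?p m b" using a by (auto simp: J_def)
      have "\<phi> k b = 0" if "k < rk" for k
        using 0[OF that] sign[OF that] \<phi>_pow[OF that b(1)] m by (simp add: \<psi>_def b(2) sgn_0_0)
      with \<phi>_ker[OF b(1)] b(2) show ?thesis by simp
    qed
    show "f (J +>\<^bsub>R\<^esub> a) < n" if "a \<in> carrier R" for a
      using f(1) that by blast
    show "f (J +>\<^bsub>R\<^esub> a) = f (J +>\<^bsub>R\<^esub> b) \<longleftrightarrow> a \<ominus>\<^bsub>R\<^esub> b \<in> J" if "a \<in> carrier R" "b \<in> carrier R" for a b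
      using f(2) that quotient_eq_iff_same_a_r_cos[OF J that] by (auto dest: inj_onD)
  qed
  then show ?thesis by (rule that)
qed

section \<open>Leading terms in sums of principal projectives\<close>

text \<open>For words of equal length this constrains u up to and including its first difference
  from v; the letters after that are free.\<close>

definition relpos :: "'l set \<Rightarrow> 'l list \<Rightarrow> 'l list \<Rightarrow> bool" where
  "relpos P v u \<longleftrightarrow> (\<forall>l<length v. take l u = take l v \<longrightarrow> u ! l \<in> P)"

lemma relpos_self: "relpos P v v \<longleftrightarrow> v \<in> lists P"
  by (auto simp: relpos_def set_conv_nth)

section \<open>Basis elements, coefficients and supports\<close>

locale projective_sum = category C for C :: "('o, 'h) cat" +
  fixes K :: "('k, 'c) ring_scheme" and q :: nat and x :: "nat \<Rightarrow> 'o"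
  assumes K: "cring K" and x: "i < q \<Longrightarrow> x i \<in> obj C"
begin

sublocale K: cring K by (rule K)

definition basis :: "'o \<Rightarrow> (nat \<times> 'h) set" where
  "basis y = {(i, f). i < q \<and> f \<in> homset C (x i) y}"

definition act :: "'o \<Rightarrow> 'o \<Rightarrow> 'h \<Rightarrow> nat \<times> 'h \<Rightarrow> nat \<times> 'h" where
  "act y z g b = (fst b, composite C (x (fst b)) y z g (snd b))"

abbreviation D :: "('o, 'h, 'k, nat \<Rightarrow> 'h \<Rightarrow> 'k) cat_module" where
  "D \<equiv> direct_sum q (\<lambda>i. principal_projective K C (x i))"

definition coef :: "(nat \<Rightarrow> 'h \<Rightarrow> 'k) \<Rightarrow> nat \<times> 'h \<Rightarrow> 'k" where
  "coef u b = u (fst b) (snd b)"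

definition supp :: "'o \<Rightarrow> (nat \<Rightarrow> 'h \<Rightarrow> 'k) \<Rightarrow> (nat \<times> 'h) set" where
  "supp y u = {b \<in> basis y. coef u b \<noteq> \<zero>\<^bsub>K\<^esub>}"

lemma act_closed:
  assumes "y \<in> obj C" "z \<in> obj C" "g \<in> homset C y z" "b \<in> basis y"
  shows "act y z g b \<in> basis z"
  using assms comp_closed x by (auto simp: basis_def act_def)

lemma carrier_D_iff:
  "u \<in> carrier (mobj D y) \<longleftrightarrow> u \<in> extensional {..<q} \<and>
    (\<forall>i<q. u i \<in> carrier (free_module K (homset C (x i) y)))"
  by (auto simp: direct_sum_def sum_module_def principal_projective_def PiE_iff)

lemma D_cat_module: "is_cat_module K C D"
  by (intro direct_sum_is_cat_module principal_projective_is_cat_module K category_axioms x)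

lemma module_D: "y \<in> obj C \<Longrightarrow> module K (mobj D y)"
  using D_cat_module by (simp add: is_cat_module_def)

lemma coef_closed:
  assumes "u \<in> carrier (mobj D y)" "b \<in> basis y"
  shows "coef u b \<in> carrier K"
  using assms free_module_carrierD(1)[of "u (fst b)" K]
  by (auto simp: carrier_D_iff basis_def coef_def)

lemma finite_supp:
  assumes "u \<in> carrier (mobj D y)"
  shows "finite (supp y u)"
proof (rule finite_subset)
  show "supp y u \<subseteq> Sigma {..<q} (\<lambda>i. {f \<in> homset C (x i) y. u i f \<noteq> \<zero>\<^bsub>K\<^esub>})"
    by (auto simp: supp_def basis_def coef_def)
  show "finite \<dots>"
    using assms free_module_carrierD(2) by (intro finite_SigmaI) (auto simp: carrier_D_iff)
qed

lemma coef_add: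
  assumes "b \<in> basis y"
  shows "coef (u \<oplus>\<^bsub>mobj D y\<^esub> w) b = coef u b \<oplus>\<^bsub>K\<^esub> coef w b"
  using assms
  by (auto simp: coef_def basis_def direct_sum_def sum_module_def principal_projective_def free_module_def)

lemma coef_smult:
  assumes "b \<in> basis y"
  shows "coef (a \<odot>\<^bsub>mobj D y\<^esub> u) b = a \<otimes>\<^bsub>K\<^esub> coef u b"
  using assms
  by (auto simp: coef_def basis_def direct_sum_def sum_module_def principal_projective_def free_module_def)

lemma coef_zero:
  assumes "b \<in> basis y"
  shows "coef \<zero>\<^bsub>mobj D y\<^esub> b = \<zero>\<^bsub>K\<^esub>"
  using assms
  by (auto simp: coef_def basis_def direct_sum_def sum_module_def principal_projective_def free_module_def)

lemma D_eqI:
  assumes "u \<in> carrier (mobj D y)" "w \<in> carrier (mobj D y)"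
    and eq: "\<And>b. b \<in> basis y \<Longrightarrow> coef u b = coef w b"
  shows "u = w"
proof (rule extensionalityI[of _ "{..<q}"])
  fix i assume "i \<in> {..<q}"
  then have i: "i < q" by simp
  show "u i = w i"
  proof (rule extensionalityI)
    show "u i \<in> extensional (homset C (x i) y)" "w i \<in> extensional (homset C (x i) y)"
      using assms i by (auto simp: carrier_D_iff intro: free_module_carrierD(3)[of _ K])
    show "u i f = w i f" if "f \<in> homset C (x i) y" for f
      using eq[of "(i, f)"] i that by (simp add: basis_def coef_def)
  qed
qed (use assms in \<open>auto simp: carrier_D_iff\<close>)

lemma supp_empty_imp_zero:
  assumes y: "y \<in> obj C" and u: "u \<in> carrier (mobj D y)" and "supp y u = {}"
  shows "u = \<zero>\<^bsub>mobj D y\<^esub>"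
proof -
  interpret M: module K "mobj D y" by (rule module_D[OF y])
  show ?thesis
    using assms by (intro D_eqI[OF u]) (auto simp: coef_zero supp_def)
qed

lemma mmap_D_eq:
  assumes "u \<in> carrier (mobj D y)" "i < q"
  shows "mmap D y z g u i = free_map K (homset C (x i) y) (homset C (x i) z) (composite C (x i) y z g) (u i)"
  using assms by (simp add: direct_sum_def principal_projective_def)

lemma mmap_D_closed:
  assumes "y \<in> obj C" "z \<in> obj C" "g \<in> homset C y z" "u \<in> carrier (mobj D y)"
  shows "mmap D y z g u \<in> carrier (mobj D z)"
proof -
  have "mmap D y z g \<in> linear_maps K (mobj D y) (mobj D z)"
    using D_cat_module assms(1-3) unfolding is_cat_module_def by blast
  with assms(4) show ?thesis by (auto simp: linear_maps_def)
qed

text \<open>Terms with the same image may cancel, whence only an inclusion.\<close>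

lemma supp_mmap:
  assumes y: "y \<in> obj C" "z \<in> obj C" "g \<in> homset C y z" and u: "u \<in> carrier (mobj D y)"
  shows "supp z (mmap D y z g u) \<subseteq> act y z g ` supp y u"
proof clarsimp
  fix i f assume ifs: "(i, f) \<in> supp z (mmap D y z g u)"
  then have i: "i < q" and f: "f \<in> homset C (x i) z" by (auto simp: supp_def basis_def)
  have "u i \<in> carrier (free_module K (homset C (x i) y))"
    using u i by (simp add: carrier_D_iff)
  from free_map_closed(2)[OF K _ this, of "composite C (x i) y z g" "homset C (x i) z"]
  have "f \<in> composite C (x i) y z g ` {s \<in> homset C (x i) y. u i s \<noteq> \<zero>\<^bsub>K\<^esub>}"
    using ifs f i x comp_closed y mmap_D_eq[OF u i, of z g] by (auto simp: supp_def coef_def)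
  then show "(i, f) \<in> act y z g ` supp y u"
    using i by (force simp: supp_def coef_def basis_def act_def)
qed

text \<open>Distinct basis elements stay distinct, so the fibre over \<open>act y z g b\<close>
  consists of b alone.\<close>

lemma coef_mmap:
  assumes y: "y \<in> obj C" "z \<in> obj C" "g \<in> homset C y z" and u: "u \<in> carrier (mobj D y)"
    and inj: "inj_on (act y z g) (basis y)" and b: "b \<in> basis y"
  shows "coef (mmap D y z g u) (act y z g b) = coef u b"
proof -
  obtain i f where ifs: "b = (i, f)" "i < q" "f \<in> homset C (x i) y"
    using b by (auto simp: basis_def)
  have u': "u i \<in> carrier (free_module K (homset C (x i) y))"
    using u ifs by (simp add: carrier_D_iff)
  \<comment> \<open>Adding f gives the fibre exactly one element even if the coefficient at f is
    zero.\<close>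
  define S' where "S' = insert f {s \<in> homset C (x i) y. u i s \<noteq> \<zero>\<^bsub>K\<^esub>}"
  have "coef (mmap D y z g u) (act y z g b) =
      free_map K (homset C (x i) y) (homset C (x i) z) (composite C (x i) y z g) (u i) (composite C (x i) y z g f)"
    using mmap_D_eq[OF u ifs(2), of z g] by (simp add: coef_def act_def ifs)
  also have "\<dots> = (\<Oplus>\<^bsub>K\<^esub>s\<in>{s \<in> S'. composite C (x i) y z g s = composite C (x i) y z g f}. u i s)"
    using free_module_carrierD(2)[OF u'] ifs x comp_closed y
    by (intro free_map_eq[OF K u']) (auto simp: S'_def)
  also have "{s \<in> S'. composite C (x i) y z g s = composite C (x i) y z g f} = {f}"
  proof -
    have "s = f" if "s \<in> S'" "composite C (x i) y z g s = composite C (x i) y z g f" for s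
      using inj_onD[OF inj, of "(i, s)" "(i, f)"] that ifs by (auto simp: act_def basis_def S'_def)
    then show ?thesis by (auto simp: S'_def)
  qed
  also have "(\<Oplus>\<^bsub>K\<^esub>s\<in>{f}. u i s) = coef u b"
    using free_module_carrierD(1)[OF u' ifs(3)] by (simp add: coef_def ifs)
  finally show ?thesis .
qed

text \<open>Inverse automorphisms are controlled through their effect on the basis, so the identity
  of the induced map is read off from there.\<close>

lemma mmap_D_id:
  assumes y: "y \<in> obj C" "e \<in> homset C y y" and u: "u \<in> carrier (mobj D y)"
    and id: "\<And>b. b \<in> basis y \<Longrightarrow> act y y e b = b"
  shows "mmap D y y e u = u"
proof (rule extensionalityI[of _ "{..<q}"])
  show "mmap D y y e u \<in> extensional {..<q}" "u \<in> extensional {..<q}"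
    using mmap_D_closed[OF y(1,1,2) u] u by (auto simp: carrier_D_iff)
  fix i assume "i \<in> {..<q}"
  then have i: "i < q" by simp
  show "mmap D y y e u i = u i"
    unfolding mmap_D_eq[OF u i]
    by (rule free_map_id[OF K]) (use u i id in \<open>auto simp: carrier_D_iff act_def basis_def\<close>)
qed

section \<open>Generated submodules\<close>

definition generated :: "('o \<times> (nat \<Rightarrow> 'h \<Rightarrow> 'k)) set \<Rightarrow> 'o \<Rightarrow> (nat \<Rightarrow> 'h \<Rightarrow> 'k) set" where
  "generated F y = \<Inter> {S y |S. is_cat_submodule K C D S \<and> (\<forall>(y', u)\<in>F. u \<in> S y')}"

lemma generated_incl: "(y, u) \<in> F \<Longrightarrow> u \<in> generated F y"
  by (auto simp: generated_def)

lemma generated_closed: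
  assumes y: "y \<in> obj C"
  shows "\<zero>\<^bsub>mobj D y\<^esub> \<in> generated F y"
    and "\<lbrakk>u \<in> generated F y; w \<in> generated F y\<rbrakk> \<Longrightarrow> u \<oplus>\<^bsub>mobj D y\<^esub> w \<in> generated F y"
    and "\<lbrakk>a \<in> carrier K; u \<in> generated F y\<rbrakk> \<Longrightarrow> a \<odot>\<^bsub>mobj D y\<^esub> u \<in> generated F y"
    and "\<lbrakk>z \<in> obj C; g \<in> homset C y z; u \<in> generated F y\<rbrakk> \<Longrightarrow> mmap D y z g u \<in> generated F z"
proof -
  interpret M: module K "mobj D y" by (rule module_D[OF y])
  have sub: "submodule (S y) K (mobj D y)" if "is_cat_submodule K C D S" for S
    using that y by (simp add: is_cat_submodule_def)
  have zero: "\<zero>\<^bsub>mobj D y\<^esub> \<in> S y" if "is_cat_submodule K C D S" for S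
    using subgroup.one_closed[OF submodule.axioms(1)[OF sub[OF that]]] by simp
  then show "\<zero>\<^bsub>mobj D y\<^esub> \<in> generated F y"
    by (auto simp: generated_def)
  show "u \<oplus>\<^bsub>mobj D y\<^esub> w \<in> generated F y" if "u \<in> generated F y" "w \<in> generated F y"
    using that M.submoduleE(5)[OF sub] by (fastforce simp: generated_def)
  show "a \<odot>\<^bsub>mobj D y\<^esub> u \<in> generated F y" if "a \<in> carrier K" "u \<in> generated F y"
    using that M.submoduleE(4)[OF sub] by (fastforce simp: generated_def)
  show "mmap D y z g u \<in> generated F z" if "z \<in> obj C" "g \<in> homset C y z" "u \<in> generated F y"
    using that y unfolding generated_def is_cat_submodule_def by blast
qed

end

section \<open>The Groebner argument for bases coded by words\<close>

locale coded_projective_sum = projective_sum C K q x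
  for C :: "('o, 'h) cat" and K :: "('k, 'c) ring_scheme" and q :: nat and x :: "nat \<Rightarrow> 'o" +
  fixes code :: "'o \<Rightarrow> nat \<times> 'h \<Rightarrow> 'l :: linorder list" and P :: "'l set"
begin

definition order_preserving :: "'o \<Rightarrow> 'o \<Rightarrow> 'h \<Rightarrow> bool" where
  "order_preserving y z g \<longleftrightarrow> (\<forall>u\<in>basis y. \<forall>u'\<in>basis y. code y u < code y u' \<longrightarrow>
     code z (act y z g u) < code z (act y z g u'))"

text \<open>The analogue of divisibility of leading terms. Preservation of \<open>relpos\<close> is
  included so that the translate of an element in relative normal form can be subtracted from one
  led by w without spoiling the normal form of the latter.\<close>

definition embeds :: "'o \<times> nat \<times> 'h \<Rightarrow> 'o \<times> nat \<times> 'h \<Rightarrow> bool" where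
  "embeds = (\<lambda>(y, v) (z, w). \<exists>g\<in>homset C y z. act y z g v = w \<and> order_preserving y z g \<and>
     (\<forall>u\<in>basis y. relpos P (code y v) (code y u) \<longrightarrow> relpos P (code z w) (code z (act y z g u))))"

lemma embedsE:
  assumes "embeds (y, v) (z, w)"
  obtains g where "g \<in> homset C y z" "act y z g v = w" "order_preserving y z g"
    "\<And>u. u \<in> basis y \<Longrightarrow> relpos P (code y v) (code y u) \<Longrightarrow> relpos P (code z w) (code z (act y z g u))"
  using assms by (auto simp: embeds_def)

end

text \<open>The interface between the Groebner argument and matrices. Well-foundedness is asked only
  of the letters in P. In the normalizer axiom, h' keeps elements outside the generated submodule,
  order preservation keeps the leading term leading, and only the finitely many elements of a
  support have to be treated at a time.\<close>

locale well_ordered_projective_sum = coded_projective_sum C K q x code P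
  for C :: "('o, 'h) cat" and K :: "('k, 'c) ring_scheme" and q :: nat and x :: "nat \<Rightarrow> 'o"
    and code :: "'o \<Rightarrow> nat \<times> 'h \<Rightarrow> 'l :: linorder list" and P :: "'l set" +
  fixes len :: "'o \<Rightarrow> nat"
  assumes noetherian: "noetherian_ring K"
    and length_code: "\<lbrakk>y \<in> obj C; b \<in> basis y\<rbrakk> \<Longrightarrow> length (code y b) = len y"
    and inj_code: "y \<in> obj C \<Longrightarrow> inj_on (code y) (basis y)"
    and wf_P: "wf {(a, b). a \<in> P \<and> b \<in> P \<and> a < b}"
    and normalizer: "\<lbrakk>y \<in> obj C; finite U; U \<subseteq> basis y; v \<in> U; j < len y\<rbrakk> \<Longrightarrow>
      \<exists>h\<in>homset C y y. \<exists>h'\<in>homset C y y.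
        (\<forall>u\<in>basis y. act y y h' (act y y h u) = u) \<and> order_preserving y y h \<and>
        (\<forall>u\<in>basis y. take j (code y (act y y h u)) = take j (code y u)) \<and>
        (\<forall>u\<in>U. take j (code y u) = take j (code y v) \<longrightarrow> code y (act y y h u) ! j \<in> P)"
    and almost_full_embeds:
      "almost_full_on embeds {(y, v). y \<in> obj C \<and> v \<in> basis y \<and> code y v \<in> lists P}"
begin

definition normalized :: "'o \<Rightarrow> (nat \<Rightarrow> 'h \<Rightarrow> 'k) \<Rightarrow> nat \<times> 'h \<Rightarrow> bool" where
  "normalized y u v \<longleftrightarrow> v \<in> supp y u \<and>
    (\<forall>b\<in>supp y u. code y b \<le> code y v \<and> relpos P (code y v) (code y b))"

lemma act_le:
  assumes "order_preserving y z g" and y: "y \<in> obj C" and "u \<in> basis y" "u' \<in> basis y" "code y u \<le> code y u'"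
  shows "code z (act y z g u) \<le> code z (act y z g u')"
proof (cases "code y u = code y u'")
  case True
  then show ?thesis using inj_onD[OF inj_code[OF y] True] assms by simp
next
  case False
  then show ?thesis using assms by (simp add: order_preserving_def order.strict_iff_order)
qed

lemma act_inj:
  assumes "order_preserving y z g" and y: "y \<in> obj C"
  shows "inj_on (act y z g) (basis y)"
proof (rule inj_onI)
  fix u u' assume u: "u \<in> basis y" "u' \<in> basis y" and eq: "act y z g u = act y z g u'"
  have "code y u = code y u'"
    using assms(1) u eq unfolding order_preserving_def by (metis less_irrefl linorder_neqE)
  then show "u = u'"
    using inj_onD[OF inj_code[OF y]] u by blast
qed

lemma lead_exists:
  assumes y: "y \<in> obj C" and u: "u \<in> carrier (mobj D y)" "u \<noteq> \<zero>\<^bsub>mobj D y\<^esub>"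
  obtains v where "v \<in> supp y u" "\<And>b. b \<in> supp y u \<Longrightarrow> code y b \<le> code y v"
proof -
  have fin: "finite (code y ` supp y u)" and "code y ` supp y u \<noteq> {}"
    using finite_supp[OF u(1)] supp_empty_imp_zero[OF y u(1)] u(2) by auto
  then have "Max (code y ` supp y u) \<in> code y ` supp y u"
    by (rule Max_in)
  then obtain v where v: "v \<in> supp y u" "code y v = Max (code y ` supp y u)"
    by (metis imageE)
  have "code y b \<le> code y v" if "b \<in> supp y u" for b
    unfolding v(2) using that by (intro Max_ge[OF fin] imageI)
  with v(1) show ?thesis
    by (rule that)
qed

context
  fixes N :: "'o \<Rightarrow> (nat \<Rightarrow> 'h \<Rightarrow> 'k) set"
  assumes N: "is_cat_submodule K C D N"
begin

lemma N_subset: "y \<in> obj C \<Longrightarrow> N y \<subseteq> carrier (mobj D y)"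
  using N module.submoduleE(1)[OF module_D] by (auto simp: is_cat_submodule_def)

lemma N_mmap: "\<lbrakk>y \<in> obj C; z \<in> obj C; g \<in> homset C y z; u \<in> N y\<rbrakk> \<Longrightarrow> mmap D y z g u \<in> N z"
  using N unfolding is_cat_submodule_def by blast

text \<open>The automorphism for position j leaves the earlier letters alone, so positions can be
  treated one after another. That the first j letters of the leading word survive is what later
  protects a drop in the leading word.\<close>

lemma normalize:
  assumes y: "y \<in> obj C" and u: "u \<in> N y - generated F y"
    and v: "v \<in> supp y u" "\<And>b. b \<in> supp y u \<Longrightarrow> code y b \<le> code y v" and j: "j \<le> len y"
    and pos: "\<And>b l. b \<in> supp y u \<Longrightarrow> l < j \<Longrightarrow> take l (code y b) = take l (code y v) \<Longrightarrow> code y b ! l \<in> P"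
  shows "\<exists>u'\<in>N y - generated F y. \<exists>v'. normalized y u' v' \<and> take j (code y v') = take j (code y v)"
  using j u v pos
proof (induction j arbitrary: u v rule: inc_induct)
  case base
  have "normalized y u v"
    using base length_code[OF y] by (auto simp: normalized_def relpos_def supp_def)
  with base show ?case by blast
next
  case (step j)
  have uc: "u \<in> carrier (mobj D y)"
    using step.prems(1) N_subset[OF y] by auto
  have sb: "supp y u \<subseteq> basis y" by (auto simp: supp_def)
  obtain h h' where h: "h \<in> homset C y y" "h' \<in> homset C y y"
    "\<And>u. u \<in> basis y \<Longrightarrow> act y y h' (act y y h u) = u"
    and mono: "order_preserving y y h"
    and tk: "\<And>u. u \<in> basis y \<Longrightarrow> take j (code y (act y y h u)) = take j (code y u)"
    and hp: "\<And>b. b \<in> supp y u \<Longrightarrow> take j (code y b) = take j (code y v) \<Longrightarrow> code y (act y y h b) ! j \<in> P"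
    using normalizer[OF y finite_supp[OF uc] sb step.prems(2) step.hyps(2)] by blast
  define u1 v1 where "u1 = mmap D y y h u" and "v1 = act y y h v"
  have supp1: "supp y u1 \<subseteq> act y y h ` supp y u"
    unfolding u1_def by (rule supp_mmap[OF y y h(1) uc])
  have v: "v \<in> basis y" using step.prems(2) sb by auto
  have v1: "v1 \<in> supp y u1"
    using coef_mmap[OF y y h(1) uc act_inj[OF mono y] v] step.prems(2) act_closed[OF y y h(1) v]
    by (simp add: supp_def u1_def v1_def)
  have max1: "code y b \<le> code y v1" if b: "b \<in> supp y u1" for b
  proof -
    obtain b' where "b = act y y h b'" "b' \<in> supp y u" using b supp1 by blast
    then show ?thesis
      unfolding v1_def using act_le[OF mono y] v step.prems(3) sb by blast
  qed
  have pos1: "code y b ! l \<in> P"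
    if b: "b \<in> supp y u1" and l: "l < Suc j" and eq: "take l (code y b) = take l (code y v1)" for b l
  proof -
    obtain b' where b': "b = act y y h b'" "b' \<in> supp y u" using b supp1 by blast
    then have bb: "b' \<in> basis y" using sb by auto
    have eq': "take l (code y b') = take l (code y v)"
      using arg_cong[OF tk[OF bb], of "take l"] arg_cong[OF tk[OF v], of "take l"] eq l
      by (simp add: b'(1) v1_def min_absorb1)
    show ?thesis
    proof (cases "l = j")
      case True
      then show ?thesis using hp[OF b'(2)] eq' by (simp add: b'(1))
    next
      case False
      then have "l < j" using l by simp
      then have "code y b ! l = code y b' ! l"
        using tk[OF bb] by (metis b'(1) nth_take)
      with \<open>l < j\<close> step.prems(4)[OF b'(2) _ eq'] show ?thesis by simp
    qed
  qed
  \<comment> \<open>Since h' brings \<open>u1\<close> back to u, a generated \<open>u1\<close> would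
    make u generated.\<close>
  have inv: "mmap D y y h' u1 = u"
  proof -
    have "mmap D y y h' u1 = mmap D y y (composite C y y y h' h) u"
      unfolding u1_def using D_cat_module y h(1,2) uc by (simp add: is_cat_module_def)
    also have "\<dots> = u"
    proof (rule mmap_D_id[OF y comp_closed[OF y y y h(1,2)] uc])
      fix b assume b: "b \<in> basis y"
      then have "act y y (composite C y y y h' h) b = act y y h' (act y y h b)"
        using comp_assoc[OF _ y y y _ h(1,2)] x by (auto simp: act_def basis_def)
      with h(3)[OF b] show "act y y (composite C y y y h' h) b = b" by simp
    qed
    finally show ?thesis .
  qed
  have "u1 \<in> N y"
    unfolding u1_def using N_mmap[OF y y h(1)] step.prems(1) by blast
  moreover have "u1 \<notin> generated F y"
    using generated_closed(4)[OF y y h(2), of u1 F] inv step.prems(1) by auto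
  ultimately obtain u' v' where "u' \<in> N y - generated F y" "normalized y u' v'"
    "take (Suc j) (code y v') = take (Suc j) (code y v1)"
    using step.IH[of u1 v1] v1 max1 pos1 by blast
  moreover have "take j (code y v') = take j (code y v)"
    using arg_cong[OF calculation(3), of "take j"] tk[OF v] by (simp add: v1_def min_absorb1)
  ultimately show ?case by blast
qed

text \<open>Relative positivity of the leading word with respect to itself puts all its letters in
  P, and words over P of the fixed length are well-ordered.\<close>

lemma minimal_normalized_exists:
  assumes y: "y \<in> obj C" and u: "u \<in> N y - generated F y"
  shows "\<exists>u v. u \<in> N y - generated F y \<and> normalized y u v \<and>
    (\<forall>u'\<in>N y - generated F y. \<forall>v'. normalized y u' v' \<longrightarrow> \<not> code y v' < code y v)"
proof -
  have uc: "u \<in> carrier (mobj D y)" "u \<noteq> \<zero>\<^bsub>mobj D y\<^esub>"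
    using u N_subset[OF y] generated_closed(1)[OF y] by auto
  obtain v where v: "v \<in> supp y u" "\<And>b. b \<in> supp y u \<Longrightarrow> code y b \<le> code y v"
    using lead_exists[OF y uc] by blast
  from normalize[OF y u v, of 0] obtain u1 v1 where 1: "u1 \<in> N y - generated F y" "normalized y u1 v1"
    by auto
  define Q where "Q = {code y v |v. \<exists>u\<in>N y - generated F y. normalized y u v}"
  have "code y v1 \<in> Q" using 1 unfolding Q_def by blast
  from wfE_min[OF wf_list_less_fixed_length[OF wf_P, of "len y"] this]
  obtain c where c: "c \<in> Q" "\<And>d. (d, c) \<in> {(xs, ys). xs \<in> lists P \<and> ys \<in> lists P \<and> length xs = len y \<and>
      length ys = len y \<and> xs < ys} \<Longrightarrow> d \<notin> Q" by blast
  have Qd: "d \<in> lists P \<and> length d = len y" if "d \<in> Q" for d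
    using that length_code[OF y] unfolding Q_def normalized_def by (auto simp: relpos_self[symmetric] supp_def)
  obtain u v where uv: "c = code y v" "u \<in> N y - generated F y" "normalized y u v"
    using c(1) by (auto simp: Q_def)
  have "\<not> code y v' < code y v" if "u' \<in> N y - generated F y" "normalized y u' v'" for u' v'
  proof
    assume less: "code y v' < code y v"
    have Q: "code y v' \<in> Q" using that unfolding Q_def by blast
    have "code y v' \<notin> Q"
      by (rule c(2)) (use less Qd[OF Q] Qd[OF c(1)] in \<open>simp add: uv(1)\<close>)
    with Q show False by contradiction
  qed
  with uv show ?thesis by blast
qed

text \<open>Otherwise generators can be picked forever, each minimal among the normalized elements
  not generated by its predecessors. Along a subsequence with pairwise embedded leading terms the
  ideals of leading coefficients become stationary, so some leading term can be cancelled by earlier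
  generators. The remainder contradicts minimality.\<close>

theorem submodule_finitely_generated:
  "\<exists>F. finite F \<and> (\<forall>(y, u)\<in>F. y \<in> obj C \<and> u \<in> N y) \<and> (\<forall>y\<in>obj C. N y \<subseteq> generated F y)"
proof (rule ccontr)
  assume not_fg: "\<not> ?thesis"
  define good where "good F t \<longleftrightarrow> (case t of (y, u, v) \<Rightarrow> y \<in> obj C \<and> u \<in> N y - generated F y \<and>
    normalized y u v \<and> (\<forall>u'\<in>N y - generated F y. \<forall>v'. normalized y u' v' \<longrightarrow> \<not> code y v' < code y v))" for F t
  define pick where "pick F = (SOME t. good F t)" for F
  define Fs where "Fs = rec_nat {} (\<lambda>_ F. insert (fst (pick F), fst (snd (pick F))) F)"
  have Fs: "Fs 0 = {}" "Fs (Suc k) = insert (fst (pick (Fs k)), fst (snd (pick (Fs k)))) (Fs k)" for k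
    by (simp_all add: Fs_def)
  have pick: "good F (pick F)" if F: "finite F" "\<forall>(y, u)\<in>F. y \<in> obj C \<and> u \<in> N y" for F
  proof -
    obtain y u where "y \<in> obj C" "u \<in> N y - generated F y"
      using not_fg F by blast
    from minimal_normalized_exists[OF this] \<open>y \<in> obj C\<close> have "\<exists>t. good F t"
      by (auto simp: good_def)
    then show ?thesis unfolding pick_def by (rule someI_ex)
  qed
  have Fs_ok: "finite (Fs k) \<and> (\<forall>(y, u)\<in>Fs k. y \<in> obj C \<and> u \<in> N y)" for k
  proof (induction k)
    case (Suc k)
    with pick[of "Fs k"] show ?case by (auto simp: Fs good_def)
  qed (simp add: Fs)
  define y u v where "y k = fst (pick (Fs k))" and "u k = fst (snd (pick (Fs k)))"
    and "v k = snd (snd (pick (Fs k)))" for k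
  have "good (Fs k) (y k, u k, v k)" for k
    using pick[of "Fs k"] Fs_ok[of k] by (simp add: y_def u_def v_def)
  then have y: "y k \<in> obj C" and u: "u k \<in> N (y k)" "u k \<notin> generated (Fs k) (y k)"
    and v: "normalized (y k) (u k) (v k)"
    and min: "\<And>u' v'. u' \<in> N (y k) - generated (Fs k) (y k) \<Longrightarrow> normalized (y k) u' v' \<Longrightarrow>
      \<not> code (y k) v' < code (y k) (v k)" for k
    by (auto simp: good_def)
  have uc: "u k \<in> carrier (mobj D (y k))" for k
    using u(1)[of k] N_subset[OF y[of k]] by auto
  have vb: "v k \<in> basis (y k)" for k
    using v[of k] by (simp add: normalized_def supp_def)
  have mem: "(y a, u a) \<in> Fs b" if "a < b" for a b
    using that by (induction b) (auto simp: Fs y_def u_def less_Suc_eq)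
  have "(y k, v k) \<in> {(y, v). y \<in> obj C \<and> v \<in> basis y \<and> code y v \<in> lists P}" for k
    using y vb v[of k] by (auto simp: normalized_def relpos_self[symmetric] simp del: in_lists_conv_set)
  \<comment> \<open>One embedded pair would not suffice: a leading coefficient is in general a
    combination of several earlier ones, and all of these leading terms have to embed into the same
    later one.\<close>
  from almost_full_on_subsequence[OF almost_full_embeds, of "\<lambda>k. (y k, v k)", OF this]
  obtain \<kappa> :: "nat \<Rightarrow> nat" where \<kappa>: "strict_mono \<kappa>"
    and div: "\<And>a b. a < b \<Longrightarrow> embeds (y (\<kappa> a), v (\<kappa> a)) (y (\<kappa> b), v (\<kappa> b))"
    by auto
  define c where "c a = coef (u (\<kappa> a)) (v (\<kappa> a))" for a
  have cK: "c a \<in> carrier K" for a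
    unfolding c_def by (rule coef_closed[OF uc vb])
  \<comment> \<open>Where the ascending chain of ideals has reached its union, the next coefficient
    is already in the ideal of the earlier ones.\<close>
  obtain b where b: "c b \<in> Idl\<^bsub>K\<^esub> (c ` {..<b})"
  proof -
    define I where "I = range (\<lambda>b. Idl\<^bsub>K\<^esub> (c ` {..<b}))"
    have cs: "c ` A \<subseteq> carrier K" for A using cK by auto
    have "subset.chain {I. ideal I K} I"
      unfolding subset_chain_def I_def
    proof safe
      show "ideal (Idl\<^bsub>K\<^esub> (c ` {..<b})) K" for b by (rule K.genideal_ideal[OF cs])
      fix a b s assume "s \<in> Idl\<^bsub>K\<^esub> (c ` {..<b})" "s \<notin> Idl\<^bsub>K\<^esub> (c ` {..<a})"
      moreover have "Idl\<^bsub>K\<^esub> (c ` {..<b}) \<subseteq> Idl\<^bsub>K\<^esub> (c ` {..<a})" if "b \<le> a"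
        using that by (intro K.subset_Idl_subset[OF cs] image_mono) auto
      ultimately have "a \<le> b" by force
      then have "Idl\<^bsub>K\<^esub> (c ` {..<a}) \<subseteq> Idl\<^bsub>K\<^esub> (c ` {..<b})"
        by (intro K.subset_Idl_subset[OF cs] image_mono) auto
      then show "t \<in> Idl\<^bsub>K\<^esub> (c ` {..<b})" if "t \<in> Idl\<^bsub>K\<^esub> (c ` {..<a})" for t
        using that by blast
    qed
    from noetherian_ring.ideal_chain_is_trivial[OF noetherian _ this] have "\<Union>I \<in> I"
      by (auto simp: I_def)
    then obtain b where b: "\<Union>I = Idl\<^bsub>K\<^esub> (c ` {..<b})" by (auto simp: I_def)
    have "c b \<in> Idl\<^bsub>K\<^esub> (c ` {..<Suc b})"
      using K.genideal_self[OF cs, of "{..<Suc b}"] by auto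
    then have "c b \<in> \<Union>I" by (auto simp: I_def)
    with b that show ?thesis by simp
  qed
  define yb vb' F where "yb = y (\<kappa> b)" and "vb' = v (\<kappa> b)" and "F = Fs (\<kappa> b)"
  have yb: "yb \<in> obj C" and ubN: "u (\<kappa> b) \<in> N yb" and ubG: "u (\<kappa> b) \<notin> generated F yb"
    and vbb: "vb' \<in> basis yb" and nb: "normalized yb (u (\<kappa> b)) vb'"
    using y u v vb by (auto simp: yb_def vb'_def F_def)
  interpret M: module K "mobj D yb" by (rule module_D[OF yb])
  have Nsub: "submodule (N yb) K (mobj D yb)"
    using N yb by (simp add: is_cat_submodule_def)
  note NE = M.submoduleE[OF Nsub]
  have N0: "\<zero>\<^bsub>mobj D yb\<^esub> \<in> N yb"
    using subgroup.one_closed[OF submodule.axioms(1)[OF Nsub]] by simp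
  \<comment> \<open>These elements can be added to \<open>u (\<kappa> b)\<close> without raising its
    leading word or violating positivity relative to it. Whether \<open>vb'\<close> occurs in them
    is left open.\<close>
  define low where "low e \<longleftrightarrow> e \<in> N yb \<and> (\<forall>s\<in>supp yb e. code yb s \<le> code yb vb' \<and>
      relpos P (code yb vb') (code yb s))" for e
  have lowD: "e \<in> N yb" "e \<in> carrier (mobj D yb)" if "low e" for e
    using that N_subset[OF yb] by (auto simp: low_def)
  have low_add: "low (e \<oplus>\<^bsub>mobj D yb\<^esub> e')" if "low e" "low e'" for e e'
  proof -
    have "supp yb (e \<oplus>\<^bsub>mobj D yb\<^esub> e') \<subseteq> supp yb e \<union> supp yb e'"
      by (auto simp: supp_def coef_add)
    then show ?thesis using that NE(5) by (auto simp: low_def)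
  qed
  have low_smult: "low (a \<odot>\<^bsub>mobj D yb\<^esub> e)" if "low e" "a \<in> carrier K" for a e
  proof -
    have "supp yb (a \<odot>\<^bsub>mobj D yb\<^esub> e) \<subseteq> supp yb e"
      using that by (auto simp: supp_def coef_smult)
    then show ?thesis using that NE(4) by (auto simp: low_def)
  qed
  \<comment> \<open>Showing that these coefficients form an ideal replaces writing
    \<open>c b\<close> as an explicit combination and summing the corresponding translates.\<close>
  define T where "T = {coef e vb' |e. low e \<and> e \<in> generated F yb}"
  have TI: "coef e vb' \<in> T" if "low e" "e \<in> generated F yb" for e
    using that by (auto simp: T_def)
  have TE: "\<exists>e. t = coef e vb' \<and> low e \<and> e \<in> generated F yb" if "t \<in> T" for t
    using that by (auto simp: T_def)
  have T_mult: "a \<otimes>\<^bsub>K\<^esub> t \<in> T" if a: "a \<in> carrier K" and t: "t \<in> T" for a t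
  proof -
    obtain e where e: "t = coef e vb'" "low e" "e \<in> generated F yb" using TE[OF t] by blast
    show ?thesis
      using TI[OF low_smult[OF e(2) a] generated_closed(3)[OF yb a e(3)]] by (simp add: coef_smult[OF vbb] e(1))
  qed
  have TK: "T \<subseteq> carrier K"
    using coef_closed[OF lowD(2) vbb] by (auto simp: T_def)
  have "ideal T K"
  proof (rule idealI)
    show "ring K" by (rule K.ring_axioms)
    show "subgroup T (add_monoid K)"
    proof (rule group.subgroupI[OF K.a_group])
      show "T \<subseteq> carrier (add_monoid K)" using TK by simp
      have "low \<zero>\<^bsub>mobj D yb\<^esub>"
        using N0 by (auto simp: low_def supp_def coef_zero)
      then show "T \<noteq> {}" using TI generated_closed(1)[OF yb] by blast
      fix a assume a: "a \<in> T"
      then have "(\<ominus>\<^bsub>K\<^esub> \<one>\<^bsub>K\<^esub>) \<otimes>\<^bsub>K\<^esub> a \<in> T" by (intro T_mult) auto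
      moreover have "(\<ominus>\<^bsub>K\<^esub> \<one>\<^bsub>K\<^esub>) \<otimes>\<^bsub>K\<^esub> a = \<ominus>\<^bsub>K\<^esub> a"
        using a TK by (auto simp: K.l_minus)
      ultimately show "inv\<^bsub>add_monoid K\<^esub> a \<in> T" by (simp add: a_inv_def)
      fix a' assume a': "a' \<in> T"
      obtain e where e: "a = coef e vb'" "low e" "e \<in> generated F yb" using TE[OF a] by blast
      obtain e' where e': "a' = coef e' vb'" "low e'" "e' \<in> generated F yb" using TE[OF a'] by blast
      show "a \<otimes>\<^bsub>add_monoid K\<^esub> a' \<in> T"
        using TI[OF low_add[OF e(2) e'(2)] generated_closed(2)[OF yb e(3) e'(3)]]
        by (simp add: coef_add[OF vbb] e(1) e'(1))
    qed
    show "t \<otimes>\<^bsub>K\<^esub> s \<in> T" if "s \<in> T" "t \<in> carrier K" for s t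
      using that by (intro T_mult)
    show "s \<otimes>\<^bsub>K\<^esub> t \<in> T" if "s \<in> T" "t \<in> carrier K" for s t
      using T_mult[OF that(2,1)] TK that by (metis K.m_comm subsetD)
  qed
  moreover have "c a \<in> T" if a: "a < b" for a
  proof -
    define ya where "ya = y (\<kappa> a)"
    have ya: "ya \<in> obj C" and uaN: "u (\<kappa> a) \<in> N ya" and uac: "u (\<kappa> a) \<in> carrier (mobj D ya)"
      and na: "normalized ya (u (\<kappa> a)) (v (\<kappa> a))" and va: "v (\<kappa> a) \<in> basis ya"
      using y u v uc vb by (auto simp: ya_def)
    obtain g where g: "g \<in> homset C ya yb" "act ya yb g (v (\<kappa> a)) = vb'"
      and mono: "order_preserving ya yb g"
      and rel: "\<And>s. s \<in> basis ya \<Longrightarrow> relpos P (code ya (v (\<kappa> a))) (code ya s) \<Longrightarrow>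
          relpos P (code yb vb') (code yb (act ya yb g s))"
      using embedsE[OF div[OF a]] unfolding ya_def yb_def vb'_def by blast
    \<comment> \<open>This translate of an earlier generator is low by the two preservation clauses
      of \<open>embeds\<close>, and its coefficient at \<open>vb'\<close> is
      \<open>c a\<close>.\<close>
    let ?e = "mmap D ya yb g (u (\<kappa> a))"
    have eN: "?e \<in> N yb"
      by (rule N_mmap[OF ya yb g(1) uaN])
    have "(ya, u (\<kappa> a)) \<in> F"
      unfolding ya_def F_def by (rule mem) (rule strict_monoD[OF \<kappa> a])
    then have eG: "?e \<in> generated F yb"
      by (intro generated_closed(4)[OF ya yb g(1)] generated_incl)
    have "code yb s \<le> code yb vb' \<and> relpos P (code yb vb') (code yb s)" if s: "s \<in> supp yb ?e" for s
    proof -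
      obtain s' where s': "s' \<in> supp ya (u (\<kappa> a))" "s = act ya yb g s'"
        using supp_mmap[OF ya yb g(1) uac] s by blast
      then have "s' \<in> basis ya" "code ya s' \<le> code ya (v (\<kappa> a))" "relpos P (code ya (v (\<kappa> a))) (code ya s')"
        using na s'(1) by (simp_all add: normalized_def supp_def del: split_paired_All)
      then show ?thesis
        using act_le[OF mono ya _ va] rel s'(2) g(2) by metis
    qed
    then have "low ?e" using eN by (simp add: low_def)
    from TI[OF this eG] show ?thesis
      using coef_mmap[OF ya yb g(1) uac act_inj[OF mono ya] va] by (simp add: g(2) c_def)
  qed
  ultimately have "Idl\<^bsub>K\<^esub> (c ` {..<b}) \<subseteq> T"
    by (intro K.genideal_minimal) auto
  with b obtain e where e: "c b = coef e vb'" "low e" "e \<in> generated F yb" using TE by blast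
  define m1 where "m1 = \<ominus>\<^bsub>K\<^esub> \<one>\<^bsub>K\<^esub>"
  have m1: "m1 \<in> carrier K" by (simp add: m1_def)
  define u' where "u' = u (\<kappa> b) \<oplus>\<^bsub>mobj D yb\<^esub> m1 \<odot>\<^bsub>mobj D yb\<^esub> e"
  have ubl: "low (u (\<kappa> b))"
    using nb ubN by (auto simp: low_def normalized_def)
  have u'l: "low u'"
    unfolding u'_def by (intro low_add low_smult ubl e(2) m1)
  have u'c: "u' \<in> carrier (mobj D yb)" by (rule lowD(2)[OF u'l])
  have coefu': "coef u' s = coef (u (\<kappa> b)) s \<ominus>\<^bsub>K\<^esub> coef e s" if "s \<in> basis yb" for s
    using coef_closed[OF lowD(2)[OF e(2)] that]
    by (simp add: u'_def coef_add[OF that] coef_smult[OF that] m1_def K.l_minus K.minus_eq)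
  have u'G: "u' \<notin> generated F yb"
  proof
    assume "u' \<in> generated F yb"
    then have *: "u' \<oplus>\<^bsub>mobj D yb\<^esub> e \<in> generated F yb"
      by (rule generated_closed(2)[OF yb _ e(3)])
    have "u' \<oplus>\<^bsub>mobj D yb\<^esub> e = u (\<kappa> b)"
    proof (rule D_eqI)
      show "u' \<oplus>\<^bsub>mobj D yb\<^esub> e \<in> carrier (mobj D yb)"
        using u'c lowD(2)[OF e(2)] by simp
      show "u (\<kappa> b) \<in> carrier (mobj D yb)" by (rule lowD(2)[OF ubl])
      show "coef (u' \<oplus>\<^bsub>mobj D yb\<^esub> e) s = coef (u (\<kappa> b)) s" if s: "s \<in> basis yb" for s
        using coef_closed[OF lowD(2)[OF e(2)] s] coef_closed[OF lowD(2)[OF ubl] s]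
        by (simp add: coef_add[OF s] coefu'[OF s] K.minus_eq K.a_assoc K.l_neg)
    qed
    with * ubG show False by simp
  qed
  obtain v' where v': "v' \<in> supp yb u'" "\<And>s. s \<in> supp yb u' \<Longrightarrow> code yb s \<le> code yb v'"
    using lead_exists[OF yb u'c] u'G generated_closed(1)[OF yb] by metis
  have v'b: "v' \<in> basis yb" using v'(1) by (simp add: supp_def)
  have "coef u' vb' = \<zero>\<^bsub>K\<^esub>"
    using e(1)[unfolded c_def, folded vb'_def] coef_closed[OF lowD(2)[OF e(2)] vbb]
    by (simp add: coefu'[OF vbb] K.r_neg K.minus_eq)
  then have "v' \<noteq> vb'" using v'(1) by (auto simp: supp_def)
  then have ne: "code yb v' \<noteq> code yb vb'"
    using inj_onD[OF inj_code[OF yb] _ v'b vbb] by blast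
  have leneq: "length (code yb v') = len yb" "length (code yb vb') = len yb"
    using length_code[OF yb] v'b vbb by auto
  have "code yb v' < code yb vb'"
    using u'l v'(1) ne by (auto simp: low_def)
  then obtain j where j: "j < len yb" "take j (code yb v') = take j (code yb vb')"
    "code yb v' ! j < code yb vb' ! j"
    using list_less_iff_first_difference leneq by metis
  \<comment> \<open>Up to position j, agreeing with v' means agreeing with vb', so positivity
    relative to vb' provides the start of normalization relative to v'. Beyond j it says nothing
    about words that share the drop at j.\<close>
  have "code yb s ! l \<in> P"
    if s: "s \<in> supp yb u'" and l: "l < Suc j" and eq: "take l (code yb s) = take l (code yb v')" for s l
  proof -
    have "take l (code yb s) = take l (code yb vb')"
      using eq arg_cong[OF j(2), of "take l"] l by (simp add: min_absorb1)
    moreover have "relpos P (code yb vb') (code yb s)"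
      using u'l s by (simp add: low_def)
    ultimately show ?thesis
      using l j(1) leneq(2) by (auto simp: relpos_def)
  qed
  \<comment> \<open>Starting at \<open>Suc j\<close> protects letter j, the one in which the leading
    word dropped.\<close>
  then obtain u2 v2 where u2: "u2 \<in> N yb - generated F yb" "normalized yb u2 v2"
    "take (Suc j) (code yb v2) = take (Suc j) (code yb v')"
    using normalize[OF yb _ v', of F "Suc j"] lowD(1)[OF u'l] u'G j(1) by (auto simp: Suc_le_eq)
  have len2: "length (code yb v2) = len yb"
    using u2(2) length_code[OF yb] by (auto simp: normalized_def supp_def)
  have "take j (code yb v2) = take j (code yb vb')"
    using arg_cong[OF u2(3), of "take j"] j(2) by (simp add: min_absorb1)
  moreover have "code yb v2 ! j = code yb v' ! j"
    using u2(3) by (metis lessI nth_take)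
  ultimately have "code yb v2 < code yb vb'"
    using list_less_iff_first_difference[of "code yb v2" "code yb vb'"] len2 leneq j by auto
  with min[of u2 "\<kappa> b" v2] u2 show False
    by (simp add: yb_def F_def vb'_def)
qed

end

end

section \<open>Coordinates in based modules\<close>

definition rank :: "('r, 'v, 'i) based_module \<Rightarrow> nat" where
  "rank y = card (index_set y)"

definition pos :: "('r, 'v, 'i) based_module \<Rightarrow> 'i \<Rightarrow> nat" where
  "pos y i = card {j \<in> index_set y. (i, j) \<in> index_order y \<and> j \<noteq> i}"

definition index_at :: "('r, 'v, 'i) based_module \<Rightarrow> nat \<Rightarrow> 'i" where
  "index_at y = inv_into (index_set y) (pos y)"

definition bvec :: "('r, 'v, 'i) based_module \<Rightarrow> nat \<Rightarrow> 'v" where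
  "bvec y r = basis_vector y (index_at y r)"

definition coord :: "('r, 'p) ring_scheme \<Rightarrow> ('r, 'v, 'i) based_module \<Rightarrow> 'v \<Rightarrow> nat \<Rightarrow> 'r" where
  "coord R y v r = (THE a. a \<in> {..<rank y} \<rightarrow>\<^sub>E carrier R \<and>
     v = (\<Oplus>\<^bsub>underlying y\<^esub>s\<in>{..<rank y}. a s \<odot>\<^bsub>underlying y\<^esub> bvec y s)) r"

locale OVI_object = ring R for R :: "('r, 'p) ring_scheme" (structure) +
  fixes y :: "('r, 'v, 'i) based_module"
  assumes y: "y \<in> OVI_objects R"
begin

sublocale M: left_module R "underlying y"
  using y by (simp add: OVI_objects_def)

lemma finite_index_set: "finite (index_set y)"
  using y by (simp add: OVI_objects_def is_basis_def)

lemma pos_less_iff: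
  assumes i: "i \<in> index_set y" and j: "j \<in> index_set y"
  shows "pos y i < pos y j \<longleftrightarrow> (j, i) \<in> index_order y \<and> i \<noteq> j"
proof -
  have ord: "linear_order_on (index_set y) (index_order y)"
    using y by (simp add: OVI_objects_def)
  have less: "pos y i < pos y j"
    if i: "i \<in> index_set y" and j: "j \<in> index_set y" and ji: "(j, i) \<in> index_order y" "i \<noteq> j" for i j
    unfolding pos_def
  proof (rule psubset_card_mono)
    have trans: "(j, k) \<in> index_order y" if "(i, k) \<in> index_order y" for k
      using ord that ji(1)
      by (auto simp: linear_order_on_def partial_order_on_def preorder_on_def dest: transD)
    have anti: "k \<noteq> j" if "(i, k) \<in> index_order y" for k
      using ord that ji
      by (auto simp: linear_order_on_def partial_order_on_def dest: antisymD)
    show "{k \<in> index_set y. (i, k) \<in> index_order y \<and> k \<noteq> i} \<subset> {k \<in> index_set y. (j, k) \<in> index_order y \<and> k \<noteq> j}"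
      using trans anti i ji by auto
  qed (use finite_index_set in simp)
  have "(i, j) \<in> index_order y \<or> (j, i) \<in> index_order y" if "i \<noteq> j"
    using ord that i j by (auto simp: linear_order_on_def total_on_def)
  then show ?thesis
    using less[OF i j] less[OF j i] by fastforce
qed

lemma bij_pos: "bij_betw (pos y) (index_set y) {..<rank y}"
proof -
  have ord: "linear_order_on (index_set y) (index_order y)"
    using y by (simp add: OVI_objects_def)
  have inj: "inj_on (pos y) (index_set y)"
  proof (rule inj_onI)
    fix i j assume ij: "i \<in> index_set y" "j \<in> index_set y" "pos y i = pos y j"
    then show "i = j"
      using pos_less_iff[of i j] pos_less_iff[of j i] ord
      by (auto simp: linear_order_on_def total_on_def)
  qed
  have "pos y i < rank y" if "i \<in> index_set y" for i
    unfolding pos_def rank_def using that finite_index_set by (intro psubset_card_mono) auto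
  then have "pos y ` index_set y \<subseteq> {..<rank y}" by auto
  moreover have "card (pos y ` index_set y) = card {..<rank y}"
    using card_image[OF inj] by (simp add: rank_def)
  ultimately have "pos y ` index_set y = {..<rank y}"
    by (intro card_subset_eq) auto
  with inj show ?thesis by (simp add: bij_betw_def)
qed

lemma index_at:
  assumes "r < rank y"
  shows "index_at y r \<in> index_set y" "pos y (index_at y r) = r"
  using assms bij_pos unfolding index_at_def
  by (auto simp: bij_betw_def intro: inv_into_into f_inv_into_f)

lemma pos:
  assumes "i \<in> index_set y"
  shows "pos y i < rank y" "index_at y (pos y i) = i"
  using assms bij_pos unfolding index_at_def by (auto simp: bij_betw_def)

lemma bij_index_at: "bij_betw (index_at y) {..<rank y} (index_set y)"
  unfolding index_at_def by (rule bij_betw_inv_into[OF bij_pos])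

lemma below_eq:
  assumes "r < rank y"
  shows "below y (index_at y r) = index_at y ` {r<..<rank y}"
proof
  show "below y (index_at y r) \<subseteq> index_at y ` {r<..<rank y}"
  proof
    fix j assume j: "j \<in> below y (index_at y r)"
    then have "pos y (index_at y r) < pos y j"
      using index_at[OF assms] by (subst pos_less_iff) (auto simp: below_def)
    then show "j \<in> index_at y ` {r<..<rank y}"
      using index_at[OF assms] pos j by (intro image_eqI[of _ _ "pos y j"]) (auto simp: below_def)
  qed
  show "index_at y ` {r<..<rank y} \<subseteq> below y (index_at y r)"
  proof clarsimp
    fix s assume s: "r < s" "s < rank y"
    then have *: "pos y (index_at y r) < pos y (index_at y s)"
      using index_at assms by auto
    note pos_less_iff[OF index_at(1)[OF assms] index_at(1)[OF s(2)], THEN iffD1, OF *]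
    then show "index_at y s \<in> below y (index_at y r)"
      using index_at(1)[OF s(2)] by (auto simp: below_def)
  qed
qed

lemma bvec_closed [simp]: "r < rank y \<Longrightarrow> bvec y r \<in> carrier (underlying y)"
  using y index_at by (auto simp: OVI_objects_def is_basis_def bvec_def)

lemma coord_unique:
  assumes v: "v \<in> carrier (underlying y)"
  shows "\<exists>!a. a \<in> {..<rank y} \<rightarrow>\<^sub>E carrier R \<and>
     v = (\<Oplus>\<^bsub>underlying y\<^esub>s\<in>{..<rank y}. a s \<odot>\<^bsub>underlying y\<^esub> bvec y s)"
proof -
  let ?V = "underlying y"
  have basis: "basis_vector y \<in> index_set y \<rightarrow> carrier ?V"
    using y by (auto simp: OVI_objects_def is_basis_def)
  have sum: "(\<Oplus>\<^bsub>?V\<^esub>i\<in>index_set y. a i \<odot>\<^bsub>?V\<^esub> basis_vector y i)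
      = (\<Oplus>\<^bsub>?V\<^esub>s\<in>{..<rank y}. a (index_at y s) \<odot>\<^bsub>?V\<^esub> bvec y s)"
    if "a \<in> index_set y \<rightarrow> carrier R" for a
    unfolding bvec_def
    using M.V.add.finprod_reindex[of "\<lambda>i. a i \<odot>\<^bsub>?V\<^esub> basis_vector y i" "index_at y" "{..<rank y}"]
      bij_index_at basis that by (auto simp: bij_betw_def Pi_def)
  have ex1: "\<exists>!a. a \<in> index_set y \<rightarrow>\<^sub>E carrier R \<and> v = (\<Oplus>\<^bsub>?V\<^esub>i\<in>index_set y. a i \<odot>\<^bsub>?V\<^esub> basis_vector y i)"
    using y v by (auto simp: OVI_objects_def is_basis_def)
  then obtain a where a: "a \<in> index_set y \<rightarrow>\<^sub>E carrier R"
    "v = (\<Oplus>\<^bsub>?V\<^esub>i\<in>index_set y. a i \<odot>\<^bsub>?V\<^esub> basis_vector y i)" by blast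
  show ?thesis
  proof (rule ex1I[of _ "\<lambda>s\<in>{..<rank y}. a (index_at y s)"], intro conjI)
    show "(\<lambda>s\<in>{..<rank y}. a (index_at y s)) \<in> {..<rank y} \<rightarrow>\<^sub>E carrier R"
      using a(1) index_at by auto
    have "v = (\<Oplus>\<^bsub>?V\<^esub>s\<in>{..<rank y}. a (index_at y s) \<odot>\<^bsub>?V\<^esub> bvec y s)"
      unfolding a(2) using a(1) by (intro sum) auto
    also have "\<dots> = (\<Oplus>\<^bsub>?V\<^esub>s\<in>{..<rank y}. (\<lambda>s\<in>{..<rank y}. a (index_at y s)) s \<odot>\<^bsub>?V\<^esub> bvec y s)"
      using a(1) index_at by (intro M.V.finsum_cong') (auto simp: PiE_iff)
    finally show "v = \<dots>" .
    fix b assume b: "b \<in> {..<rank y} \<rightarrow>\<^sub>E carrier R \<and> v = (\<Oplus>\<^bsub>?V\<^esub>s\<in>{..<rank y}. b s \<odot>\<^bsub>?V\<^esub> bvec y s)"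
    let ?b = "\<lambda>i\<in>index_set y. b (pos y i)"
    have "(\<Oplus>\<^bsub>?V\<^esub>i\<in>index_set y. ?b i \<odot>\<^bsub>?V\<^esub> basis_vector y i)
        = (\<Oplus>\<^bsub>?V\<^esub>s\<in>{..<rank y}. ?b (index_at y s) \<odot>\<^bsub>?V\<^esub> bvec y s)"
      using b pos by (intro sum) auto
    also have "\<dots> = (\<Oplus>\<^bsub>?V\<^esub>s\<in>{..<rank y}. b s \<odot>\<^bsub>?V\<^esub> bvec y s)"
      using b index_at by (intro M.V.finsum_cong') (auto simp: PiE_iff)
    finally have "?b \<in> index_set y \<rightarrow>\<^sub>E carrier R \<and> v = (\<Oplus>\<^bsub>?V\<^esub>i\<in>index_set y. ?b i \<odot>\<^bsub>?V\<^esub> basis_vector y i)"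
      using b pos by auto
    with ex1 a have "?b = a" by blast
    show "b = (\<lambda>s\<in>{..<rank y}. a (index_at y s))"
    proof (rule extensionalityI[of _ "{..<rank y}"])
      fix s assume s: "s \<in> {..<rank y}"
      then have "a (index_at y s) = b s"
        using index_at[of s] by (auto simp flip: \<open>?b = a\<close>)
      with s show "b s = (\<lambda>s\<in>{..<rank y}. a (index_at y s)) s" by simp
    qed (use conjunct1[OF b] in \<open>simp_all add: PiE_iff\<close>)
  qed
qed

lemma coord:
  assumes v: "v \<in> carrier (underlying y)"
  shows coord_closed: "r < rank y \<Longrightarrow> coord R y v r \<in> carrier R"
    and coord_expand: "v = (\<Oplus>\<^bsub>underlying y\<^esub>s\<in>{..<rank y}. coord R y v s \<odot>\<^bsub>underlying y\<^esub> bvec y s)"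
proof -
  have "coord R y v = (THE a. a \<in> {..<rank y} \<rightarrow>\<^sub>E carrier R \<and>
     v = (\<Oplus>\<^bsub>underlying y\<^esub>s\<in>{..<rank y}. a s \<odot>\<^bsub>underlying y\<^esub> bvec y s))"
    by (rule ext) (simp only: coord_def)
  note * = theI'[OF coord_unique[OF v], folded this]
  show "coord R y v r \<in> carrier R" if "r < rank y"
    using PiE_mem[OF conjunct1[OF *]] that by simp
  show "v = (\<Oplus>\<^bsub>underlying y\<^esub>s\<in>{..<rank y}. coord R y v s \<odot>\<^bsub>underlying y\<^esub> bvec y s)"
    by (rule conjunct2[OF *])
qed

lemma coord_finsum_bvec:
  assumes a: "a \<in> {..<rank y} \<rightarrow> carrier R" and r: "r < rank y"
  shows "coord R y (\<Oplus>\<^bsub>underlying y\<^esub>s\<in>{..<rank y}. a s \<odot>\<^bsub>underlying y\<^esub> bvec y s) r = a r"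
proof -
  let ?V = "underlying y"
  let ?v = "\<Oplus>\<^bsub>?V\<^esub>s\<in>{..<rank y}. a s \<odot>\<^bsub>?V\<^esub> bvec y s"
  have v: "?v \<in> carrier ?V"
    using a by (intro M.V.finsum_closed) (auto simp: Pi_iff)
  have "?v = (\<Oplus>\<^bsub>?V\<^esub>s\<in>{..<rank y}. restrict a {..<rank y} s \<odot>\<^bsub>?V\<^esub> bvec y s)"
    using a by (intro M.V.finsum_cong') (auto simp: Pi_iff)
  then have "(THE b. b \<in> {..<rank y} \<rightarrow>\<^sub>E carrier R \<and>
      ?v = (\<Oplus>\<^bsub>?V\<^esub>s\<in>{..<rank y}. b s \<odot>\<^bsub>?V\<^esub> bvec y s)) = restrict a {..<rank y}"
    using a by (intro the1_equality[OF coord_unique[OF v]]) auto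
  with r show ?thesis by (simp add: coord_def)
qed

lemma coord_eqI:
  assumes "v \<in> carrier (underlying y)" "w \<in> carrier (underlying y)"
    and "\<And>r. r < rank y \<Longrightarrow> coord R y v r = coord R y w r"
  shows "v = w"
proof -
  have "v = (\<Oplus>\<^bsub>underlying y\<^esub>s\<in>{..<rank y}. coord R y v s \<odot>\<^bsub>underlying y\<^esub> bvec y s)"
    by (rule coord_expand[OF assms(1)])
  also have "\<dots> = (\<Oplus>\<^bsub>underlying y\<^esub>s\<in>{..<rank y}. coord R y w s \<odot>\<^bsub>underlying y\<^esub> bvec y s)"
    using assms coord_closed by (intro M.V.finsum_cong') auto
  also have "\<dots> = w"
    by (rule coord_expand[OF assms(2), symmetric])
  finally show ?thesis .
qed

lemma coord_add:
  assumes v: "v \<in> carrier (underlying y)" "w \<in> carrier (underlying y)" and r: "r < rank y"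
  shows "coord R y (v \<oplus>\<^bsub>underlying y\<^esub> w) r = coord R y v r \<oplus> coord R y w r"
proof -
  let ?V = "underlying y"
  have "v \<oplus>\<^bsub>?V\<^esub> w = (\<Oplus>\<^bsub>?V\<^esub>s\<in>{..<rank y}. coord R y v s \<odot>\<^bsub>?V\<^esub> bvec y s)
      \<oplus>\<^bsub>?V\<^esub> (\<Oplus>\<^bsub>?V\<^esub>s\<in>{..<rank y}. coord R y w s \<odot>\<^bsub>?V\<^esub> bvec y s)"
    by (rule arg_cong2[OF coord_expand[OF v(1)] coord_expand[OF v(2)]])
  also have "\<dots> = (\<Oplus>\<^bsub>?V\<^esub>s\<in>{..<rank y}. coord R y v s \<odot>\<^bsub>?V\<^esub> bvec y s \<oplus>\<^bsub>?V\<^esub> coord R y w s \<odot>\<^bsub>?V\<^esub> bvec y s)"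
    using v coord_closed by (intro M.V.finsum_addf[symmetric]) auto
  also have "\<dots> = (\<Oplus>\<^bsub>?V\<^esub>s\<in>{..<rank y}. (coord R y v s \<oplus> coord R y w s) \<odot>\<^bsub>?V\<^esub> bvec y s)"
    using v coord_closed by (intro M.V.finsum_cong') (auto simp: M.smult_l_distr)
  finally show ?thesis
    using v coord_closed r by (simp add: coord_finsum_bvec)
qed

lemma coord_smult:
  assumes v: "v \<in> carrier (underlying y)" and a: "a \<in> carrier R" and r: "r < rank y"
  shows "coord R y (a \<odot>\<^bsub>underlying y\<^esub> v) r = a \<otimes> coord R y v r"
proof -
  let ?V = "underlying y"
  have "a \<odot>\<^bsub>?V\<^esub> v = a \<odot>\<^bsub>?V\<^esub> (\<Oplus>\<^bsub>?V\<^esub>s\<in>{..<rank y}. coord R y v s \<odot>\<^bsub>?V\<^esub> bvec y s)"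
    by (rule arg_cong[OF coord_expand[OF v]])
  also have "\<dots> = (\<Oplus>\<^bsub>?V\<^esub>s\<in>{..<rank y}. a \<odot>\<^bsub>?V\<^esub> (coord R y v s \<odot>\<^bsub>?V\<^esub> bvec y s))"
    using v a coord_closed by (intro M.smult_finsum) auto
  also have "\<dots> = (\<Oplus>\<^bsub>?V\<^esub>s\<in>{..<rank y}. (a \<otimes> coord R y v s) \<odot>\<^bsub>?V\<^esub> bvec y s)"
    using v a coord_closed by (intro M.V.finsum_cong') (auto simp: M.smult_assoc1)
  finally show ?thesis
    using v a coord_closed r by (simp add: coord_finsum_bvec)
qed

lemma coord_finsum:
  assumes "finite S" "g \<in> S \<rightarrow> carrier (underlying y)" and r: "r < rank y"
  shows "coord R y (\<Oplus>\<^bsub>underlying y\<^esub>s\<in>S. g s) r = (\<Oplus>s\<in>S. coord R y (g s) r)"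
  using assms(1,2)
proof (induction S rule: finite_induct)
  case empty
  have "coord R y (\<zero> \<odot>\<^bsub>underlying y\<^esub> \<zero>\<^bsub>underlying y\<^esub>) r = \<zero> \<otimes> coord R y \<zero>\<^bsub>underlying y\<^esub> r"
    by (rule coord_smult) (use r in auto)
  then show ?case using coord_closed[of "\<zero>\<^bsub>underlying y\<^esub>" r] r by simp
next
  case (insert s S)
  then have g: "g s \<in> carrier (underlying y)" "g \<in> S \<rightarrow> carrier (underlying y)" by auto
  have c: "(\<lambda>s. coord R y (g s) r) \<in> S \<rightarrow> carrier R"
    using g r coord_closed by auto
  have "coord R y (\<Oplus>\<^bsub>underlying y\<^esub>s\<in>insert s S. g s) r
      = coord R y (g s \<oplus>\<^bsub>underlying y\<^esub> (\<Oplus>\<^bsub>underlying y\<^esub>s\<in>S. g s)) r"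
    by (simp only: M.V.finsum_insert[OF insert.hyps g(2,1)])
  also have "\<dots> = coord R y (g s) r \<oplus> (\<Oplus>s\<in>S. coord R y (g s) r)"
    using coord_add[OF g(1) M.V.finsum_closed[OF g(2)] r] insert.IH[OF g(2)] by simp
  also have "\<dots> = (\<Oplus>s\<in>insert s S. coord R y (g s) r)"
    by (rule finsum_insert[OF insert.hyps c coord_closed[OF g(1) r], symmetric])
  finally show ?case .
qed

lemma coord_bvec:
  assumes "r < rank y" "s < rank y"
  shows "coord R y (bvec y s) r = (if r = s then \<one> else \<zero>)"
proof -
  let ?V = "underlying y"
  have "(\<Oplus>\<^bsub>?V\<^esub>t\<in>{..<rank y}. (if t = s then \<one> else \<zero>) \<odot>\<^bsub>?V\<^esub> bvec y t)
      = (\<Oplus>\<^bsub>?V\<^esub>t\<in>{..<rank y}. if s = t then bvec y t else \<zero>\<^bsub>?V\<^esub>)"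
    by (intro M.V.finsum_cong') auto
  also have "\<dots> = bvec y s"
    using assms by (intro M.V.finsum_singleton) auto
  finally have "coord R y (bvec y s) r
      = coord R y (\<Oplus>\<^bsub>?V\<^esub>t\<in>{..<rank y}. (if t = s then \<one> else \<zero>) \<odot>\<^bsub>?V\<^esub> bvec y t) r"
    by (simp only:)
  also have "\<dots> = (if r = s then \<one> else \<zero>)"
    using assms(1) by (intro coord_finsum_bvec) auto
  finally show ?thesis .
qed

lemma basis_vector_eq: "i \<in> index_set y \<Longrightarrow> basis_vector y i = bvec y (pos y i)"
  by (simp add: bvec_def pos)

text \<open>As \<open>pos\<close> reverses the index order, the smaller indices occupy the later
  positions; hence the coordinates up to and including r vanish.\<close>

lemma combinations_below_iff:
  assumes r: "r < rank y"
  shows "v \<in> M.combinations (below y (index_at y r)) (basis_vector y) \<longleftrightarrow>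
    v \<in> carrier (underlying y) \<and> (\<forall>s\<le>r. coord R y v s = \<zero>)"
proof -
  let ?V = "underlying y"
  have inj: "inj_on (index_at y) {r<..<rank y}"
    by (rule inj_on_subset[OF bij_betw_imp_inj_on[OF bij_index_at]]) auto
  have sum: "(\<Oplus>\<^bsub>?V\<^esub>i\<in>below y (index_at y r). a i \<odot>\<^bsub>?V\<^esub> basis_vector y i)
      = (\<Oplus>\<^bsub>?V\<^esub>s\<in>{..<rank y}. (if r < s then a (index_at y s) else \<zero>) \<odot>\<^bsub>?V\<^esub> bvec y s)"
    if a: "a \<in> below y (index_at y r) \<rightarrow> carrier R" for a
  proof -
    have "(\<Oplus>\<^bsub>?V\<^esub>i\<in>below y (index_at y r). a i \<odot>\<^bsub>?V\<^esub> basis_vector y i)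
        = (\<Oplus>\<^bsub>?V\<^esub>s\<in>{r<..<rank y}. a (index_at y s) \<odot>\<^bsub>?V\<^esub> bvec y s)"
      unfolding below_eq[OF r] bvec_def
    proof (rule M.V.add.finprod_reindex[OF _ inj], rule Pi_I)
      fix i assume i: "i \<in> index_at y ` {r<..<rank y}"
      then have "basis_vector y i \<in> carrier ?V"
        using bvec_closed by (auto simp: bvec_def)
      moreover have "a i \<in> carrier R"
        using a i by (auto simp: below_eq[OF r])
      ultimately show "a i \<odot>\<^bsub>?V\<^esub> basis_vector y i \<in> carrier ?V" by simp
    qed
    also have "\<dots> = (\<Oplus>\<^bsub>?V\<^esub>s\<in>{..<rank y}. (if r < s then a (index_at y s) else \<zero>) \<odot>\<^bsub>?V\<^esub> bvec y s)"
      using a by (intro M.V.add.finprod_mono_neutral_cong_left) (auto simp: below_eq[OF r] Pi_def)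
    finally show ?thesis .
  qed
  show ?thesis
  proof (intro iffI)
    assume "v \<in> M.combinations (below y (index_at y r)) (basis_vector y)"
    then obtain a where a: "a \<in> below y (index_at y r) \<rightarrow> carrier R"
      "v = (\<Oplus>\<^bsub>?V\<^esub>i\<in>below y (index_at y r). a i \<odot>\<^bsub>?V\<^esub> basis_vector y i)"
      by (auto simp: M.combinations_def)
    have a': "(\<lambda>s. if r < s then a (index_at y s) else \<zero>) \<in> {..<rank y} \<rightarrow> carrier R"
      using a(1) by (auto simp: below_eq[OF r] Pi_def)
    show "v \<in> carrier ?V \<and> (\<forall>s\<le>r. coord R y v s = \<zero>)"
      unfolding a(2) sum[OF a(1)] using a' r
      by (auto simp: coord_finsum_bvec intro!: M.V.finsum_closed)
  next
    assume v: "v \<in> carrier ?V \<and> (\<forall>s\<le>r. coord R y v s = \<zero>)"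
    let ?a = "\<lambda>i. coord R y v (pos y i)"
    have a: "?a \<in> below y (index_at y r) \<rightarrow> carrier R"
      using v coord_closed pos(1) by (auto simp: below_def)
    have "(\<Oplus>\<^bsub>?V\<^esub>i\<in>below y (index_at y r). ?a i \<odot>\<^bsub>?V\<^esub> basis_vector y i)
        = (\<Oplus>\<^bsub>?V\<^esub>s\<in>{..<rank y}. coord R y v s \<odot>\<^bsub>?V\<^esub> bvec y s)"
      unfolding sum[OF a] using v coord_closed index_at
      by (intro M.V.finsum_cong') (auto simp: not_less)
    also have "\<dots> = v"
      by (rule coord_expand[symmetric]) (use v in simp)
    finally show "v \<in> M.combinations (below y (index_at y r)) (basis_vector y)"
      using a by (auto simp: M.combinations_def intro!: exI[of _ ?a])
  qed
qed

end

section \<open>Matrices of morphisms\<close>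

text \<open>
  A morphism is encoded by the matrix of its values on the basis vectors.  Since \<^const>\<open>pos\<close> numbers
  rows and columns from the largest basis index downwards, this matrix is in lower echelon form.
\<close>

definition echelon ::
  "('r, 'p) ring_scheme \<Rightarrow> nat \<Rightarrow> nat \<Rightarrow> (nat \<Rightarrow> nat \<Rightarrow> 'r) \<Rightarrow> (nat \<Rightarrow> nat) \<Rightarrow> bool" where
  "echelon R n d A \<rho> \<longleftrightarrow> (\<forall>r<n. \<forall>c<d. A r c \<in> carrier R) \<and>
     (\<forall>c<d. \<rho> c < n \<and> A (\<rho> c) c = \<one>\<^bsub>R\<^esub> \<and> (\<forall>r<\<rho> c. A r c = \<zero>\<^bsub>R\<^esub>)) \<and>
     (\<forall>c<d. \<forall>c'<c. \<rho> c' < \<rho> c)"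

definition mat ::
  "('r, 'p) ring_scheme \<Rightarrow> ('r, 'v, 'i) based_module \<Rightarrow> ('r, 'v, 'i) based_module \<Rightarrow>
   ('v \<Rightarrow> 'v) \<times> ('i \<Rightarrow> 'i) \<Rightarrow> nat \<Rightarrow> nat \<Rightarrow> 'r" where
  "mat R x y f r c = coord R y (fst f (bvec x c)) r"

definition piv ::
  "('r, 'v, 'i) based_module \<Rightarrow> ('r, 'v, 'i) based_module \<Rightarrow> ('v \<Rightarrow> 'v) \<times> ('i \<Rightarrow> 'i) \<Rightarrow> nat \<Rightarrow> nat" where
  "piv x y f c = pos y (snd f (index_at x c))"

locale OVI_pair = X: OVI_object R x + Y: OVI_object R y
  for R :: "('r, 'p) ring_scheme" (structure) and x y :: "('r, 'v, 'i) based_module"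
begin

lemma hom_linear:
  assumes "f \<in> OVI_hom R x y"
  shows "fst f \<in> linear_maps R (underlying x) (underlying y)"
  using assms by (auto simp: OVI_hom_def)

lemma hom_closed:
  assumes "f \<in> OVI_hom R x y" "v \<in> carrier (underlying x)"
  shows "fst f v \<in> carrier (underlying y)"
  using hom_linear[OF assms(1)] assms(2) by (auto simp: linear_maps_def)

lemma mat_closed:
  assumes "f \<in> OVI_hom R x y" "r < rank y" "c < rank x"
  shows "mat R x y f r c \<in> carrier R"
  unfolding mat_def by (intro Y.coord_closed hom_closed assms X.bvec_closed)

lemma hom_expand:
  assumes f: "f \<in> OVI_hom R x y" and v: "v \<in> carrier (underlying x)"
  shows "fst f v = (\<Oplus>\<^bsub>underlying y\<^esub>c\<in>{..<rank x}. coord R x v c \<odot>\<^bsub>underlying y\<^esub> fst f (bvec x c))"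
proof -
  have "fst f v = fst f (\<Oplus>\<^bsub>underlying x\<^esub>c\<in>{..<rank x}. coord R x v c \<odot>\<^bsub>underlying x\<^esub> bvec x c)"
    by (rule arg_cong[OF X.coord_expand[OF v]])
  also have "\<dots> = (\<Oplus>\<^bsub>underlying y\<^esub>c\<in>{..<rank x}. fst f (coord R x v c \<odot>\<^bsub>underlying x\<^esub> bvec x c))"
    using X.coord_closed[OF v]
    by (intro linear_maps_finsum[OF X.M.left_module_axioms Y.M.left_module_axioms hom_linear[OF f]]) auto
  also have "\<dots> = (\<Oplus>\<^bsub>underlying y\<^esub>c\<in>{..<rank x}. coord R x v c \<odot>\<^bsub>underlying y\<^esub> fst f (bvec x c))"
    using hom_linear[OF f] X.coord_closed[OF v] hom_closed[OF f]
    by (intro Y.M.V.finsum_cong') (auto simp: linear_maps_def)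
  finally show ?thesis .
qed

lemma hom_echelon:
  assumes f: "f \<in> OVI_hom R x y"
  shows "echelon R (rank y) (rank x) (mat R x y f) (piv x y f)"
  unfolding echelon_def
proof (intro conjI allI impI)
  obtain f1 f0 where f10: "f = (f1, f0)" by (cases f)
  note hom = f[unfolded f10 OVI_hom_iff[OF Y.y]]
  have f0: "f0 i \<in> index_set y" if "i \<in> index_set x" for i
    using hom that by auto
  show "mat R x y f r c \<in> carrier R" if "r < rank y" "c < rank x" for r c
    by (rule mat_closed[OF f that])
  fix c assume c: "c < rank x"
  let ?i = "index_at x c"
  have i: "?i \<in> index_set x" by (rule X.index_at[OF c])
  have r: "piv x y f c < rank y" "index_at y (piv x y f c) = f0 ?i"
    using Y.pos[OF f0[OF i]] by (simp_all add: piv_def f10)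
  show "piv x y f c < rank y" by (rule r)
  obtain w where w: "w \<in> Y.M.combinations (below y (f0 ?i)) (basis_vector y)"
    "f1 (bvec x c) = basis_vector y (f0 ?i) \<oplus>\<^bsub>underlying y\<^esub> w"
    using hom i unfolding bvec_def by blast
  have w': "w \<in> carrier (underlying y)" "\<And>s. s \<le> piv x y f c \<Longrightarrow> coord R y w s = \<zero>"
    using w(1) Y.combinations_below_iff[OF r(1)] unfolding r(2) by auto
  have m: "mat R x y f s c = (if s = piv x y f c then \<one> else \<zero>) \<oplus> coord R y w s" if "s < rank y" for s
    unfolding mat_def using that w(2) w'(1) r(1) Y.basis_vector_eq[OF f0[OF i]]
    by (simp add: f10 Y.coord_add Y.coord_bvec piv_def)
  show "mat R x y f (piv x y f c) c = \<one>"
    using m[OF r(1)] w'(2) by simp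
  show "mat R x y f s c = \<zero>" if "s < piv x y f c" for s
    using m[of s] w'(2)[of s] that r(1) by simp
  show "piv x y f c' < piv x y f c" if c': "c' < c" for c'
  proof -
    have c'x: "c' < rank x" using c c' by simp
    have i': "index_at x c' \<in> index_set x" by (rule X.index_at[OF c'x])
    have "pos x (index_at x c') < pos x ?i"
      using c' c c'x by (simp add: X.index_at)
    then have "(?i, index_at x c') \<in> index_order x" "index_at x c' \<noteq> ?i"
      using X.pos_less_iff[OF i' i] by auto
    then have "(f0 ?i, f0 (index_at x c')) \<in> index_order y" "f0 (index_at x c') \<noteq> f0 ?i"
      using hom i i' by (auto dest: inj_onD)
    then show ?thesis
      using Y.pos_less_iff[OF f0[OF i'] f0[OF i]] by (simp add: piv_def f10)
  qed
qed

text \<open>The matrix determines the linear map, and also the index map: since 1 is not 0, the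
  pivot of a column is the row of its first nonzero entry.\<close>

lemma hom_eqI:
  assumes one: "\<one> \<noteq> \<zero>" and f: "f \<in> OVI_hom R x y" and g: "g \<in> OVI_hom R x y"
    and eq: "\<And>r c. r < rank y \<Longrightarrow> c < rank x \<Longrightarrow> mat R x y f r c = mat R x y g r c"
  shows "f = g"
proof (rule prod_eqI)
  have b: "fst f (bvec x c) = fst g (bvec x c)" if "c < rank x" for c
    using that eq hom_closed f g by (intro Y.coord_eqI) (auto simp: mat_def)
  have fg: "fst f v = fst g v" if v: "v \<in> carrier (underlying x)" for v
    unfolding hom_expand[OF f v] hom_expand[OF g v]
    using b hom_closed[OF g] X.coord_closed[OF v] by (intro Y.M.V.finsum_cong') auto
  show "fst f = fst g"
  proof (rule extensionalityI)
    show "fst f \<in> extensional (carrier (underlying x))" "fst g \<in> extensional (carrier (underlying x))"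
      using f g by (auto simp: OVI_hom_def linear_maps_def PiE_iff)
  qed (rule fg)
  have p: "piv x y f c = piv x y g c" if c: "c < rank x" for c
  proof -
    have "\<not> piv x y f c < piv x y g c" "\<not> piv x y g c < piv x y f c"
      using hom_echelon[OF f] hom_echelon[OF g] c eq one unfolding echelon_def by metis+
    then show ?thesis by simp
  qed
  show "snd f = snd g"
  proof (rule extensionalityI[of _ "index_set x"])
    fix i assume i: "i \<in> index_set x"
    have f0: "snd f i \<in> index_set y" "snd g i \<in> index_set y"
      using f g i by (auto simp: OVI_hom_def)
    have "pos y (snd f i) = pos y (snd g i)"
      using p[OF X.pos(1)[OF i]] by (simp add: piv_def X.pos(2)[OF i])
    then show "snd f i = snd g i"
      by (metis Y.pos(2) f0)
  qed (use f g in \<open>auto simp: OVI_hom_def PiE_iff\<close>)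
qed

text \<open>The columns prescribe the images of the basis vectors. Zeros above a leading 1 express
  the triangularity of a morphism, and increasing pivots express monotonicity of the index
  map.\<close>

lemma hom_exists:
  assumes G: "echelon R (rank y) (rank x) G \<rho>"
  obtains g where "g \<in> OVI_hom R x y"
    "\<And>r c. r < rank y \<Longrightarrow> c < rank x \<Longrightarrow> mat R x y g r c = G r c"
proof -
  let ?X = "underlying x" and ?Y = "underlying y"
  have GR: "G r c \<in> carrier R" if "r < rank y" "c < rank x" for r c
    using G that by (simp add: echelon_def)
  define col where "col c = (\<Oplus>\<^bsub>?Y\<^esub>r\<in>{..<rank y}. G r c \<odot>\<^bsub>?Y\<^esub> bvec y r)" for c
  have col: "col c \<in> carrier ?Y" if "c < rank x" for c
    unfolding col_def using GR that by (intro Y.M.V.finsum_closed) auto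
  have coord_col: "coord R y (col c) r = G r c" if "r < rank y" "c < rank x" for r c
    unfolding col_def using GR that by (intro Y.coord_finsum_bvec) auto
  define g1 where "g1 = (\<lambda>v\<in>carrier ?X. \<Oplus>\<^bsub>?Y\<^esub>c\<in>{..<rank x}. coord R x v c \<odot>\<^bsub>?Y\<^esub> col c)"
  define g0 where "g0 = (\<lambda>i\<in>index_set x. index_at y (\<rho> (pos x i)))"
  have g1: "g1 (bvec x c) = col c" if c: "c < rank x" for c
  proof -
    have "g1 (bvec x c) = (\<Oplus>\<^bsub>?Y\<^esub>c'\<in>{..<rank x}. coord R x (bvec x c) c' \<odot>\<^bsub>?Y\<^esub> col c')"
      using c by (simp add: g1_def)
    also have "\<dots> = (\<Oplus>\<^bsub>?Y\<^esub>c'\<in>{..<rank x}. if c = c' then col c' else \<zero>\<^bsub>?Y\<^esub>)"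
      using c col by (intro Y.M.V.finsum_cong') (auto simp: X.coord_bvec)
    also have "\<dots> = col c"
      using c col by (intro Y.M.V.finsum_singleton) auto
    finally show ?thesis .
  qed
  have lin: "g1 \<in> linear_maps R ?X ?Y"
    unfolding linear_maps_def
  proof (intro CollectI conjI ballI)
    show "g1 \<in> carrier ?X \<rightarrow>\<^sub>E carrier ?Y"
      using X.coord_closed col by (auto simp: g1_def intro!: Y.M.V.finsum_closed)
    fix v w assume v: "v \<in> carrier ?X" and w: "w \<in> carrier ?X"
    have "g1 (v \<oplus>\<^bsub>?X\<^esub> w) = (\<Oplus>\<^bsub>?Y\<^esub>c\<in>{..<rank x}. coord R x (v \<oplus>\<^bsub>?X\<^esub> w) c \<odot>\<^bsub>?Y\<^esub> col c)"
      using v w by (simp add: g1_def)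
    also have "\<dots> = (\<Oplus>\<^bsub>?Y\<^esub>c\<in>{..<rank x}. coord R x v c \<odot>\<^bsub>?Y\<^esub> col c \<oplus>\<^bsub>?Y\<^esub> coord R x w c \<odot>\<^bsub>?Y\<^esub> col c)"
      using v w X.coord_closed col
      by (intro Y.M.V.finsum_cong') (auto simp: X.coord_add Y.M.smult_l_distr)
    also have "\<dots> = g1 v \<oplus>\<^bsub>?Y\<^esub> g1 w"
      using v w X.coord_closed col
      by (simp add: g1_def)
    finally show "g1 (v \<oplus>\<^bsub>?X\<^esub> w) = g1 v \<oplus>\<^bsub>?Y\<^esub> g1 w" .
  next
    fix a v assume a: "a \<in> carrier R" and v: "v \<in> carrier ?X"
    have "g1 (a \<odot>\<^bsub>?X\<^esub> v) = (\<Oplus>\<^bsub>?Y\<^esub>c\<in>{..<rank x}. coord R x (a \<odot>\<^bsub>?X\<^esub> v) c \<odot>\<^bsub>?Y\<^esub> col c)"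
      using v a by (simp add: g1_def)
    also have "\<dots> = (\<Oplus>\<^bsub>?Y\<^esub>c\<in>{..<rank x}. a \<odot>\<^bsub>?Y\<^esub> (coord R x v c \<odot>\<^bsub>?Y\<^esub> col c))"
      using v a X.coord_closed col
      by (intro Y.M.V.finsum_cong') (auto simp: X.coord_smult Y.M.smult_assoc1)
    also have "\<dots> = a \<odot>\<^bsub>?Y\<^esub> (\<Oplus>\<^bsub>?Y\<^esub>c\<in>{..<rank x}. coord R x v c \<odot>\<^bsub>?Y\<^esub> col c)"
      using v a X.coord_closed col by (intro Y.M.smult_finsum[symmetric]) auto
    also have "\<dots> = a \<odot>\<^bsub>?Y\<^esub> g1 v"
      using v by (simp add: g1_def)
    finally show "g1 (a \<odot>\<^bsub>?X\<^esub> v) = a \<odot>\<^bsub>?Y\<^esub> g1 v" .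
  qed
  have \<rho>: "\<rho> (pos x i) < rank y" if "i \<in> index_set x" for i
    using G X.pos(1)[OF that] by (simp add: echelon_def)
  have g0: "g0 i = index_at y (\<rho> (pos x i))" "g0 i \<in> index_set y" "pos y (g0 i) = \<rho> (pos x i)"
    if "i \<in> index_set x" for i
    using that \<rho>[OF that] by (simp_all add: g0_def Y.index_at)
  have pos_g0: "pos y (g0 i) < pos y (g0 j)" if "i \<in> index_set x" "j \<in> index_set x" "pos x i < pos x j" for i j
    using that G X.pos(1) by (simp add: g0(3) echelon_def)
  have "(g1, g0) \<in> OVI_hom R x y"
    unfolding OVI_hom_iff[OF Y.y]
  proof (intro conjI ballI impI lin)
    show "g0 \<in> index_set x \<rightarrow>\<^sub>E index_set y"
      using g0(2) by (auto simp: g0_def)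
    show "inj_on g0 (index_set x)"
    proof (rule inj_onI)
      fix i j assume ij: "i \<in> index_set x" "j \<in> index_set x" "g0 i = g0 j"
      then have "pos x i = pos x j"
        using pos_g0[of i j] pos_g0[of j i] by (metis less_irrefl linorder_neqE_nat)
      then show "i = j" using X.pos(2) ij by metis
    qed
    fix i assume i: "i \<in> index_set x"
    {
      fix j assume j: "j \<in> index_set x" and ij: "(i, j) \<in> index_order x"
      show "(g0 i, g0 j) \<in> index_order y"
      proof (cases "i = j")
        case True
        have "linear_order_on (index_set y) (index_order y)"
          using Y.y by (simp add: OVI_objects_def)
        with True g0(2)[OF i] show ?thesis
          by (auto simp: linear_order_on_def partial_order_on_def preorder_on_def refl_on_def)
      next
        case False
        then have "pos x j < pos x i" using X.pos_less_iff[OF j i] ij by simp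
        from pos_g0[OF j i this] show ?thesis
          using Y.pos_less_iff[OF g0(2)[OF j] g0(2)[OF i]] by simp
      qed
    }
    let ?c = "pos x i"
    have c: "?c < rank x" by (rule X.pos[OF i])
    \<comment> \<open>The column without its pivot vector has no coordinates up to the pivot row, so
      it is a combination of the basis vectors below.\<close>
    let ?w = "col ?c \<ominus>\<^bsub>?Y\<^esub> bvec y (\<rho> ?c)"
    have b: "bvec y (\<rho> ?c) \<in> carrier ?Y" using \<rho>[OF i] by simp
    have w: "?w \<in> carrier ?Y" using col[OF c] b by simp
    have split: "col ?c = bvec y (\<rho> ?c) \<oplus>\<^bsub>?Y\<^esub> ?w"
      using col[OF c] b by (simp add: Y.M.V.minus_eq Y.M.V.a_ac Y.M.V.r_neg Y.M.V.r_neg2)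
    have "coord R y ?w s = \<zero>" if s: "s \<le> \<rho> ?c" for s
    proof -
      have sy: "s < rank y" using s \<rho>[OF i] by simp
      have "G s ?c = (if s = \<rho> ?c then \<one> else \<zero>) \<oplus> coord R y ?w s"
        using arg_cong[OF split, of "\<lambda>v. coord R y v s"] sy c b w \<rho>[OF i]
        by (simp add: coord_col Y.coord_add Y.coord_bvec)
      moreover have "G s ?c = (if s = \<rho> ?c then \<one> else \<zero>)"
        using G c s by (simp add: echelon_def)
      ultimately show ?thesis
        using Y.coord_closed[OF w sy] by (auto split: if_splits)
    qed
    then have "?w \<in> Y.M.combinations (below y (g0 i)) (basis_vector y)"
      unfolding g0(1)[OF i] using Y.combinations_below_iff[OF \<rho>[OF i]] w by blast
    moreover have "g1 (basis_vector x i) = basis_vector y (g0 i) \<oplus>\<^bsub>?Y\<^esub> ?w"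
      using g1[OF c] split X.basis_vector_eq[OF i] by (simp add: g0(1)[OF i] bvec_def)
    ultimately show "\<exists>w\<in>Y.M.combinations (below y (g0 i)) (basis_vector y).
        g1 (basis_vector x i) = basis_vector y (g0 i) \<oplus>\<^bsub>?Y\<^esub> w" by blast
  qed
  then show ?thesis
    by (rule that) (simp add: mat_def g1 coord_col)
qed

end

text \<open>Coefficients in left modules come out on the left, so the entries of f precede those of
  g. Thus the rows of the composite are right linear combinations of the rows of f, which is how
  morphisms act on words of rows.\<close>

lemma mat_composite:
  assumes R: "ring R" and x: "x \<in> OVI_objects R" and y: "y \<in> OVI_objects R" and z: "z \<in> OVI_objects R"
    and f: "f \<in> OVI_hom R x y" and g: "g \<in> OVI_hom R y z" and r: "r < rank z" and c: "c < rank x"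
  shows "mat R x z (composite (OVI R) x y z g f) r c
    = (\<Oplus>\<^bsub>R\<^esub>l\<in>{..<rank y}. mat R x y f l c \<otimes>\<^bsub>R\<^esub> mat R y z g r l)"
proof -
  interpret R: ring R by (rule R)
  interpret XY: OVI_pair R x y by unfold_locales (use x y in auto)
  interpret YZ: OVI_pair R y z by unfold_locales (use z in auto)
  have v: "fst f (bvec x c) \<in> carrier (underlying y)"
    by (intro XY.hom_closed[OF f] XY.X.bvec_closed c)
  have "mat R x z (composite (OVI R) x y z g f) r c = coord R z (fst g (fst f (bvec x c))) r"
    using XY.X.bvec_closed[OF c]
    by (cases f; cases g) (simp add: mat_def OVI_def compose_eq)
  also have "\<dots> = coord R z (\<Oplus>\<^bsub>underlying z\<^esub>l\<in>{..<rank y}. coord R y (fst f (bvec x c)) l \<odot>\<^bsub>underlying z\<^esub> fst g (bvec y l)) r"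
    by (simp only: YZ.hom_expand[OF g v])
  also have "\<dots> = (\<Oplus>\<^bsub>R\<^esub>l\<in>{..<rank y}. coord R z (coord R y (fst f (bvec x c)) l \<odot>\<^bsub>underlying z\<^esub> fst g (bvec y l)) r)"
    using XY.Y.coord_closed[OF v] YZ.hom_closed[OF g] r by (intro YZ.Y.coord_finsum) auto
  also have "\<dots> = (\<Oplus>\<^bsub>R\<^esub>l\<in>{..<rank y}. mat R x y f l c \<otimes>\<^bsub>R\<^esub> mat R y z g r l)"
    using XY.Y.coord_closed[OF v] YZ.hom_closed[OF g] YZ.Y.coord_closed r
    by (intro R.finsum_cong') (auto simp: mat_def YZ.Y.coord_smult)
  finally show ?thesis .
qed

section \<open>Translation-invariant orders on rows\<close>

lemma map2_add_less_map2_add: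
  fixes xs ys zs :: "int list"
  assumes "length xs = length ys" "length ys = length zs" "xs < ys"
  shows "map2 (+) xs zs < map2 (+) ys zs"
  using assms by (induction xs ys zs rule: list_induct3) auto

lemma map2_concat_map:
  assumes "\<And>c. c \<in> set cs \<Longrightarrow> length (f c) = length (g c)"
  shows "map2 h (concat (map f cs)) (concat (map g cs)) = concat (map (\<lambda>c. map2 h (f c) (g c)) cs)"
  using assms by (induction cs) auto

lemma concat_map_eqD:
  assumes "concat (map f cs) = concat (map g cs)" "\<And>c. c \<in> set cs \<Longrightarrow> length (f c) = length (g c)"
    and "c \<in> set cs"
  shows "f c = g c"
  using assms by (induction cs) auto

lemma list_all2_concat_mapD:
  assumes "list_all2 Q (concat (map f cs)) (concat (map g cs))"
    and "\<And>c. c \<in> set cs \<Longrightarrow> length (f c) = length (g c)" and "c \<in> set cs"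
  shows "list_all2 Q (f c) (g c)"
  using assms by (induction cs) (auto simp: list_all2_append)

lemma (in abelian_group) add_minus_cancel:
  assumes "a \<in> carrier G" "b \<in> carrier G"
  shows "a \<oplus> (b \<ominus> a) = b" "(a \<oplus> b) \<ominus> a = b"
proof -
  show "a \<oplus> (b \<ominus> a) = b"
    using assms by (simp add: minus_eq a_lcomm[of a b] r_neg)
  then show "(a \<oplus> b) \<ominus> a = b"
    using assms by (simp add: minus_eq a_assoc)
qed

section \<open>Keys of ring elements and of rows\<close>

context ring_coordinates
begin

interpretation J: ideal J R by (rule J)

lemma J_carrier: "a \<in> J \<Longrightarrow> a \<in> carrier R"
  by (rule J.a_Hcarr)

lemma \<phi>_zero: "k < rk \<Longrightarrow> \<phi> k \<zero> = 0"
  using \<phi>_add[of k \<zero> \<zero>] by simp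

lemma \<phi>_diff:
  assumes "k < rk" "a \<in> carrier R" "b \<in> carrier R"
  shows "\<phi> k (a \<ominus> b) = \<phi> k a - \<phi> k b"
proof -
  have "\<phi> k (b \<oplus> (a \<ominus> b)) = \<phi> k b + \<phi> k (a \<ominus> b)"
    using assms by (intro \<phi>_add) auto
  with assms show ?thesis by (simp add: add_minus_cancel)
qed

lemma idx_add_J:
  assumes "a \<in> carrier R" "t \<in> J"
  shows "idx (a \<oplus> t) = idx a"
proof -
  have t: "t \<in> carrier R" by (rule J_carrier[OF assms(2)])
  show ?thesis
    using assms t by (simp add: idx_eq add_minus_cancel)
qed

lemma large_in_J: "\<exists>a\<in>J. \<forall>k<rk. int n \<le> \<phi> k a"
proof (induction n)
  case 0
  show ?case using \<phi>_zero by (intro bexI[of _ \<zero>]) auto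
next
  case (Suc n)
  then obtain a where a: "a \<in> J" "\<And>k. k < rk \<Longrightarrow> int n \<le> \<phi> k a" by blast
  have "int (Suc n) \<le> \<phi> k (a \<oplus> z)" if "k < rk" for k
    using a(2)[OF that] \<phi>_z[OF that] \<phi>_add[OF that J_carrier[OF a(1)] J_carrier[OF z]] by simp
  then show ?case
    using J.a_closed[OF a(1) z] by blast
qed

text \<open>The coordinates determine an element only within its coset of J; the coset number
  decides among cosets.\<close>

definition entry :: "'a \<Rightarrow> int list" where
  "entry a = map (\<lambda>k. \<phi> k a) [0..<rk] @ [int (idx a)]"

lemma length_entry [simp]: "length (entry a) = Suc rk"
  by (simp add: entry_def)

lemma entry_inj:
  assumes a: "a \<in> carrier R" and b: "b \<in> carrier R" and eq: "entry a = entry b"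
  shows "a = b"
proof -
  have "\<phi> k a = \<phi> k b" if "k < rk" for k
    using eq that by (auto simp: entry_def)
  then have "\<phi> k (a \<ominus> b) = 0" if "k < rk" for k
    using that a b by (simp add: \<phi>_diff)
  moreover have "a \<ominus> b \<in> J"
    using eq a b by (simp add: entry_def flip: idx_eq)
  ultimately have "a \<ominus> b = \<zero>" by (intro \<phi>_inj)
  then show ?thesis using a b by simp
qed

definition row_key :: "nat \<Rightarrow> nat \<Rightarrow> (nat \<Rightarrow> 'a) \<Rightarrow> int list" where
  "row_key m i w = int i # concat (map (\<lambda>c. entry (w c)) [0..<m])"

lemma length_row_key: "length (row_key m i w) = Suc (m * Suc rk)"
  by (simp add: row_key_def length_concat o_def sum_list_triv)

lemma row_key_inj:
  assumes "row_key m i w = row_key m i' w'"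
  shows "i = i'"
    and "\<lbrakk>\<And>c. c < m \<Longrightarrow> w c \<in> carrier R; \<And>c. c < m \<Longrightarrow> w' c \<in> carrier R; c < m\<rbrakk> \<Longrightarrow> w c = w' c"
proof -
  show "i = i'" using assms by (simp add: row_key_def)
  show "w c = w' c" if "\<And>c. c < m \<Longrightarrow> w c \<in> carrier R" "\<And>c. c < m \<Longrightarrow> w' c \<in> carrier R" "c < m"
    using assms that concat_map_eqD[of "\<lambda>c. entry (w c)" "[0..<m]" "\<lambda>c. entry (w' c)" c]
    by (intro entry_inj) (auto simp: row_key_def)
qed

text \<open>Translation by J adds coordinates and keeps coset numbers, so it adds one and the same
  integer vector to both keys. Lexicographic order is invariant under this.\<close>

lemma row_key_translate_less:
  assumes w: "\<And>c. c < m \<Longrightarrow> w c \<in> carrier R" "\<And>c. c < m \<Longrightarrow> w' c \<in> carrier R"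
    and t: "\<And>c. c < m \<Longrightarrow> t c \<in> J" and less: "row_key m i w < row_key m i w'"
  shows "row_key m i (\<lambda>c. w c \<oplus> t c) < row_key m i (\<lambda>c. w' c \<oplus> t c)"
proof -
  \<comment> \<open>The zero at the end of each block stands for the coset number; the one at the
    head of \<open>ts\<close> stands for the summand number.\<close>
  define \<tau> where "\<tau> a = map (\<lambda>k. \<phi> k a) [0..<rk] @ [0]" for a
  define ts where "ts = 0 # concat (map (\<lambda>c. \<tau> (t c)) [0..<m])"
  have "entry (a \<oplus> u) = map2 (+) (entry a) (\<tau> u)" if a: "a \<in> carrier R" and u: "u \<in> J" for a u
    using that J_carrier[OF u]
    by (intro nth_equalityI) (auto simp: entry_def \<tau>_def \<phi>_add idx_add_J nth_append)
  then have *: "row_key m i (\<lambda>c. v c \<oplus> t c) = map2 (+) (row_key m i v) ts"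
    if v: "\<And>c. c < m \<Longrightarrow> v c \<in> carrier R" for v
    using v t by (auto simp: row_key_def ts_def map2_concat_map \<tau>_def intro!: arg_cong[of _ _ concat])
  have "length ts = Suc (m * Suc rk)"
    by (simp add: ts_def \<tau>_def length_concat o_def sum_list_triv)
  then show ?thesis
    using map2_add_less_map2_add[of "row_key m i w" "row_key m i w'" ts] less
    by (simp add: *[OF w(1)] *[OF w(2)] length_row_key)
qed

definition nonneg_keys :: "nat \<Rightarrow> int list set" where
  "nonneg_keys m = {ks \<in> lists {0..}. length ks = Suc (m * Suc rk)}"

text \<open>Summand and coset numbers are natural numbers, so only the coordinates matter.\<close>

lemma row_key_nonneg_iff:
  "row_key m i w \<in> nonneg_keys m \<longleftrightarrow> (\<forall>c<m. \<forall>k<rk. 0 \<le> \<phi> k (w c))"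
  by (auto simp: nonneg_keys_def length_row_key) (auto simp: row_key_def entry_def)

lemma wf_nonneg_keys: "wf {(a, b). a \<in> nonneg_keys m \<and> b \<in> nonneg_keys m \<and> a < b}"
proof (rule wf_subset)
  have "wf {(a, b). a \<in> {0 :: int..} \<and> b \<in> {0..} \<and> a < b}"
    by (rule wf_subset[OF wf_measure[of nat]]) auto
  then show "wf {(xs, ys). xs \<in> lists {0 :: int..} \<and> ys \<in> lists {0..} \<and> length xs = Suc (m * Suc rk) \<and>
      length ys = Suc (m * Suc rk) \<and> xs < ys}"
    by (rule wf_list_less_fixed_length)
qed (auto simp: nonneg_keys_def)

text \<open>
  By triangularity the pivot rows suffice, and the coefficients stay in every ideal that contains the
  entries of \<open>v\<close>.
\<close>

lemma echelon_solve:
  assumes A: "echelon R n d A \<rho>" and I: "ideal I R" and q: "q \<le> n"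
    and v: "\<And>c. c < d \<Longrightarrow> v c \<in> I" "\<And>c. c < d \<Longrightarrow> q \<le> \<rho> c \<Longrightarrow> v c = \<zero>"
  shows "\<exists>\<gamma>. (\<forall>l<q. \<gamma> l \<in> I) \<and> (\<forall>c<d. (\<Oplus>l\<in>{..<q}. A l c \<otimes> \<gamma> l) = v c)"
  using q v
proof (induction q arbitrary: v)
  case 0
  then show ?case by auto
next
  case (Suc q)
  interpret I: ideal I R by (rule I)
  have Ic: "a \<in> carrier R" if "a \<in> I" for a using that by (rule I.a_Hcarr)
  have AR: "A l c \<in> carrier R" if "l < n" "c < d" for l c
    using A that by (simp add: echelon_def)
  have q: "q < n" using Suc.prems(1) by simp
  \<comment> \<open>Eliminate row q. If it is the pivot row of column c0, then \<open>v c0\<close>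
    is the only possible coefficient, as the earlier rows vanish in that column; otherwise 0 works.
    Columns with later pivots vanish in row q and are not disturbed.\<close>
  obtain s where s: "s \<in> I" "\<And>c. c < d \<Longrightarrow> q \<le> \<rho> c \<Longrightarrow> v c \<ominus> A q c \<otimes> s = \<zero>"
  proof (cases "\<exists>c<d. \<rho> c = q")
    case True
    then obtain c0 where c0: "c0 < d" "\<rho> c0 = q" by blast
    show ?thesis
    proof (rule that[of "v c0"])
      show "v c0 \<in> I" by (rule Suc.prems(2)[OF c0(1)])
      fix c assume c: "c < d" "q \<le> \<rho> c"
      show "v c \<ominus> A q c \<otimes> v c0 = \<zero>"
      proof (cases "c = c0")
        case True
        then show ?thesis using A c0 Ic[OF Suc.prems(2)[OF c0(1)]] by (auto simp: echelon_def r_neg minus_eq)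
      next
        case False
        then have "\<rho> c \<noteq> q"
          using A c0 c(1) unfolding echelon_def by (metis less_irrefl linorder_neqE_nat)
        with c have "q < \<rho> c" by simp
        then show ?thesis
          using A c Suc.prems(3)[OF c(1)] Ic[OF Suc.prems(2)[OF c0(1)]] by (auto simp: echelon_def minus_eq)
      qed
    qed
  next
    case False
    have "v c \<ominus> A q c \<otimes> \<zero> = \<zero>" if "c < d" "q \<le> \<rho> c" for c
      using False Suc.prems(3)[of c] that AR[OF q] by (auto simp: minus_eq Suc_le_eq order.strict_iff_order)
    then show ?thesis using that[of \<zero>] by auto
  qed
  have "v c \<ominus> A q c \<otimes> s \<in> I" if "c < d" for c
    using I.I_l_closed[OF s(1) AR[OF q that]] Suc.prems(2)[OF that]
    by (simp add: minus_eq I.a_closed)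
  then have "\<exists>\<gamma>. (\<forall>l<q. \<gamma> l \<in> I) \<and> (\<forall>c<d. (\<Oplus>l\<in>{..<q}. A l c \<otimes> \<gamma> l) = v c \<ominus> A q c \<otimes> s)"
    by (intro Suc.IH less_imp_le[OF q] s(2))
  then obtain \<gamma> where
    *: "\<forall>l<q. \<gamma> l \<in> I" and **: "\<forall>c<d. (\<Oplus>l\<in>{..<q}. A l c \<otimes> \<gamma> l) = v c \<ominus> A q c \<otimes> s"
    by (elim exE conjE) (rule that)
  note \<gamma> = *[rule_format] **[rule_format]
  have "(\<Oplus>l\<in>{..<Suc q}. A l c \<otimes> (\<gamma>(q := s)) l) = v c" if c: "c < d" for c
  proof -
    have A\<gamma>: "A l c \<otimes> \<gamma> l \<in> carrier R" if "l < q" for l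
      using AR[of l c] Ic[OF \<gamma>(1)[OF that]] c q that by simp
    have "(\<Oplus>l\<in>{..<Suc q}. A l c \<otimes> (\<gamma>(q := s)) l)
        = A q c \<otimes> s \<oplus> (\<Oplus>l\<in>{..<q}. A l c \<otimes> (\<gamma>(q := s)) l)"
      unfolding lessThan_Suc using A\<gamma> AR[OF q c] Ic[OF s(1)] by (subst finsum_insert) auto
    also have "(\<Oplus>l\<in>{..<q}. A l c \<otimes> (\<gamma>(q := s)) l) = (\<Oplus>l\<in>{..<q}. A l c \<otimes> \<gamma> l)"
      using A\<gamma> by (intro finsum_cong') auto
    also have "A q c \<otimes> s \<oplus> \<dots> = v c"
      using \<gamma>(2)[OF c] AR[OF q c] Ic[OF s(1)] Ic[OF Suc.prems(2)[OF c]]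
      by (simp add: add_minus_cancel)
    finally show ?thesis .
  qed
  then show ?case
    using \<gamma>(1) s(1) by (intro exI[of _ "\<gamma>(q := s)"]) (auto simp: less_Suc_eq)
qed

end

section \<open>Words of rows\<close>

locale OVI_projective_sum = ring_coordinates R rk \<phi> J z idx bound + projective_sum "OVI R" K q x
  for R :: "('r, 'p) ring_scheme" (structure) and rk and \<phi> and J and z and idx and bound
    and K :: "('k, 'c) ring_scheme" and q and x :: "nat \<Rightarrow> ('r, 'v, 'i) based_module"
begin

text \<open>A convenient common bound for the ranks: rows from all summands are padded to this
  length and share one alphabet.\<close>

definition width :: nat where
  "width = (\<Sum>i<q. rank (x i))"

definition row :: "('r, 'v, 'i) based_module \<Rightarrow> nat \<times> ('v \<Rightarrow> 'v) \<times> ('i \<Rightarrow> 'i) \<Rightarrow> nat \<Rightarrow> nat \<Rightarrow> 'r" where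
  "row y b l c = (if c < rank (x (fst b)) then mat R (x (fst b)) y (snd b) l c else \<zero>)"

text \<open>The additional first letter carries only the summand. It separates the summands even
  over an object of rank 0, which has no rows, and it moves row l to position
  \<open>Suc l\<close>.\<close>

definition code :: "('r, 'v, 'i) based_module \<Rightarrow> nat \<times> ('v \<Rightarrow> 'v) \<times> ('i \<Rightarrow> 'i) \<Rightarrow> int list list" where
  "code y b = row_key width (fst b) (\<lambda>_. \<zero>) # map (\<lambda>l. row_key width (fst b) (row y b l)) [0..<rank y]"

lemma obj_OVI: "y \<in> obj (OVI R) \<longleftrightarrow> y \<in> OVI_objects R"
  by (simp add: OVI_def)

lemma homset_OVI: "homset (OVI R) = OVI_hom R"
  by (simp add: OVI_def)

lemma OVI_pair: "\<lbrakk>y \<in> obj (OVI R); y' \<in> obj (OVI R)\<rbrakk> \<Longrightarrow> OVI_pair R y y'"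
  by unfold_locales (auto simp: obj_OVI)

lemma basisD:
  assumes "y \<in> obj (OVI R)" "b \<in> basis y"
  shows "fst b < q" "x (fst b) \<in> obj (OVI R)" "snd b \<in> OVI_hom R (x (fst b)) y"
  using assms x by (auto simp: basis_def homset_OVI)

lemma rank_le_width: "i < q \<Longrightarrow> rank (x i) \<le> width"
  unfolding width_def by (rule member_le_sum) auto

lemma row_closed:
  assumes "y \<in> obj (OVI R)" "b \<in> basis y" "l < rank y"
  shows "row y b l c \<in> carrier R"
  using OVI_pair.mat_closed[OF OVI_pair[OF basisD(2)[OF assms(1,2)] assms(1)] basisD(3)[OF assms(1,2)] assms(3)]
  by (simp add: row_def)

lemma row_outside:
  assumes "y \<in> obj (OVI R)" "b \<in> basis y" "\<not> c < width"
  shows "row y b l c = \<zero>"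
  using rank_le_width[OF basisD(1)[OF assms(1,2)]] assms(3) by (simp add: row_def)

lemma length_code: "length (code y b) = Suc (rank y)"
  by (simp add: code_def)

lemma code_0: "code y b ! 0 = row_key width (fst b) (\<lambda>_. \<zero>)"
  by (simp add: code_def)

lemma code_Suc: "l < rank y \<Longrightarrow> code y b ! Suc l = row_key width (fst b) (row y b l)"
  by (simp add: code_def)

lemma take_code_eq_iff:
  assumes y: "y \<in> obj (OVI R)" and b: "b \<in> basis y" "b' \<in> basis y" and l: "l \<le> rank y"
  shows "take (Suc l) (code y b) = take (Suc l) (code y b') \<longleftrightarrow>
    fst b = fst b' \<and> (\<forall>l'<l. row y b l' = row y b' l')"
proof
  assume *: "take (Suc l) (code y b) = take (Suc l) (code y b')"
  have nth: "code y b ! j = code y b' ! j" if "j < Suc l" for j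
    using * that by (metis nth_take)
  have fst: "fst b = fst b'"
    using nth[of 0] row_key_inj(1) by (simp add: code_0)
  have "row y b l' c = row y b' l' c" if l': "l' < l" for l' c
  proof (cases "c < width")
    case True
    have "row_key width (fst b) (row y b l') = row_key width (fst b') (row y b' l')"
      using nth[of "Suc l'"] l l' by (simp add: code_Suc)
    from row_key_inj(2)[OF this _ _ True] show ?thesis
      using row_closed[OF y] b l l' by simp
  qed (use row_outside[OF y] b in simp)
  with fst show "fst b = fst b' \<and> (\<forall>l'<l. row y b l' = row y b' l')" by auto
next
  assume "fst b = fst b' \<and> (\<forall>l'<l. row y b l' = row y b' l')"
  then show "take (Suc l) (code y b) = take (Suc l) (code y b')"
    using l by (auto simp: code_def take_map)
qed

lemma basis_eqI:
  assumes y: "y \<in> obj (OVI R)" and b: "b \<in> basis y" "b' \<in> basis y"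
    and "fst b = fst b'" and rows: "\<And>l. l < rank y \<Longrightarrow> row y b l = row y b' l"
  shows "b = b'"
proof (rule prod_eqI)
  show "fst b = fst b'" by fact
  have b': "snd b' \<in> OVI_hom R (x (fst b)) y"
    using basisD(3)[OF y b(2)] assms(4) by simp
  show "snd b = snd b'"
  proof (rule OVI_pair.hom_eqI[OF OVI_pair[OF basisD(2)[OF y b(1)] y] one_neq_zero basisD(3)[OF y b(1)] b'])
    fix r c assume "r < rank y" "c < rank (x (fst b))"
    then show "mat R (x (fst b)) y (snd b) r c = mat R (x (fst b)) y (snd b') r c"
      using fun_cong[OF rows[of r], of c] assms(4) by (simp add: row_def)
  qed
qed

lemma inj_code:
  assumes y: "y \<in> obj (OVI R)"
  shows "inj_on (code y) (basis y)"
proof (rule inj_onI)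
  fix b b' assume b: "b \<in> basis y" "b' \<in> basis y" and eq: "code y b = code y b'"
  have "fst b = fst b' \<and> (\<forall>l'<rank y. row y b l' = row y b' l')"
    by (rule iffD1[OF take_code_eq_iff[OF y b order_refl]]) (simp add: eq)
  then show "b = b'" by (intro basis_eqI[OF y b]) auto
qed

lemma row_key_row_nonneg_iff:
  assumes y: "y \<in> obj (OVI R)" "b \<in> basis y"
  shows "row_key width i (row y b l) \<in> nonneg_keys width \<longleftrightarrow> (\<forall>c. \<forall>k<rk. 0 \<le> \<phi> k (row y b l c))"
  using row_outside[OF y] \<phi>_zero by (metis order_refl row_key_nonneg_iff)

lemma code_0_nonneg: "code y b ! 0 \<in> nonneg_keys width"
  by (simp add: code_0 row_key_nonneg_iff \<phi>_zero)

lemma code_nonneg_iff: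
  assumes y: "y \<in> obj (OVI R)" "b \<in> basis y"
  shows "code y b \<in> lists (nonneg_keys width) \<longleftrightarrow> (\<forall>l<rank y. \<forall>c. \<forall>k<rk. 0 \<le> \<phi> k (row y b l c))"
  using row_key_row_nonneg_iff[OF y] code_0_nonneg[of y b] by (auto simp: code_def)

section \<open>The action of morphisms on rows\<close>

lemma fst_act [simp]: "fst (act y y' g b) = fst b"
  by (simp add: act_def)

lemma row_act:
  assumes y: "y \<in> obj (OVI R)" "y' \<in> obj (OVI R)" and g: "g \<in> OVI_hom R y y'"
    and b: "b \<in> basis y" and r: "r < rank y'"
  shows "row y' (act y y' g b) r c = (\<Oplus>l\<in>{..<rank y}. row y b l c \<otimes> mat R y y' g r l)"
proof (cases "c < rank (x (fst b))")
  case True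
  then show ?thesis
    using mat_composite[OF ring_axioms _ _ _ basisD(3)[OF y(1) b] g r True] basisD(2)[OF y(1) b] y
    by (simp add: row_def act_def obj_OVI)
next
  case False
  have "(\<Oplus>l\<in>{..<rank y}. row y b l c \<otimes> mat R y y' g r l) = (\<Oplus>l\<in>{..<rank y}. \<zero>)"
    using False OVI_pair.mat_closed[OF OVI_pair[OF y] g r] by (intro finsum_cong') (auto simp: row_def)
  with False show ?thesis by (simp add: row_def)
qed

text \<open>
  Modulo \<open>J\<close>, the morphisms below only insert rows.  Hence they shift the rows of all matrices that
  agree in the earlier rows by the same element of \<open>J\<close>, which makes them order preserving.
\<close>

definition shifting ::
  "('r, 'v, 'i) based_module \<Rightarrow> ('r, 'v, 'i) based_module \<Rightarrow> ('v \<Rightarrow> 'v) \<times> ('i \<Rightarrow> 'i) \<Rightarrow> (nat \<Rightarrow> nat) \<Rightarrow> bool" where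
  "shifting y y' g p \<longleftrightarrow> g \<in> OVI_hom R y y' \<and> echelon R (rank y') (rank y) (mat R y y' g) p \<and>
     (\<forall>l<rank y. \<forall>l'<l. mat R y y' g (p l) l' \<in> J)"

definition shift where
  "shift y y' g p b l c = (\<Oplus>l'\<in>{..<l}. row y b l' c \<otimes> mat R y y' g (p l) l')"

context
  fixes y y' g p
  assumes y: "y \<in> obj (OVI R)" and y': "y' \<in> obj (OVI R)" and g: "shifting y y' g p"
begin

lemma shifting_hom: "g \<in> OVI_hom R y y'"
  using g by (simp add: shifting_def)

lemma shifting_less: "l < rank y \<Longrightarrow> p l < rank y'" "l < rank y \<Longrightarrow> l' < l \<Longrightarrow> p l' < p l"
  using g by (auto simp: shifting_def echelon_def)

lemma shifting_mat_closed: "\<lbrakk>r < rank y'; l < rank y\<rbrakk> \<Longrightarrow> mat R y y' g r l \<in> carrier R"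
  using g by (auto simp: shifting_def echelon_def)

lemma act_basis: "b \<in> basis y \<Longrightarrow> act y y' g b \<in> basis y'"
  using shifting_hom by (intro act_closed[OF y y']) (auto simp: homset_OVI)

lemma shift_in_J:
  assumes b: "b \<in> basis y" and l: "l < rank y"
  shows "shift y y' g p b l c \<in> J"
proof -
  interpret J: ideal J R by (rule J)
  have t: "row y b l' c \<otimes> mat R y y' g (p l) l' \<in> J" if "l' < l" for l'
    using g l that row_closed[OF y b] by (intro J.I_l_closed) (auto simp: shifting_def)
  have "(\<Oplus>l'\<in>S. row y b l' c \<otimes> mat R y y' g (p l) l') \<in> J" if "finite S" "S \<subseteq> {..<l}" for S
    using that
  proof (induction S rule: finite_induct)
    case (insert l' S)
    then have *: "(\<lambda>l'. row y b l' c \<otimes> mat R y y' g (p l) l') \<in> S \<rightarrow> carrier R"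
      using t J_carrier by blast
    have **: "row y b l' c \<otimes> mat R y y' g (p l) l' \<in> J"
      using insert t by auto
    show ?case
      using insert * ** J_carrier[OF **] by (simp add: finsum_insert J.a_closed)
  qed simp
  then show ?thesis by (simp add: shift_def)
qed

text \<open>Row \<open>p l\<close> of the matrix of g has the entry 1 at l, entries in J before it,
  and zeros after it because later columns have later pivots.\<close>

lemma row_act_shift:
  assumes b: "b \<in> basis y" and l: "l < rank y"
  shows "row y' (act y y' g b) (p l) c = row y b l c \<oplus> shift y y' g p b l c"
proof -
  let ?t = "\<lambda>l'. row y b l' c \<otimes> mat R y y' g (p l) l'"
  have t: "?t l' \<in> carrier R" if "l' < rank y" for l'
    using row_closed[OF y b that] shifting_mat_closed[OF shifting_less(1)[OF l] that] by simp
  have "row y' (act y y' g b) (p l) c = (\<Oplus>l'\<in>{..<rank y}. ?t l')"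
    by (rule row_act[OF y y' shifting_hom b shifting_less(1)[OF l]])
  also have "\<dots> = (\<Oplus>l'\<in>{..<Suc l}. ?t l')"
  proof (rule add.finprod_mono_neutral_cong_right)
    show "?t l' = \<zero>" if "l' \<in> {..<rank y} - {..<Suc l}" for l'
    proof -
      have l': "l' < rank y" "l < l'" using that by auto
      then have "mat R y y' g (p l) l' = \<zero>"
        using g shifting_less(2)[OF l'] by (auto simp: shifting_def echelon_def)
      then show ?thesis using row_closed[OF y b l'(1)] by simp
    qed
  qed (use l t in auto)
  also have "\<dots> = ?t l \<oplus> (\<Oplus>l'\<in>{..<l}. ?t l')"
    unfolding lessThan_Suc using t l by (subst finsum_insert) auto
  also have "?t l = row y b l c"
    using g l row_closed[OF y b l] by (auto simp: shifting_def echelon_def)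
  finally show ?thesis by (simp add: shift_def)
qed

lemma shift_cong:
  assumes "b \<in> basis y" "l < rank y" "\<And>l'. l' < l \<Longrightarrow> row y b l' = row y b' l'"
  shows "shift y y' g p b l = shift y y' g p b' l"
proof
  fix c
  show "shift y y' g p b l c = shift y y' g p b' l c"
    unfolding shift_def using assms(2) row_closed[OF y assms(1)] shifting_mat_closed[OF shifting_less(1)[OF assms(2)]]
    by (intro finsum_cong') (auto simp: assms(3)[symmetric])
qed

text \<open>Column l vanishes above its pivot \<open>p l\<close>, so row r of the image involves
  only rows l with \<open>p l \<le> r\<close>.\<close>

lemma row_act_cong:
  assumes b: "b \<in> basis y" "b' \<in> basis y" and r: "r < rank y'"
    and eq: "\<And>l. l < rank y \<Longrightarrow> p l \<le> r \<Longrightarrow> row y b l = row y b' l"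
  shows "row y' (act y y' g b) r = row y' (act y y' g b') r"
proof
  fix c
  have "(\<Oplus>l\<in>{..<rank y}. row y b l c \<otimes> mat R y y' g r l) = (\<Oplus>l\<in>{..<rank y}. row y b' l c \<otimes> mat R y y' g r l)"
  proof (rule finsum_cong')
    show "(\<lambda>l. row y b' l c \<otimes> mat R y y' g r l) \<in> {..<rank y} \<rightarrow> carrier R"
      using row_closed[OF y b(2)] shifting_mat_closed[OF r] by auto
    fix l assume "l \<in> {..<rank y}"
    then have l: "l < rank y" by simp
    show "row y b l c \<otimes> mat R y y' g r l = row y b' l c \<otimes> mat R y y' g r l"
    proof (cases "p l \<le> r")
      case False
      then have "mat R y y' g r l = \<zero>"
        using g l by (auto simp: shifting_def echelon_def)
      then show ?thesis using row_closed[OF y _ l] b by simp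
    qed (use eq[OF l] in simp)
  qed simp
  then show "row y' (act y y' g b) r c = row y' (act y y' g b') r c"
    using row_act[OF y y' shifting_hom _ r] b by simp
qed

text \<open>The triangular action is undone row by row: once the rows before l agree, so do the
  shifts, and these cancel from row \<open>p l\<close> of the images.\<close>

lemma rows_eq_of_act_rows_eq:
  assumes b: "b \<in> basis y" "b' \<in> basis y"
    and eq: "\<And>r'. r' < r \<Longrightarrow> row y' (act y y' g b) r' = row y' (act y y' g b') r'"
    and l: "l < rank y" "p l < r"
  shows "row y b l = row y b' l"
  using l
proof (induction l rule: less_induct)
  case (less l)
  have "shift y y' g p b l = shift y y' g p b' l"
  proof (rule shift_cong[OF b(1) less.prems(1)])
    fix l' assume "l' < l"
    then show "row y b l' = row y b' l'"
      using less shifting_less(2)[OF less.prems(1), of l'] by (intro less.IH) auto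
  qed
  then have "row y b l c \<oplus> shift y y' g p b l c = row y b' l c \<oplus> shift y y' g p b l c" for c
    using row_act_shift[OF b(1) less.prems(1), of c] row_act_shift[OF b(2) less.prems(1), of c]
      eq[OF less.prems(2)] by simp
  then show ?case
    using row_closed[OF y _ less.prems(1)] b J_carrier[OF shift_in_J[OF b(1) less.prems(1)]]
    by (auto simp: add.r_cancel)
qed

text \<open>If the words first differ in row l, the images agree before row \<open>p l\<close>, and
  there both rows have received the same translation by J. The first difference thus moves to
  \<open>p l\<close> and keeps its direction. A difference of summands stays where it is.\<close>

lemma act_code_less:
  assumes b: "b \<in> basis y" "b' \<in> basis y" and less: "code y b < code y b'"
  shows "code y' (act y y' g b) < code y' (act y y' g b')"
proof -
  have len: "length (code y b) = length (code y b')"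
    "length (code y' (act y y' g b)) = length (code y' (act y y' g b'))"
    by (simp_all add: length_code)
  obtain j where j: "j < Suc (rank y)" "take j (code y b) = take j (code y b')" "code y b ! j < code y b' ! j"
    using less unfolding list_less_iff_first_difference[OF len(1)] by (auto simp: length_code)
  show ?thesis
  proof (cases j)
    case 0
    with j(3) have "code y' (act y y' g b) ! 0 < code y' (act y y' g b') ! 0"
      by (simp add: code_0)
    then show ?thesis
      unfolding list_less_iff_first_difference[OF len(2)] by (auto simp: length_code)
  next
    case (Suc l)
    with j(1) have l: "l < rank y" by simp
    have agree: "fst b = fst b'" "\<And>l'. l' < l \<Longrightarrow> row y b l' = row y b' l'"
      using j(2) l unfolding Suc by (simp_all add: take_code_eq_iff[OF y b])
    have "row_key width (fst b) (row y b l) < row_key width (fst b) (row y b' l)"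
      using j(3) l agree(1) by (simp add: Suc code_Suc)
    then have "row_key width (fst b) (\<lambda>c. row y b l c \<oplus> shift y y' g p b l c)
        < row_key width (fst b) (\<lambda>c. row y b' l c \<oplus> shift y y' g p b l c)"
      using row_closed[OF y _ l] b shift_in_J[OF b(1) l] by (intro row_key_translate_less) auto
    moreover have "row y' (act y y' g b) (p l) = (\<lambda>c. row y b l c \<oplus> shift y y' g p b l c)"
      using row_act_shift[OF b(1) l] by auto
    moreover have "row y' (act y y' g b') (p l) = (\<lambda>c. row y b' l c \<oplus> shift y y' g p b l c)"
      using row_act_shift[OF b(2) l] shift_cong[OF b(1) l agree(2)] by auto
    ultimately have "code y' (act y y' g b) ! Suc (p l) < code y' (act y y' g b') ! Suc (p l)"
      using agree(1) shifting_less(1)[OF l] by (simp add: code_Suc)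
    moreover have "row y' (act y y' g b) r = row y' (act y y' g b') r" if r: "r < p l" for r
    proof (rule row_act_cong[OF b])
      show "r < rank y'" using r shifting_less(1)[OF l] by simp
      fix l' assume l': "l' < rank y" "p l' \<le> r"
      have "l' < l"
        using shifting_less(2)[OF l'(1), of l] l' r by (metis leD less_trans linorder_neqE_nat order.strict_trans1)
      then show "row y b l' = row y b' l'" by (rule agree(2))
    qed
    then have "take (Suc (p l)) (code y' (act y y' g b)) = take (Suc (p l)) (code y' (act y y' g b'))"
      using agree(1) shifting_less(1)[OF l] act_basis b by (subst take_code_eq_iff[OF y']) auto
    ultimately show ?thesis
      unfolding list_less_iff_first_difference[OF len(2)] using shifting_less(1)[OF l] by (auto simp: length_code)
  qed
qed

text \<open>Agreement of the images before row r forces u and v to agree in all rows l with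
  \<open>p l < r\<close>. If \<open>r = p l\<close>, row l of u is nonnegative by hypothesis, and
  the shift, common to u and v, is nonnegative because the row of v has not decreased. If r is not
  of this form, row r of both images comes from rows in which u and v agree, so it is nonnegative as
  for v.\<close>

lemma act_relpos:
  assumes u: "u \<in> basis y" and v: "v \<in> basis y"
    and rel: "relpos (nonneg_keys width) (code y v) (code y u)"
    and nonneg: "code y' (act y y' g v) \<in> lists (nonneg_keys width)"
    and le: "\<And>l c k. l < rank y \<Longrightarrow> k < rk \<Longrightarrow> \<phi> k (row y v l c) \<le> \<phi> k (row y' (act y y' g v) (p l) c)"
  shows "relpos (nonneg_keys width) (code y' (act y y' g v)) (code y' (act y y' g u))"
  unfolding relpos_def
proof (intro allI impI)
  fix j assume j: "j < length (code y' (act y y' g v))"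
    and eq: "take j (code y' (act y y' g u)) = take j (code y' (act y y' g v))"
  show "code y' (act y y' g u) ! j \<in> nonneg_keys width"
  proof (cases j)
    case 0
    then show ?thesis using code_0_nonneg by simp
  next
    case (Suc r)
    with j have r: "r < rank y'" by (simp add: length_code)
    have fst: "fst u = fst v" and rows: "\<And>r'. r' < r \<Longrightarrow> row y' (act y y' g u) r' = row y' (act y y' g v) r'"
      using eq r unfolding Suc by (simp_all add: take_code_eq_iff[OF y' act_basis[OF u] act_basis[OF v]])
    have rows': "row y u l = row y v l" if "l < rank y" "p l < r" for l
      using rows_eq_of_act_rows_eq[OF u v rows that] .
    have "0 \<le> \<phi> k (row y' (act y y' g u) r c)" if k: "k < rk" for k c
    proof (cases "\<exists>l<rank y. p l = r")
      case True
      then obtain l where l: "l < rank y" "p l = r" by blast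
      have agree: "row y u l' = row y v l'" if "l' < l" for l'
        using rows'[of l'] shifting_less(2)[OF l(1) that] l that by simp
      have "take (Suc l) (code y u) = take (Suc l) (code y v)"
        using agree fst l(1) by (simp add: take_code_eq_iff[OF y u v])
      then have "code y u ! Suc l \<in> nonneg_keys width"
        using rel l(1) by (simp add: relpos_def length_code)
      then have "0 \<le> \<phi> k (row y u l c)"
        using k row_key_row_nonneg_iff[OF y u] l(1) by (simp add: code_Suc)
      moreover have sc: "shift y y' g p u l c \<in> carrier R"
        by (rule J_carrier[OF shift_in_J[OF u l(1)]])
      moreover have "\<phi> k (row y' (act y y' g u) r c) = \<phi> k (row y u l c) + \<phi> k (shift y y' g p u l c)"
        using row_act_shift[OF u l(1), of c] \<phi>_add[OF k row_closed[OF y u l(1)] sc] l(2) by simp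
      moreover have "\<phi> k (row y' (act y y' g v) r c) = \<phi> k (row y v l c) + \<phi> k (shift y y' g p u l c)"
        using row_act_shift[OF v l(1), of c] \<phi>_add[OF k row_closed[OF y v l(1)] sc] l(2)
          shift_cong[OF u l(1) agree] by simp
      ultimately show ?thesis
        using le[OF l(1) k, of c] l(2) by simp
    next
      case False
      have "row y' (act y y' g u) r = row y' (act y y' g v) r"
        by (rule row_act_cong[OF u v r]) (use rows' False in \<open>auto simp: order.order_iff_strict\<close>)
      then show ?thesis
        using nonneg r k code_nonneg_iff[OF y' act_basis[OF v]] by simp
    qed
    then show ?thesis
      using row_key_row_nonneg_iff[OF y' act_basis[OF u]] r by (simp add: Suc code_Suc)
  qed
qed

end

section \<open>Construction of normalizers and embeddings\<close>

sublocale coded_projective_sum "OVI R" K q x code "nonneg_keys width"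
  by unfold_locales

lemma shifting_exists:
  assumes y: "y \<in> obj (OVI R)" "y' \<in> obj (OVI R)" and G: "echelon R (rank y') (rank y) G p"
    and J: "\<And>l l'. l < rank y \<Longrightarrow> l' < l \<Longrightarrow> G (p l) l' \<in> J"
  obtains g where "shifting y y' g p" "\<And>r l. r < rank y' \<Longrightarrow> l < rank y \<Longrightarrow> mat R y y' g r l = G r l"
proof -
  obtain g where g: "g \<in> OVI_hom R y y'"
    "\<And>r l. r < rank y' \<Longrightarrow> l < rank y \<Longrightarrow> mat R y y' g r l = G r l"
    using OVI_pair.hom_exists[OF OVI_pair[OF y] G] by blast
  have "echelon R (rank y') (rank y) (mat R y y' g) p"
    using G g(2) by (auto simp: echelon_def)
  moreover have "mat R y y' g (p l) l' \<in> J" if "l < rank y" "l' < l" for l l'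
    using J[OF that] g(2)[of "p l" l'] that G by (simp add: echelon_def)
  ultimately have "shifting y y' g p"
    using g(1) by (simp add: shifting_def)
  with g(2) show ?thesis by (rule that[rotated])
qed

text \<open>The matrix is the identity with the coefficients \<gamma> placed in row r before the
  diagonal.\<close>

lemma row_operation_exists:
  assumes y: "y \<in> obj (OVI R)" and r: "r < rank y" and \<gamma>: "\<And>l. l < r \<Longrightarrow> \<gamma> l \<in> J"
  obtains h where "shifting y y h id"
    "\<And>b s. b \<in> basis y \<Longrightarrow> s < rank y \<Longrightarrow> s \<noteq> r \<Longrightarrow> row y (act y y h b) s = row y b s"
    "\<And>b c. b \<in> basis y \<Longrightarrow> row y (act y y h b) r c = row y b r c \<oplus> (\<Oplus>l\<in>{..<r}. row y b l c \<otimes> \<gamma> l)"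
proof -
  interpret J: ideal J R by (rule J)
  define G where "G s l = (if s = l then \<one> else if s = r \<and> l < r then \<gamma> l else \<zero>)" for s l
  have "echelon R (rank y) (rank y) G id"
    using \<gamma> J_carrier by (auto simp: echelon_def G_def)
  moreover have "G (id l) l' \<in> J" if "l < rank y" "l' < l" for l l'
    using \<gamma> that by (auto simp: G_def)
  ultimately obtain h where h: "shifting y y h id"
    "\<And>s l. s < rank y \<Longrightarrow> l < rank y \<Longrightarrow> mat R y y h s l = G s l"
    using shifting_exists[OF y y] by blast
  have shift: "shift y y h id b s c = (if s = r then \<Oplus>l\<in>{..<r}. row y b l c \<otimes> \<gamma> l else \<zero>)"
    if b: "b \<in> basis y" and s: "s < rank y" for b s c
  proof -
    have "shift y y h id b s c = (\<Oplus>l\<in>{..<s}. row y b l c \<otimes> (if s = r then \<gamma> l else \<zero>))"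
      unfolding shift_def using row_closed[OF y b] s J_carrier[OF \<gamma>]
      by (intro finsum_cong') (auto simp: h(2) G_def)
    also have "\<dots> = (if s = r then \<Oplus>l\<in>{..<r}. row y b l c \<otimes> \<gamma> l else (\<Oplus>l\<in>{..<s}. \<zero>))"
    proof (cases "s = r")
      case False
      have "(\<Oplus>l\<in>{..<s}. row y b l c \<otimes> (if s = r then \<gamma> l else \<zero>)) = (\<Oplus>l\<in>{..<s}. \<zero>)"
        using False row_closed[OF y b] s by (intro finsum_cong') auto
      with False show ?thesis by simp
    qed simp
    finally show ?thesis by simp
  qed
  show ?thesis
  proof (rule that[OF h(1)])
    show "row y (act y y h b) s = row y b s" if "b \<in> basis y" "s < rank y" "s \<noteq> r" for b s
      using row_act_shift[OF y y h(1) that(1,2)] shift[OF that(1,2)] that(3) row_closed[OF y that(1,2)] by auto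
    show "row y (act y y h b) r c = row y b r c \<oplus> (\<Oplus>l\<in>{..<r}. row y b l c \<otimes> \<gamma> l)" if "b \<in> basis y" for b c
      using row_act_shift[OF y y h(1) that r] shift[OF that r] by simp
  qed
qed

lemma basis_echelon:
  assumes "y \<in> obj (OVI R)" "b \<in> basis y"
  shows "echelon R (rank y) (rank (x (fst b))) (row y b) (piv (x (fst b)) y (snd b))"
  using OVI_pair.hom_echelon[OF OVI_pair[OF basisD(2)[OF assms] assms(1)] basisD(3)[OF assms]]
  by (auto simp: echelon_def row_def)

lemma shifting_order_preserving:
  assumes "y \<in> obj (OVI R)" "y' \<in> obj (OVI R)" "shifting y y' g p"
  shows "order_preserving y y' g"
  using act_code_less[OF assms] by (simp add: order_preserving_def)

text \<open>Columns of v with a pivot before row r are translated by one large element of J. The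
  required combination uses only rows of v before r, so the words of U that agree with v there
  receive the same translation. In the remaining columns the entry in row r of such a word is 0 or
  1, which is nonnegative by the choice of signs.\<close>

lemma normalizer:
  assumes y: "y \<in> obj (OVI R)" and U: "finite U" "U \<subseteq> basis y" and v: "v \<in> U" and j: "j < Suc (rank y)"
  shows "\<exists>h\<in>homset (OVI R) y y. \<exists>h'\<in>homset (OVI R) y y.
    (\<forall>u\<in>basis y. act y y h' (act y y h u) = u) \<and> order_preserving y y h \<and>
    (\<forall>u\<in>basis y. take j (code y (act y y h u)) = take j (code y u)) \<and>
    (\<forall>u\<in>U. take j (code y u) = take j (code y v) \<longrightarrow> code y (act y y h u) ! j \<in> nonneg_keys width)"
proof (cases j)
  case 0
  have "act y y (ident (OVI R) y) u = u" if "u \<in> basis y" for u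
    using that comp_ident_left[OF basisD(2)[OF y that] y] basisD(3)[OF y that]
    by (simp add: act_def homset_OVI)
  then show ?thesis
    \<comment> \<open>Letter 0 only names the summand and is nonnegative already, so the identity
      suffices.\<close>
    using ident_closed[OF y] code_0_nonneg 0
    by (intro bexI[of _ "ident (OVI R) y"] conjI) (auto simp: order_preserving_def)
next
  case (Suc r)
  interpret J: ideal J R by (rule J)
  have r: "r < rank y" using Suc j by simp
  have vb: "v \<in> basis y" using v U by auto
  let ?d = "rank (x (fst v))" and ?\<rho> = "piv (x (fst v)) y (snd v)"
  \<comment> \<open>A crude bound on all coordinates in row r over the finite set U.\<close>
  define t where "t = (\<Sum>u\<in>U. \<Sum>c<width. \<Sum>k<rk. \<bar>\<phi> k (row y u r c)\<bar>)"
  have t: "\<bar>\<phi> k (row y u r c)\<bar> \<le> t" if "u \<in> U" "c < width" "k < rk" for u c k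
  proof -
    have "\<bar>\<phi> k (row y u r c)\<bar> \<le> (\<Sum>k<rk. \<bar>\<phi> k (row y u r c)\<bar>)"
      by (rule member_le_sum) (use that in auto)
    moreover have "(\<Sum>k<rk. \<bar>\<phi> k (row y u r c)\<bar>) \<le> (\<Sum>c<width. \<Sum>k<rk. \<bar>\<phi> k (row y u r c)\<bar>)"
      by (rule member_le_sum[where f = "\<lambda>c. \<Sum>k<rk. \<bar>\<phi> k (row y u r c)\<bar>"])
        (use that in \<open>auto intro: sum_nonneg\<close>)
    moreover have "(\<Sum>c<width. \<Sum>k<rk. \<bar>\<phi> k (row y u r c)\<bar>) \<le> t"
      unfolding t_def
      by (rule member_le_sum[where f = "\<lambda>u. \<Sum>c<width. \<Sum>k<rk. \<bar>\<phi> k (row y u r c)\<bar>"])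
        (use that U in \<open>auto intro!: sum_nonneg\<close>)
    ultimately show ?thesis by linarith
  qed
  obtain a where a: "a \<in> J" "\<And>k. k < rk \<Longrightarrow> t \<le> \<phi> k a"
    using large_in_J[of "nat t"] by (auto simp: t_def sum_nonneg)
  have "\<exists>\<gamma>. (\<forall>l<r. \<gamma> l \<in> J) \<and>
      (\<forall>c<?d. (\<Oplus>l\<in>{..<r}. row y v l c \<otimes> \<gamma> l) = (if ?\<rho> c < r then a else \<zero>))"
    using a(1) r by (intro echelon_solve[OF basis_echelon[OF y vb] J]) auto
  then obtain \<gamma> where "\<forall>l<r. \<gamma> l \<in> J"
    and "\<forall>c<?d. (\<Oplus>l\<in>{..<r}. row y v l c \<otimes> \<gamma> l) = (if ?\<rho> c < r then a else \<zero>)" by blast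
  note \<gamma> = this[rule_format]
  have \<gamma>': "\<ominus> \<gamma> l \<in> J" if "l < r" for l
    using J.a_inv_closed[OF \<gamma>(1)[OF that]] .
  obtain h where h: "shifting y y h id"
    "\<And>b s. b \<in> basis y \<Longrightarrow> s < rank y \<Longrightarrow> s \<noteq> r \<Longrightarrow> row y (act y y h b) s = row y b s"
    "\<And>b c. b \<in> basis y \<Longrightarrow> row y (act y y h b) r c = row y b r c \<oplus> (\<Oplus>l\<in>{..<r}. row y b l c \<otimes> \<gamma> l)"
    by (rule row_operation_exists[OF y r \<gamma>(1)]) auto
  \<comment> \<open>The row operation leaves the rows before r unchanged, so the one with opposite
    coefficients inverts it.\<close>
  obtain h' where h': "shifting y y h' id"
    "\<And>b s. b \<in> basis y \<Longrightarrow> s < rank y \<Longrightarrow> s \<noteq> r \<Longrightarrow> row y (act y y h' b) s = row y b s"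
    "\<And>b c. b \<in> basis y \<Longrightarrow> row y (act y y h' b) r c = row y b r c \<oplus> (\<Oplus>l\<in>{..<r}. row y b l c \<otimes> \<ominus> \<gamma> l)"
    by (rule row_operation_exists[OF y r \<gamma>']) auto
  have hb: "act y y h b \<in> basis y" if "b \<in> basis y" for b
    by (rule act_basis[OF y y h(1) that])
  have inv: "act y y h' (act y y h u) = u" if u: "u \<in> basis y" for u
  proof (rule basis_eqI[OF y act_basis[OF y y h'(1) hb[OF u]] u])
    fix l assume l: "l < rank y"
    show "row y (act y y h' (act y y h u)) l = row y u l"
    proof (cases "l = r")
      case False
      then show ?thesis using h(2)[OF u l] h'(2)[OF hb[OF u] l] by simp
    next
      case True
      have uR: "row y u l' c \<in> carrier R" if "l' \<le> r" for l' c
        using row_closed[OF y u] that r by simp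
      have gR: "\<gamma> l' \<in> carrier R" if "l' < r" for l' using J_carrier[OF \<gamma>(1)[OF that]] .
      have "row y (act y y h' (act y y h u)) r c = row y u r c" for c
      proof -
        let ?S = "\<Oplus>l\<in>{..<r}. row y u l c \<otimes> \<gamma> l" and ?S' = "\<Oplus>l\<in>{..<r}. row y u l c \<otimes> \<ominus> \<gamma> l"
        have S: "?S \<in> carrier R" "?S' \<in> carrier R"
          using uR gR by (auto intro!: finsum_closed)
        have "?S \<oplus> ?S' = (\<Oplus>l\<in>{..<r}. row y u l c \<otimes> \<gamma> l \<oplus> row y u l c \<otimes> \<ominus> \<gamma> l)"
          using uR gR by (intro finsum_addf[symmetric]) auto
        also have "\<dots> = (\<Oplus>l\<in>{..<r}. \<zero>)"
          using uR gR by (intro finsum_cong') (auto simp: r_minus r_neg)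
        finally have "?S \<oplus> ?S' = \<zero>" by simp
        moreover have "(\<Oplus>l\<in>{..<r}. row y (act y y h u) l c \<otimes> \<ominus> \<gamma> l) = ?S'"
          using uR gR h(2)[OF u] r by (intro finsum_cong') auto
        ultimately show ?thesis
          using h'(3)[OF hb[OF u]] h(3)[OF u] S uR[of r c] by (simp add: a_assoc)
      qed
      then show ?thesis using True by auto
    qed
  qed simp
  have take: "take j (code y (act y y h u)) = take j (code y u)" if u: "u \<in> basis y" for u
    unfolding Suc using h(2)[OF u] r by (subst take_code_eq_iff[OF y hb[OF u] u]) auto
  have nonneg: "code y (act y y h u) ! j \<in> nonneg_keys width"
    if uU: "u \<in> U" and eq: "take j (code y u) = take j (code y v)" for u
  proof -
    have u: "u \<in> basis y" using uU U by auto
    have agree: "fst u = fst v" "\<And>l. l < r \<Longrightarrow> row y u l = row y v l"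
      using eq r unfolding Suc by (simp_all add: take_code_eq_iff[OF y u vb])
    note ech_v = basis_echelon[OF y vb] and ech_u = basis_echelon[OF y u, unfolded agree(1)]
    have "0 \<le> \<phi> k (row y (act y y h u) r c)" if k: "k < rk" for k c
    proof (cases "c < ?d")
      case False
      then show ?thesis using agree(1) \<phi>_zero[OF k] by (simp add: row_def)
    next
      case True
      have cw: "c < width" using True rank_le_width[OF basisD(1)[OF y vb]] by simp
      have uR: "row y u r c \<in> carrier R" by (rule row_closed[OF y u r])
      have "(\<Oplus>l\<in>{..<r}. row y u l c \<otimes> \<gamma> l) = (\<Oplus>l\<in>{..<r}. row y v l c \<otimes> \<gamma> l)"
        using agree(2) row_closed[OF y vb] r J_carrier[OF \<gamma>(1)] by (intro finsum_cong') auto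
      then have *: "row y (act y y h u) r c = row y u r c \<oplus> (if ?\<rho> c < r then a else \<zero>)"
        using h(3)[OF u] \<gamma>(2)[OF True] by simp
      show ?thesis
      proof (cases "?\<rho> c < r")
        case T: True
        have "\<phi> k (row y (act y y h u) r c) = \<phi> k (row y u r c) + \<phi> k a"
          unfolding * using T \<phi>_add[OF k uR J_carrier[OF a(1)]] by simp
        then show ?thesis using t[OF uU cw k] a(2)[OF k] by simp
      next
        case F: False
        let ?\<sigma> = "piv (x (fst v)) y (snd u)"
        \<comment> \<open>A pivot of u before row r would be a 1 in a row shared with v, where v
          still has 0.\<close>
        have "\<not> ?\<sigma> c < r"
        proof
          assume s: "?\<sigma> c < r"
          then have "row y v (?\<sigma> c) c = \<one>"
            using ech_u True by (simp add: echelon_def flip: agree(2)[OF s])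
          moreover have "row y v (?\<sigma> c) c = \<zero>"
            using ech_v True s F by (simp add: echelon_def)
          ultimately show False using one_neq_zero by simp
        qed
        then have "row y u r c = \<one> \<or> row y u r c = \<zero>"
          using ech_u True by (auto simp: echelon_def not_less order.order_iff_strict)
        then show ?thesis
          unfolding * using F \<phi>_one[OF k] \<phi>_zero[OF k] by auto
      qed
    qed
    then show ?thesis
      using row_key_row_nonneg_iff[OF y hb[OF u]] r by (simp add: Suc code_Suc)
  qed
  have "h \<in> homset (OVI R) y y" "h' \<in> homset (OVI R) y y"
    using h(1) h'(1) by (simp_all add: shifting_def homset_OVI)
  with inv take nonneg shifting_order_preserving[OF y y h(1)] show ?thesis by blast
qed

text \<open>The matrix of g is found one row at a time. Row \<open>p l\<close> has to be the unit
  vector at l plus earlier coefficients in J; they exist because row \<open>p l\<close> of w and row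
  l of v are congruent modulo J and coincide in columns with pivot l or later. For a row r outside
  the image of p, the rows l with \<open>p l < r\<close> suffice: all pivots of w lie in the image
  of p, so w is zero there in every column whose pivot comes after r.\<close>

lemma embeds_if_rows_embed:
  assumes y: "y \<in> obj (OVI R)" "y' \<in> obj (OVI R)" and v: "v \<in> basis y" and w: "w \<in> basis y'"
    and i: "fst v = fst w" and nonneg: "code y' w \<in> lists (nonneg_keys width)"
    and p: "\<And>l. l < rank y \<Longrightarrow> p l < rank y'" "\<And>l l'. l < rank y \<Longrightarrow> l' < l \<Longrightarrow> p l' < p l"
    and J: "\<And>l c. l < rank y \<Longrightarrow> row y' w (p l) c \<ominus> row y v l c \<in> J"
    and le: "\<And>l c k. l < rank y \<Longrightarrow> k < rk \<Longrightarrow> \<phi> k (row y v l c) \<le> \<phi> k (row y' w (p l) c)"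
    and piv: "\<And>c. c < rank (x (fst v)) \<Longrightarrow>
      piv (x (fst w)) y' (snd w) c = p (piv (x (fst v)) y (snd v) c)"
  shows "embeds (y, v) (y', w)"
proof -
  let ?d = "rank (x (fst v))" and ?\<rho> = "piv (x (fst v)) y (snd v)"
  have ech_v: "echelon R (rank y) ?d (row y v) ?\<rho>" by (rule basis_echelon[OF y(1) v])
  have "echelon R (rank y') ?d (row y' w) (piv (x (fst w)) y' (snd w))"
    using basis_echelon[OF y(2) w] i by simp
  then have ech_w: "echelon R (rank y') ?d (row y' w) (\<lambda>c. p (?\<rho> c))"
    using piv by (simp add: echelon_def)
  have vR: "row y v l c \<in> carrier R" if "l < rank y" for l c by (rule row_closed[OF y(1) v that])
  have wR: "row y' w r c \<in> carrier R" if "r < rank y'" for r c by (rule row_closed[OF y(2) w that])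
  have p_less_iff: "p l' < p l \<longleftrightarrow> l' < l" "p l' = p l \<longleftrightarrow> l' = l"
    if "l < rank y" "l' < rank y" for l l'
    using p(2)[of l l'] p(2)[of l' l] that by (metis linorder_neqE_nat not_less_iff_gr_or_eq)+
  \<comment> \<open>G qualifies as row r of a shifting matrix that produces row r of w from the rows
    of v.\<close>
  define ok where "ok r G \<longleftrightarrow> (\<forall>l<rank y. G l \<in> carrier R \<and> (r < p l \<longrightarrow> G l = \<zero>) \<and>
      (p l = r \<longrightarrow> G l = \<one>) \<and> (\<forall>l'<rank y. p l' = r \<longrightarrow> l < l' \<longrightarrow> G l \<in> J)) \<and>
      (\<forall>c<?d. (\<Oplus>l\<in>{..<rank y}. row y v l c \<otimes> G l) = row y' w r c)" for r G
  have "\<exists>G. ok r G" if r: "r < rank y'" for r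
  proof (cases "\<exists>l<rank y. p l = r")
    case True
    then obtain l where l: "l < rank y" "p l = r" by blast
    \<comment> \<open>In these columns both rows have the same rigid entry, 1 at the pivot or 0
      before it.\<close>
    have 0: "row y' w r c \<ominus> row y v l c = \<zero>" if c: "c < ?d" "l \<le> ?\<rho> c" for c
    proof (cases "?\<rho> c = l")
      case True
      then have "row y v l c = \<one>" "row y' w r c = \<one>"
        using ech_v ech_w c(1) l(2) by (auto simp: echelon_def)
      then show ?thesis by (simp add: minus_eq r_neg)
    next
      case False
      then have lt: "l < ?\<rho> c" using c by simp
      then have "r < p (?\<rho> c)"
        using ech_v c(1) l(2) p(2)[of "?\<rho> c" l] by (auto simp: echelon_def)
      then show ?thesis using ech_v ech_w c(1) lt by (simp add: echelon_def minus_eq)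
    qed
    have "\<exists>\<gamma>. (\<forall>l'<l. \<gamma> l' \<in> J) \<and>
        (\<forall>c<?d. (\<Oplus>l'\<in>{..<l}. row y v l' c \<otimes> \<gamma> l') = row y' w r c \<ominus> row y v l c)"
      using J[OF l(1)] l 0 by (intro echelon_solve[OF ech_v ring_coordinates.J[OF ring_coordinates_axioms]]) auto
    then obtain \<gamma> where "\<forall>l'<l. \<gamma> l' \<in> J"
      and "\<forall>c<?d. (\<Oplus>l'\<in>{..<l}. row y v l' c \<otimes> \<gamma> l') = row y' w r c \<ominus> row y v l c" by blast
    note \<gamma> = this[rule_format]
    have \<gamma>R: "\<gamma> l' \<in> carrier R" if "l' < l" for l' by (rule J_carrier[OF \<gamma>(1)[OF that]])
    define G where "G l' = (if l' < l then \<gamma> l' else if l' = l then \<one> else \<zero>)" for l'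
    have GR: "G l' \<in> carrier R" for l' using \<gamma>R by (simp add: G_def)
    have "(\<Oplus>l'\<in>{..<rank y}. row y v l' c \<otimes> G l') = row y' w r c" if c: "c < ?d" for c
    proof -
      have "(\<Oplus>l'\<in>{..<rank y}. row y v l' c \<otimes> G l') = (\<Oplus>l'\<in>{..<Suc l}. row y v l' c \<otimes> G l')"
        using l(1) vR GR by (intro add.finprod_mono_neutral_cong_right) (auto simp: G_def)
      also have "\<dots> = row y v l c \<otimes> G l \<oplus> (\<Oplus>l'\<in>{..<l}. row y v l' c \<otimes> G l')"
        unfolding lessThan_Suc using l(1) vR GR by (subst finsum_insert) auto
      also have "(\<Oplus>l'\<in>{..<l}. row y v l' c \<otimes> G l') = (\<Oplus>l'\<in>{..<l}. row y v l' c \<otimes> \<gamma> l')"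
        using l(1) vR \<gamma>R by (intro finsum_cong') (auto simp: G_def)
      also have "row y v l c \<otimes> G l \<oplus> \<dots> = row y' w r c"
        using \<gamma>(2)[OF c] vR[OF l(1)] wR[OF r] by (simp add: G_def add_minus_cancel)
      finally show ?thesis .
    qed
    then show ?thesis
      using GR \<gamma>(1) l p_less_iff by (intro exI[of _ G]) (auto simp: ok_def G_def)
  next
    case False
    \<comment> \<open>The number of l with \<open>p l < r\<close>. The alternative
      \<open>rank y \<le> l\<close> ensures existence and guards against values of p beyond its
      range.\<close>
    define n where "n = (LEAST l. rank y \<le> l \<or> r \<le> p l)"
    have n: "n \<le> rank y" "\<And>l. l < rank y \<Longrightarrow> p l < r \<longleftrightarrow> l < n"
    proof -
      have least: "rank y \<le> n \<or> r \<le> p n"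
        unfolding n_def by (rule LeastI[of _ "rank y"]) simp
      show "n \<le> rank y"
        unfolding n_def by (rule Least_le) simp
      fix l assume l: "l < rank y"
      show "p l < r \<longleftrightarrow> l < n"
      proof
        assume less: "p l < r"
        show "l < n"
        proof (rule ccontr)
          assume "\<not> l < n"
          then have "n = l \<or> p n < p l" using p(2)[OF l, of n] by (cases "n < l") auto
          then show False using least l less \<open>\<not> l < n\<close> by auto
        qed
      next
        assume "l < n"
        then show "p l < r"
          using not_less_Least[of l "\<lambda>l. rank y \<le> l \<or> r \<le> p l"] by (simp add: n_def)
      qed
    qed
    have "row y' w r c = \<zero>" if c: "c < ?d" "n \<le> ?\<rho> c" for c
    proof -
      have "?\<rho> c < rank y" using ech_v c(1) by (simp add: echelon_def)
      then have "r < p (?\<rho> c)"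
        using n(2)[of "?\<rho> c"] False c(2) by (meson linorder_neqE_nat not_less)
      then show ?thesis using ech_w c(1) by (simp add: echelon_def)
    qed
    then have "\<exists>\<gamma>. (\<forall>l<n. \<gamma> l \<in> carrier R) \<and> (\<forall>c<?d. (\<Oplus>l\<in>{..<n}. row y v l c \<otimes> \<gamma> l) = row y' w r c)"
      \<comment> \<open>No congruence is required in these rows, so the ideal is the whole
        ring.\<close>
      using wR[OF r] n(1) by (intro echelon_solve[OF ech_v oneideal])
    then obtain \<gamma> where "\<forall>l<n. \<gamma> l \<in> carrier R"
      and "\<forall>c<?d. (\<Oplus>l\<in>{..<n}. row y v l c \<otimes> \<gamma> l) = row y' w r c" by blast
    note \<gamma> = this[rule_format]
    define G where "G l = (if l < n then \<gamma> l else \<zero>)" for l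
    have GR: "G l' \<in> carrier R" for l' using \<gamma>(1) by (simp add: G_def)
    have "(\<Oplus>l\<in>{..<rank y}. row y v l c \<otimes> G l) = row y' w r c" if c: "c < ?d" for c
    proof -
      have "(\<Oplus>l\<in>{..<rank y}. row y v l c \<otimes> G l) = (\<Oplus>l\<in>{..<n}. row y v l c \<otimes> \<gamma> l)"
        using n(1) vR GR by (intro add.finprod_mono_neutral_cong_right) (auto simp: G_def)
      with \<gamma>(2)[OF c] show ?thesis by simp
    qed
    moreover have "G l = \<zero>" if "l < rank y" "r < p l" for l
      using n(2)[OF that(1)] that(2) by (simp add: G_def)
    ultimately show ?thesis
      using GR False by (intro exI[of _ G]) (auto simp: ok_def)
  qed
  then obtain G where ok: "\<And>r. r < rank y' \<Longrightarrow> ok r (G r)"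
    by metis
  have G: "G r l \<in> carrier R \<and> (r < p l \<longrightarrow> G r l = \<zero>) \<and> (p l = r \<longrightarrow> G r l = \<one>) \<and>
      (\<forall>l'<rank y. p l' = r \<longrightarrow> l < l' \<longrightarrow> G r l \<in> J)" if "r < rank y'" "l < rank y" for r l
    using ok[OF that(1)] that(2) unfolding ok_def by blast
  have Gw: "(\<Oplus>l\<in>{..<rank y}. row y v l c \<otimes> G r l) = row y' w r c" if "r < rank y'" "c < ?d" for r c
    using ok[OF that(1)] that(2) unfolding ok_def by blast
  have "echelon R (rank y') (rank y) G p"
    unfolding echelon_def
  proof (intro conjI allI impI)
    show "G r l \<in> carrier R" if "r < rank y'" "l < rank y" for r l
      using G[OF that] by blast
    fix l assume l: "l < rank y"
    show "p l < rank y'" by (rule p(1)[OF l])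
    show "G (p l) l = \<one>" using G[OF p(1)[OF l] l] by blast
    show "G r l = \<zero>" if "r < p l" for r
      using G[OF less_trans[OF that p(1)[OF l]] l] that by blast
    show "p l' < p l" if "l' < l" for l' by (rule p(2)[OF l that])
  qed
  moreover have "G (p l) l' \<in> J" if "l < rank y" "l' < l" for l l'
    using G[of "p l" l'] p(1)[OF that(1)] that by auto
  ultimately obtain g where g: "shifting y y' g p"
    "\<And>r l. r < rank y' \<Longrightarrow> l < rank y \<Longrightarrow> mat R y y' g r l = G r l"
    using shifting_exists[OF y] by blast
  have gw: "act y y' g v = w"
  proof (rule basis_eqI[OF y(2) act_basis[OF y g(1) v] w])
    show "fst (act y y' g v) = fst w" using i by simp
    fix r assume r: "r < rank y'"
    show "row y' (act y y' g v) r = row y' w r"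
    proof
      fix c
      show "row y' (act y y' g v) r c = row y' w r c"
      proof (cases "c < ?d")
        case True
        have "row y' (act y y' g v) r c = (\<Oplus>l\<in>{..<rank y}. row y v l c \<otimes> mat R y y' g r l)"
          by (rule row_act[OF y shifting_hom[OF y g(1)] v r])
        also have "\<dots> = (\<Oplus>l\<in>{..<rank y}. row y v l c \<otimes> G r l)"
          using g(2)[OF r] vR G[OF r] by (intro finsum_cong') auto
        finally show ?thesis using Gw[OF r True] by simp
      qed (simp add: row_def i)
    qed
  qed
  have "relpos (nonneg_keys width) (code y' w) (code y' (act y y' g u))"
    if "u \<in> basis y" "relpos (nonneg_keys width) (code y v) (code y u)" for u
    using act_relpos[OF y g(1) that(1) v that(2)] nonneg le by (simp add: gw)
  then show ?thesis
    using g(1) gw shifting_order_preserving[OF y g(1)]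
    by (auto simp: embeds_def shifting_def homset_OVI intro!: bexI[of _ g])
qed

text \<open>
  The complementary pairs of entries turn the componentwise order into equality: of residues modulo
  \<open>J\<close> in the first pair, of pivot positions in the second.
\<close>

definition cell ::
  "('r, 'v, 'i) based_module \<Rightarrow> nat \<times> ('v \<Rightarrow> 'v) \<times> ('i \<Rightarrow> 'i) \<Rightarrow> nat \<Rightarrow> nat \<Rightarrow> nat list" where
  "cell y b l c = map (\<lambda>k. nat (\<phi> k (row y b l c))) [0..<rk] @
     (let e = idx (row y b l c);
          s = of_bool (c < rank (x (fst b)) \<and> piv (x (fst b)) y (snd b) c = l)
      in [e, bound - e, s, 1 - s])"

definition letter ::
  "('r, 'v, 'i) based_module \<Rightarrow> nat \<times> ('v \<Rightarrow> 'v) \<times> ('i \<Rightarrow> 'i) \<Rightarrow> nat \<Rightarrow> nat list" where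
  "letter y b l = concat (map (cell y b l) [0..<width])"

lemma length_cell: "length (cell y b l c) = rk + 4"
  by (simp add: cell_def Let_def)

lemma length_letter: "length (letter y b l) = width * (rk + 4)"
  by (simp add: letter_def length_concat o_def length_cell sum_list_triv)

text \<open>Truncation by \<open>nat\<close> loses nothing on nonnegative coordinates. Coset numbers
  below \<open>bound\<close> that are compared together with their complements must be
  equal.\<close>

lemma cell_leD:
  assumes y: "y \<in> obj (OVI R)" "y' \<in> obj (OVI R)" and v: "v \<in> basis y" and w: "w \<in> basis y'"
    and l: "l < rank y" "l' < rank y'" and le: "list_all2 (\<le>) (cell y v l c) (cell y' w l' c)"
  shows "k < rk \<Longrightarrow> 0 \<le> \<phi> k (row y v l c) \<Longrightarrow> 0 \<le> \<phi> k (row y' w l' c) \<Longrightarrow> \<phi> k (row y v l c) \<le> \<phi> k (row y' w l' c)"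
    and "row y' w l' c \<ominus> row y v l c \<in> J"
    and "\<lbrakk>c < rank (x (fst v)); piv (x (fst v)) y (snd v) c = l\<rbrakk> \<Longrightarrow> piv (x (fst w)) y' (snd w) c = l'"
proof -
  have le': "cell y v l c ! k \<le> cell y' w l' c ! k" if "k < rk + 4" for k
    using list_all2_nthD[OF le] that by (simp add: length_cell)
  show "\<phi> k (row y v l c) \<le> \<phi> k (row y' w l' c)"
    if "k < rk" "0 \<le> \<phi> k (row y v l c)" "0 \<le> \<phi> k (row y' w l' c)"
    using le'[of k] that by (simp add: cell_def nth_append)
  have vR: "row y v l c \<in> carrier R" and wR: "row y' w l' c \<in> carrier R"
    by (rule row_closed[OF y(1) v l(1)], rule row_closed[OF y(2) w l(2)])
  have "idx (row y v l c) = idx (row y' w l' c)"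
    using le'[of rk] le'[of "rk + 1"] idx_bound[OF vR] idx_bound[OF wR]
    by (simp add: cell_def nth_append Let_def)
  then show "row y' w l' c \<ominus> row y v l c \<in> J"
    using idx_eq[OF wR vR] by simp
  show "piv (x (fst w)) y' (snd w) c = l'" if "c < rank (x (fst v))" "piv (x (fst v)) y (snd v) c = l"
    using le'[of "rk + 2"] that by (simp add: cell_def nth_append Let_def of_bool_def split: if_splits)
qed

text \<open>Letters are vectors of natural numbers of one fixed length, so Dickson's lemma applies
  to letters, Higman's lemma to words, and finiteness to the summand. The result is applied to
  nonnegative words, for which cells record the coordinates faithfully.\<close>

lemma almost_full_embeds:
  "almost_full_on embeds {(y, v). y \<in> obj (OVI R) \<and> v \<in> basis y \<and> code y v \<in> lists (nonneg_keys width)}"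
  (is "almost_full_on embeds ?A")
proof -
  let ?L = "{xs :: nat list. set xs \<subseteq> UNIV \<and> length xs = width * (rk + 4)}"
  have "almost_full_on (\<lambda>(a, b) (a', b'). a = a' \<and> list_emb (list_all2 (\<le>)) b b') ({..<q} \<times> lists ?L)"
    by (intro almost_full_on_prod almost_full_on_finite_eq higman almost_full_on_list_all2 almost_full_on_nat_le) simp
  then show ?thesis
  proof (rule almost_full_on_vimage[where h = "\<lambda>(y, v). (fst v, map (letter y v) [0..<rank y])"])
    show "(case a of (y, v) \<Rightarrow> (fst v, map (letter y v) [0..<rank y])) \<in> {..<q} \<times> lists ?L" if "a \<in> ?A" for a
      using that basisD(1) by (auto simp: length_letter)
    fix a b assume "a \<in> ?A" "b \<in> ?A" and ab: "(case case a of (y, v) \<Rightarrow> (fst v, map (letter y v) [0..<rank y]) of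
        (a, b) \<Rightarrow> \<lambda>(a', b'). a = a' \<and> list_emb (list_all2 (\<le>)) b b')
        (case b of (y, v) \<Rightarrow> (fst v, map (letter y v) [0..<rank y]))"
    obtain y v y' w where a: "a = (y, v)" and b: "b = (y', w)" by (cases a; cases b)
    have y: "y \<in> obj (OVI R)" "y' \<in> obj (OVI R)" and v: "v \<in> basis y" and w: "w \<in> basis y'"
      and nv: "code y v \<in> lists (nonneg_keys width)" and nw: "code y' w \<in> lists (nonneg_keys width)"
      using \<open>a \<in> ?A\<close> \<open>b \<in> ?A\<close> by (simp_all add: a b)
    have i: "fst v = fst w"
      and emb: "list_emb (list_all2 (\<le>)) (map (letter y v) [0..<rank y]) (map (letter y' w) [0..<rank y'])"
      using ab by (simp_all add: a b)
    let ?vs = "map (letter y v) [0..<rank y]" and ?ws = "map (letter y' w) [0..<rank y']"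
    have "\<exists>p. (\<forall>l<length ?vs. \<forall>l'<l. p l' < p l) \<and>
        (\<forall>l<length ?vs. p l < length ?ws \<and> list_all2 (\<le>) (?vs ! l) (?ws ! p l))"
      proof (rule list_emb_index_map[OF emb])
      fix p :: "nat \<Rightarrow> nat"
      assume "\<And>l' l. l' < l \<Longrightarrow> l < length ?vs \<Longrightarrow> p l' < p l"
        "\<And>l. l < length ?vs \<Longrightarrow> p l < length ?ws \<and> list_all2 (\<le>) (?vs ! l) (?ws ! p l)"
      then show "\<exists>p. (\<forall>l<length ?vs. \<forall>l'<l. p l' < p l) \<and>
        (\<forall>l<length ?vs. p l < length ?ws \<and> list_all2 (\<le>) (?vs ! l) (?ws ! p l))"
        by (intro exI[of _ p]) blast
    qed
    then obtain p where *: "\<forall>l<length ?vs. \<forall>l'<l. p l' < p l"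
      and **: "\<forall>l<length ?vs. p l < length ?ws \<and> list_all2 (\<le>) (?vs ! l) (?ws ! p l)" by blast
    have p: "l' < l \<Longrightarrow> p l' < p l" "p l < rank y'" and le: "list_all2 (\<le>) (letter y v l) (letter y' w (p l))"
      if "l < rank y" for l l'
      using * ** that by auto
    have cell: "list_all2 (\<le>) (cell y v l c) (cell y' w (p l) c)" if "l < rank y" "c < width" for l c
      by (rule list_all2_concat_mapD[OF le[OF that(1), unfolded letter_def]])
        (use that(2) in \<open>simp_all add: length_cell\<close>)
    have nonneg: "0 \<le> \<phi> k (row y v l c)" "0 \<le> \<phi> k (row y' w (p l) c)" if "l < rank y" "k < rk" for l c k
      using code_nonneg_iff[OF y(1) v] code_nonneg_iff[OF y(2) w] nv nw that p(2)[OF that(1)] by simp_all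
    have "embeds (y, v) (y', w)"
    proof (rule embeds_if_rows_embed[OF y v w i nw])
      show "p l < rank y'" if "l < rank y" for l by (rule p(2)[OF that])
      show "p l' < p l" if "l < rank y" "l' < l" for l l' by (rule p(1)[OF that])
      show "row y' w (p l) c \<ominus> row y v l c \<in> J" if l: "l < rank y" for l c
      proof (cases "c < width")
        case True
        show ?thesis by (rule cell_leD(2)[OF y v w l p(2)[OF l] cell[OF l True]])
      next
        case False
        interpret J: ideal J R by (rule J)
        show ?thesis using row_outside[OF y(1) v False] row_outside[OF y(2) w False] by (simp add: minus_eq)
      qed
      show "\<phi> k (row y v l c) \<le> \<phi> k (row y' w (p l) c)" if l: "l < rank y" and k: "k < rk" for l c k
      proof (cases "c < width")
        case True
        show ?thesis by (rule cell_leD(1)[OF y v w l p(2)[OF l] cell[OF l True] k nonneg[OF l k]])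
      next
        case False
        then show ?thesis using row_outside[OF y(1) v False] row_outside[OF y(2) w False] by simp
      qed
      fix c assume c: "c < rank (x (fst v))"
      then have cw: "c < width" using rank_le_width[OF basisD(1)[OF y(1) v]] by simp
      have l: "piv (x (fst v)) y (snd v) c < rank y"
        using basis_echelon[OF y(1) v] c by (simp add: echelon_def)
      show "piv (x (fst w)) y' (snd w) c = p (piv (x (fst v)) y (snd v) c)"
        by (rule cell_leD(3)[OF y v w l p(2)[OF l] cell[OF l cw] c refl])
    qed
    then show "embeds a b" by (simp add: a b)
  qed
qed

lemma well_ordered:
  assumes "noetherian_ring K"
  shows "well_ordered_projective_sum (OVI R) K q x code (nonneg_keys width) (\<lambda>y. Suc (rank y))"
proof
  show "\<exists>h\<in>homset (OVI R) y y. \<exists>h'\<in>homset (OVI R) y y.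
      (\<forall>u\<in>basis y. act y y h' (act y y h u) = u) \<and> order_preserving y y h \<and>
      (\<forall>u\<in>basis y. take j (code y (act y y h u)) = take j (code y u)) \<and>
      (\<forall>u\<in>U. take j (code y u) = take j (code y v) \<longrightarrow> code y (act y y h u) ! j \<in> nonneg_keys width)"
    if "y \<in> obj (OVI R)" "finite U" "U \<subseteq> basis y" "v \<in> U" "j < Suc (rank y)" for y U v j
    using that by (rule normalizer)
qed (use assms in \<open>simp_all add: length_code inj_code wf_nonneg_keys almost_full_embeds
    noetherian_ring.finetely_gen\<close>)

end

section \<open>Maps from principal projectives\<close>

lemma left_module_if_module: "module K V \<Longrightarrow> left_module K V"
  by (auto simp: module_def left_module_def module_axioms_def left_module_axioms_def cring_def)

lemma linear_maps_zero:
  assumes "module K V" "module K W" "f \<in> linear_maps K V W"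
  shows "f \<zero>\<^bsub>V\<^esub> = \<zero>\<^bsub>W\<^esub>"
proof -
  interpret V: module K V by fact
  interpret W: module K W by fact
  show ?thesis
    using linear_maps_finsum[OF left_module_if_module left_module_if_module, OF assms, of "{}" "\<lambda>_. \<zero>\<^bsub>V\<^esub>"]
    by simp
qed

lemma linear_maps_a_inv:
  assumes "module K V" "module K W" "f \<in> linear_maps K V W" and v: "v \<in> carrier V"
  shows "f (\<ominus>\<^bsub>V\<^esub> v) = \<ominus>\<^bsub>W\<^esub> f v"
proof -
  interpret V: module K V by fact
  interpret W: module K W by fact
  have f: "f v \<in> carrier W" "f (\<ominus>\<^bsub>V\<^esub> v) \<in> carrier W"
    using assms(3) v by (auto simp: linear_maps_def)
  have "f (\<ominus>\<^bsub>V\<^esub> v) \<oplus>\<^bsub>W\<^esub> f v = f (\<ominus>\<^bsub>V\<^esub> v \<oplus>\<^bsub>V\<^esub> v)"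
    using assms(3) v by (simp add: linear_maps_def)
  also have "\<dots> = \<zero>\<^bsub>W\<^esub>"
    using v linear_maps_zero[OF assms(1-3)] by (simp add: V.l_neg)
  finally show ?thesis
    using f by (metis W.minus_equality)
qed

lemma submodule_vimage:
  assumes V: "module K V" and W: "module K W" and f: "f \<in> linear_maps K V W" and H: "submodule H K W"
  shows "submodule {v \<in> carrier V. f v \<in> H} K V"
proof -
  interpret V: module K V by fact
  interpret W: module K W by fact
  note HE = W.submoduleE[OF H]
  have "\<zero>\<^bsub>W\<^esub> \<in> H"
    using subgroup.one_closed[OF submodule.axioms(1)[OF H]] by simp
  then show ?thesis
    using f HE linear_maps_zero[OF V W f] linear_maps_a_inv[OF V W f]
    by (intro V.submoduleI) (auto simp: linear_maps_def)
qed

lemma submodule_image: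
  assumes V: "module K V" and W: "module K W" and f: "f \<in> linear_maps K V W"
  shows "submodule (f ` carrier V) K W"
proof -
  interpret V: module K V by fact
  interpret W: module K W by fact
  have add: "f u \<oplus>\<^bsub>W\<^esub> f v = f (u \<oplus>\<^bsub>V\<^esub> v)" if "u \<in> carrier V" "v \<in> carrier V" for u v
    using f that by (auto simp: linear_maps_def)
  have smult: "a \<odot>\<^bsub>W\<^esub> f v = f (a \<odot>\<^bsub>V\<^esub> v)" if "v \<in> carrier V" "a \<in> carrier K" for v a
    using f that by (auto simp: linear_maps_def)
  show ?thesis
  proof (intro W.submoduleI)
    show "f ` carrier V \<subseteq> carrier W"
      using f by (auto simp: linear_maps_def)
    show "\<zero>\<^bsub>W\<^esub> \<in> f ` carrier V"
      using imageI[OF V.zero_closed, of f] by (simp add: linear_maps_zero[OF V W f])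
    show "\<ominus>\<^bsub>W\<^esub> w \<in> f ` carrier V" if "w \<in> f ` carrier V" for w
      using that by (auto simp flip: linear_maps_a_inv[OF V W f])
    show "w \<oplus>\<^bsub>W\<^esub> w' \<in> f ` carrier V" if "w \<in> f ` carrier V" "w' \<in> f ` carrier V" for w w'
      using that by (auto simp: add)
    show "a \<odot>\<^bsub>W\<^esub> w \<in> f ` carrier V" if "a \<in> carrier K" "w \<in> f ` carrier V" for a w
      using that by (auto simp: smult)
  qed
qed

lemma (in module) smult_finsum_left:
  assumes "finite S" "c \<in> S \<rightarrow> carrier R" "v \<in> carrier M"
  shows "(\<Oplus>\<^bsub>R\<^esub>s\<in>S. c s) \<odot>\<^bsub>M\<^esub> v = (\<Oplus>\<^bsub>M\<^esub>s\<in>S. c s \<odot>\<^bsub>M\<^esub> v)"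
  using assms(1,2)
proof (induction S rule: finite_induct)
  case empty
  then show ?case using assms(3) by simp
next
  case (insert s S)
  then have "c s \<in> carrier R" "c \<in> S \<rightarrow> carrier R" by auto
  with insert assms(3) show ?case
    by (simp add: R.finsum_insert M.finsum_insert smult_l_distr Pi_def)
qed

section \<open>Yoneda maps\<close>

definition yoneda_map ::
  "('o, 'h) cat \<Rightarrow> ('o, 'h, 'k, 'a) cat_module \<Rightarrow> ('k, 'q) ring_scheme \<Rightarrow> 'o \<Rightarrow> 'a \<Rightarrow> 'o \<Rightarrow> ('h \<Rightarrow> 'k) \<Rightarrow> 'a" where
  "yoneda_map C M K x m y = (\<lambda>c\<in>carrier (free_module K (homset C x y)).
     \<Oplus>\<^bsub>mobj M y\<^esub>f\<in>{f \<in> homset C x y. c f \<noteq> \<zero>\<^bsub>K\<^esub>}. c f \<odot>\<^bsub>mobj M y\<^esub> mmap M x y f m)"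

locale yoneda = category C for C :: "('o, 'h) cat" +
  fixes K :: "('k, 'q) ring_scheme" and M :: "('o, 'h, 'k, 'a) cat_module" and x :: 'o and m :: 'a
  assumes K: "cring K" and M: "is_cat_module K C M" and x: "x \<in> obj C" and m: "m \<in> carrier (mobj M x)"
begin

lemma module_M: "y \<in> obj C \<Longrightarrow> module K (mobj M y)"
  using M by (simp add: is_cat_module_def)

lemma mmap_linear:
  "\<lbrakk>y \<in> obj C; z \<in> obj C; g \<in> homset C y z\<rbrakk> \<Longrightarrow> mmap M y z g \<in> linear_maps K (mobj M y) (mobj M z)"
  using M unfolding is_cat_module_def by blast

lemma mmap_m_closed: "\<lbrakk>y \<in> obj C; f \<in> homset C x y\<rbrakk> \<Longrightarrow> mmap M x y f m \<in> carrier (mobj M y)"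
  using mmap_linear[OF x, of y f] m by (auto simp: linear_maps_def)

text \<open>Enlarging the index set lets sums for different formal sums run over one common
  set.\<close>

lemma yoneda_map_eq:
  assumes y: "y \<in> obj C" and c: "c \<in> carrier (free_module K (homset C x y))"
    and S: "finite S" "{f \<in> homset C x y. c f \<noteq> \<zero>\<^bsub>K\<^esub>} \<subseteq> S" "S \<subseteq> homset C x y"
  shows "yoneda_map C M K x m y c = (\<Oplus>\<^bsub>mobj M y\<^esub>f\<in>S. c f \<odot>\<^bsub>mobj M y\<^esub> mmap M x y f m)"
proof -
  interpret V: module K "mobj M y" by (rule module_M[OF y])
  interpret L: left_module K "mobj M y" by (rule left_module_if_module[OF V.module_axioms])
  have "(\<Oplus>\<^bsub>mobj M y\<^esub>f\<in>{f \<in> homset C x y. c f \<noteq> \<zero>\<^bsub>K\<^esub>}. c f \<odot>\<^bsub>mobj M y\<^esub> mmap M x y f m)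
      = (\<Oplus>\<^bsub>mobj M y\<^esub>f\<in>S. c f \<odot>\<^bsub>mobj M y\<^esub> mmap M x y f m)"
    using S mmap_m_closed[OF y] free_module_carrierD(1)[OF c]
    by (intro V.add.finprod_mono_neutral_cong_left) (auto simp: subset_iff)
  with c show ?thesis by (simp add: yoneda_map_def)
qed

lemma yoneda_map_linear:
  assumes y: "y \<in> obj C"
  shows "yoneda_map C M K x m y \<in> linear_maps K (free_module K (homset C x y)) (mobj M y)"
proof -
  let ?V = "free_module K (homset C x y)" and ?W = "mobj M y"
  interpret V: module K ?V by (rule module_free_module[OF K])
  interpret W: module K ?W by (rule module_M[OF y])
  interpret L: left_module K ?W by (rule left_module_if_module[OF W.module_axioms])
  have clo: "c f \<odot>\<^bsub>?W\<^esub> mmap M x y f m \<in> carrier ?W" if "c \<in> carrier ?V" "f \<in> homset C x y" for c f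
    using free_module_carrierD(1)[OF that] mmap_m_closed[OF y that(2)] by simp
  have "yoneda_map C M K x m y c \<in> carrier ?W" if c: "c \<in> carrier ?V" for c
    using clo[OF c] c by (auto simp: yoneda_map_def intro!: W.finsum_closed)
  moreover have "yoneda_map C M K x m y (c \<oplus>\<^bsub>?V\<^esub> d) = yoneda_map C M K x m y c \<oplus>\<^bsub>?W\<^esub> yoneda_map C M K x m y d"
    if c: "c \<in> carrier ?V" and d: "d \<in> carrier ?V" for c d
  proof -
    define S where "S = {f \<in> homset C x y. c f \<noteq> \<zero>\<^bsub>K\<^esub>} \<union> {f \<in> homset C x y. d f \<noteq> \<zero>\<^bsub>K\<^esub>}"
    have S: "finite S" "S \<subseteq> homset C x y" "{f \<in> homset C x y. c f \<noteq> \<zero>\<^bsub>K\<^esub>} \<subseteq> S"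
      "{f \<in> homset C x y. d f \<noteq> \<zero>\<^bsub>K\<^esub>} \<subseteq> S" "{f \<in> homset C x y. (c \<oplus>\<^bsub>?V\<^esub> d) f \<noteq> \<zero>\<^bsub>K\<^esub>} \<subseteq> S"
      using free_module_carrierD(2)[OF c] free_module_carrierD(2)[OF d]
      by (auto simp: S_def free_module_def)
    have cd: "c \<oplus>\<^bsub>?V\<^esub> d \<in> carrier ?V" using c d by simp
    have "yoneda_map C M K x m y (c \<oplus>\<^bsub>?V\<^esub> d)
        = (\<Oplus>\<^bsub>?W\<^esub>f\<in>S. (c \<oplus>\<^bsub>?V\<^esub> d) f \<odot>\<^bsub>?W\<^esub> mmap M x y f m)"
      by (rule yoneda_map_eq[OF y cd S(1,5,2)])
    also have "\<dots> = (\<Oplus>\<^bsub>?W\<^esub>f\<in>S. c f \<odot>\<^bsub>?W\<^esub> mmap M x y f m \<oplus>\<^bsub>?W\<^esub> d f \<odot>\<^bsub>?W\<^esub> mmap M x y f m)"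
    proof (rule W.finsum_cong')
      show "(\<lambda>f. c f \<odot>\<^bsub>?W\<^esub> mmap M x y f m \<oplus>\<^bsub>?W\<^esub> d f \<odot>\<^bsub>?W\<^esub> mmap M x y f m) \<in> S \<rightarrow> carrier ?W"
        using clo[OF c] clo[OF d] S(2) by auto
      fix f assume "f \<in> S"
      then have f: "f \<in> homset C x y" using S(2) by auto
      have "(c \<oplus>\<^bsub>?V\<^esub> d) f = c f \<oplus>\<^bsub>K\<^esub> d f" using f by (simp add: free_module_def)
      then show "(c \<oplus>\<^bsub>?V\<^esub> d) f \<odot>\<^bsub>?W\<^esub> mmap M x y f m
          = c f \<odot>\<^bsub>?W\<^esub> mmap M x y f m \<oplus>\<^bsub>?W\<^esub> d f \<odot>\<^bsub>?W\<^esub> mmap M x y f m"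
        using free_module_carrierD(1)[OF c f] free_module_carrierD(1)[OF d f] mmap_m_closed[OF y f]
        by (simp add: W.smult_l_distr)
    qed simp
    also have "\<dots> = (\<Oplus>\<^bsub>?W\<^esub>f\<in>S. c f \<odot>\<^bsub>?W\<^esub> mmap M x y f m) \<oplus>\<^bsub>?W\<^esub> (\<Oplus>\<^bsub>?W\<^esub>f\<in>S. d f \<odot>\<^bsub>?W\<^esub> mmap M x y f m)"
      using clo[OF c] clo[OF d] S(2) by (intro W.finsum_addf) auto
    finally show ?thesis
      using yoneda_map_eq[OF y c S(1,3,2)] yoneda_map_eq[OF y d S(1,4,2)] by simp
  qed
  moreover have "yoneda_map C M K x m y (a \<odot>\<^bsub>?V\<^esub> c) = a \<odot>\<^bsub>?W\<^esub> yoneda_map C M K x m y c"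
    if a: "a \<in> carrier K" and c: "c \<in> carrier ?V" for a c
  proof -
    define S where "S = {f \<in> homset C x y. c f \<noteq> \<zero>\<^bsub>K\<^esub>}"
    have S: "finite S" "S \<subseteq> homset C x y" "{f \<in> homset C x y. c f \<noteq> \<zero>\<^bsub>K\<^esub>} \<subseteq> S"
      "{f \<in> homset C x y. (a \<odot>\<^bsub>?V\<^esub> c) f \<noteq> \<zero>\<^bsub>K\<^esub>} \<subseteq> S"
      using free_module_carrierD(2)[OF c] a by (auto simp: S_def free_module_def)
    have ac: "a \<odot>\<^bsub>?V\<^esub> c \<in> carrier ?V" using a c by simp
    have "yoneda_map C M K x m y (a \<odot>\<^bsub>?V\<^esub> c) = (\<Oplus>\<^bsub>?W\<^esub>f\<in>S. (a \<odot>\<^bsub>?V\<^esub> c) f \<odot>\<^bsub>?W\<^esub> mmap M x y f m)"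
      by (rule yoneda_map_eq[OF y ac S(1,4,2)])
    also have "\<dots> = (\<Oplus>\<^bsub>?W\<^esub>f\<in>S. a \<odot>\<^bsub>?W\<^esub> (c f \<odot>\<^bsub>?W\<^esub> mmap M x y f m))"
    proof (rule W.finsum_cong')
      show "(\<lambda>f. a \<odot>\<^bsub>?W\<^esub> (c f \<odot>\<^bsub>?W\<^esub> mmap M x y f m)) \<in> S \<rightarrow> carrier ?W"
        using clo[OF c] S(2) a by auto
      fix f assume "f \<in> S"
      then have f: "f \<in> homset C x y" using S(2) by auto
      have "(a \<odot>\<^bsub>?V\<^esub> c) f = a \<otimes>\<^bsub>K\<^esub> c f" using f by (simp add: free_module_def)
      then show "(a \<odot>\<^bsub>?V\<^esub> c) f \<odot>\<^bsub>?W\<^esub> mmap M x y f m = a \<odot>\<^bsub>?W\<^esub> (c f \<odot>\<^bsub>?W\<^esub> mmap M x y f m)"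
        using free_module_carrierD(1)[OF c f] a mmap_m_closed[OF y f] by (simp add: W.smult_assoc1)
    qed simp
    also have "\<dots> = a \<odot>\<^bsub>?W\<^esub> (\<Oplus>\<^bsub>?W\<^esub>f\<in>S. c f \<odot>\<^bsub>?W\<^esub> mmap M x y f m)"
      using clo[OF c] S a by (intro L.smult_finsum[symmetric]) auto
    finally show ?thesis
      using yoneda_map_eq[OF y c S(1,3,2)] by simp
  qed
  moreover have "yoneda_map C M K x m y \<in> extensional (carrier ?V)"
    by (simp add: yoneda_map_def)
  ultimately show ?thesis
    by (auto simp: linear_maps_def PiE_iff)
qed

text \<open>Grouping the morphisms of the support by their composite with g reduces naturality to
  functoriality and linearity of M.\<close>

lemma yoneda_map_natural:
  assumes y: "y \<in> obj C" and z: "z \<in> obj C" and g: "g \<in> homset C y z"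
    and c: "c \<in> carrier (free_module K (homset C x y))"
  shows "yoneda_map C M K x m z (free_map K (homset C x y) (homset C x z) (composite C x y z g) c)
    = mmap M y z g (yoneda_map C M K x m y c)"
proof -
  let ?h = "composite C x y z g" and ?Y = "mobj M y" and ?Z = "mobj M z"
  interpret K: cring K by (rule K)
  interpret Y: module K ?Y by (rule module_M[OF y])
  interpret Z: module K ?Z by (rule module_M[OF z])
  interpret LZ: left_module K ?Z by (rule left_module_if_module[OF Z.module_axioms])
  define S where "S = {f \<in> homset C x y. c f \<noteq> \<zero>\<^bsub>K\<^esub>}"
  have S: "finite S" "S \<subseteq> homset C x y" "{f \<in> homset C x y. c f \<noteq> \<zero>\<^bsub>K\<^esub>} \<subseteq> S"
    using free_module_carrierD(2)[OF c] by (auto simp: S_def)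
  have h: "?h \<in> homset C x y \<rightarrow> homset C x z"
    using comp_closed[OF x y z _ g] by auto
  have cS: "c f \<in> carrier K" if "f \<in> S" for f
    using that S(2) free_module_carrierD(1)[OF c] by auto
  have mS: "mmap M x y f m \<in> carrier ?Y" "mmap M x z (?h f) m \<in> carrier ?Z" if "f \<in> S" for f
    using that S(2) h mmap_m_closed[OF y] mmap_m_closed[OF z] by auto
  let ?d = "free_map K (homset C x y) (homset C x z) ?h c"
  note d = free_map_closed[OF K h c]
  have T: "finite (?h ` S)" "{t \<in> homset C x z. ?d t \<noteq> \<zero>\<^bsub>K\<^esub>} \<subseteq> ?h ` S" "?h ` S \<subseteq> homset C x z"
    using S d(2) h by (auto simp: S_def)
  have "yoneda_map C M K x m z ?d = (\<Oplus>\<^bsub>?Z\<^esub>t\<in>?h ` S. ?d t \<odot>\<^bsub>?Z\<^esub> mmap M x z t m)"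
    by (rule yoneda_map_eq[OF z d(1) T])
  also have "\<dots> = (\<Oplus>\<^bsub>?Z\<^esub>t\<in>?h ` S. \<Oplus>\<^bsub>?Z\<^esub>f\<in>{f \<in> S. ?h f = t}. c f \<odot>\<^bsub>?Z\<^esub> mmap M x z (?h f) m)"
  proof (rule Z.finsum_cong')
    show "(\<lambda>t. \<Oplus>\<^bsub>?Z\<^esub>f\<in>{f \<in> S. ?h f = t}. c f \<odot>\<^bsub>?Z\<^esub> mmap M x z (?h f) m) \<in> ?h ` S \<rightarrow> carrier ?Z"
      using cS mS by (auto intro!: Z.finsum_closed)
    fix t assume t: "t \<in> ?h ` S"
    then have tz: "t \<in> homset C x z" using T(3) by auto
    have "?d t = (\<Oplus>\<^bsub>K\<^esub>f\<in>{f \<in> S. ?h f = t}. c f)"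
      by (rule free_map_eq[OF K c tz S(1,3,2)])
    then have "?d t \<odot>\<^bsub>?Z\<^esub> mmap M x z t m = (\<Oplus>\<^bsub>?Z\<^esub>f\<in>{f \<in> S. ?h f = t}. c f \<odot>\<^bsub>?Z\<^esub> mmap M x z t m)"
      using S(1) cS by (simp add: Z.smult_finsum_left mmap_m_closed[OF z tz])
    also have "\<dots> = (\<Oplus>\<^bsub>?Z\<^esub>f\<in>{f \<in> S. ?h f = t}. c f \<odot>\<^bsub>?Z\<^esub> mmap M x z (?h f) m)"
      using cS mS by (intro Z.finsum_cong') auto
    finally show "?d t \<odot>\<^bsub>?Z\<^esub> mmap M x z t m = \<dots>" .
  qed simp
  also have "\<dots> = (\<Oplus>\<^bsub>?Z\<^esub>f\<in>(\<Union>t\<in>?h ` S. {f \<in> S. ?h f = t}). c f \<odot>\<^bsub>?Z\<^esub> mmap M x z (?h f) m)"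
    using S cS mS by (intro Z.add.finprod_UN_disjoint[symmetric]) (auto simp: pairwise_def disjnt_def)
  also have "(\<Union>t\<in>?h ` S. {f \<in> S. ?h f = t}) = S" by auto
  also have "(\<Oplus>\<^bsub>?Z\<^esub>f\<in>S. c f \<odot>\<^bsub>?Z\<^esub> mmap M x z (?h f) m)
      = (\<Oplus>\<^bsub>?Z\<^esub>f\<in>S. mmap M y z g (c f \<odot>\<^bsub>?Y\<^esub> mmap M x y f m))"
  proof (rule Z.finsum_cong')
    have lin: "mmap M y z g \<in> linear_maps K ?Y ?Z" by (rule mmap_linear[OF y z g])
    show "(\<lambda>f. mmap M y z g (c f \<odot>\<^bsub>?Y\<^esub> mmap M x y f m)) \<in> S \<rightarrow> carrier ?Z"
      using lin cS mS by (auto simp: linear_maps_def)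
    fix f assume f: "f \<in> S"
    have "mmap M x z (?h f) m = mmap M y z g (mmap M x y f m)"
      using M x y z g f m S(2) unfolding is_cat_module_def by blast
    then show "c f \<odot>\<^bsub>?Z\<^esub> mmap M x z (?h f) m = mmap M y z g (c f \<odot>\<^bsub>?Y\<^esub> mmap M x y f m)"
      using lin cS[OF f] mS(1)[OF f] by (simp add: linear_maps_def)
  qed simp
  also have "\<dots> = mmap M y z g (\<Oplus>\<^bsub>?Y\<^esub>f\<in>S. c f \<odot>\<^bsub>?Y\<^esub> mmap M x y f m)"
    using cS mS S(1)
    by (intro linear_maps_finsum[OF left_module_if_module left_module_if_module mmap_linear[OF y z g], symmetric]
        Y.module_axioms Z.module_axioms) auto
  finally show ?thesis
    using yoneda_map_eq[OF y c S(1,3,2)] by simp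
qed

text \<open>The preimage is the basis element of the identity morphism.\<close>

lemma yoneda_map_hits: "m \<in> yoneda_map C M K x m x ` carrier (free_module K (homset C x x))"
proof
  interpret K: cring K by (rule K)
  interpret V: module K "mobj M x" by (rule module_M[OF x])
  let ?\<delta> = "\<lambda>f\<in>homset C x x. if f = ident C x then \<one>\<^bsub>K\<^esub> else \<zero>\<^bsub>K\<^esub>"
  have id: "ident C x \<in> homset C x x" by (rule ident_closed[OF x])
  show \<delta>: "?\<delta> \<in> carrier (free_module K (homset C x x))"
    by (auto simp: free_module_def intro!: finite_subset[of _ "{ident C x}"])
  have "yoneda_map C M K x m x ?\<delta> = (\<Oplus>\<^bsub>mobj M x\<^esub>f\<in>{ident C x}. ?\<delta> f \<odot>\<^bsub>mobj M x\<^esub> mmap M x x f m)"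
    by (rule yoneda_map_eq[OF x \<delta>]) (use id in \<open>auto split: if_splits\<close>)
  also have "\<dots> = m"
    using M x m id by (simp add: is_cat_module_def)
  finally show "m = yoneda_map C M K x m x ?\<delta>" ..
qed

end

text \<open>Sum the Yoneda maps of the chosen elements. Each \<open>m i\<close> is hit by the basis
  element of the identity in summand i, with zero in the others.\<close>

lemma map_from_projectives_exists:
  assumes K: "cring K" and C: "category C" and M: "is_cat_module K C M"
    and x: "\<And>i. i < n \<Longrightarrow> x i \<in> obj C" and m: "\<And>i. i < n \<Longrightarrow> m i \<in> carrier (mobj M (x i))"
  shows "\<exists>\<psi>\<in>cat_module_maps K C (direct_sum n (\<lambda>i. principal_projective K C (x i))) M.
    \<forall>i<n. m i \<in> \<psi> (x i) ` carrier (mobj (direct_sum n (\<lambda>i. principal_projective K C (x i))) (x i))"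
proof -
  interpret PS: projective_sum C K n x
    by (intro projective_sum.intro projective_sum_axioms.intro C K x)
  define Y where "Y i y = yoneda_map C M K (x i) (m i) y" for i y
  define \<psi> where "\<psi> y = (\<lambda>u\<in>carrier (mobj PS.D y). \<Oplus>\<^bsub>mobj M y\<^esub>i\<in>{..<n}. Y i y (u i))" for y
  have yon: "yoneda C K M (x i) (m i)" if "i < n" for i
    using that by (intro yoneda.intro yoneda_axioms.intro C K M x m)
  have Y: "Y i y \<in> linear_maps K (free_module K (homset C (x i) y)) (mobj M y)" if "i < n" "y \<in> obj C" for i y
    unfolding Y_def by (rule yoneda.yoneda_map_linear[OF yon[OF that(1)] that(2)])
  have modM: "module K (mobj M y)" if "y \<in> obj C" for y
    using M that by (simp add: is_cat_module_def)
  have ui: "u i \<in> carrier (free_module K (homset C (x i) y))" if "u \<in> carrier (mobj PS.D y)" "i < n" for u i y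
    using that by (simp add: PS.carrier_D_iff)
  have Yu: "Y i y (u i) \<in> carrier (mobj M y)" if "u \<in> carrier (mobj PS.D y)" "i < n" "y \<in> obj C" for u i y
    using Y[OF that(2,3)] ui[OF that(1,2)] by (auto simp: linear_maps_def)
  have lin: "\<psi> y \<in> linear_maps K (mobj PS.D y) (mobj M y)" if y: "y \<in> obj C" for y
  proof -
    interpret W: module K "mobj M y" by (rule modM[OF y])
    interpret L: left_module K "mobj M y" by (rule left_module_if_module[OF W.module_axioms])
    interpret V: module K "mobj PS.D y" by (rule PS.module_D[OF y])
    have "\<psi> y u \<in> carrier (mobj M y)" if u: "u \<in> carrier (mobj PS.D y)" for u
      using u Yu[OF u _ y] by (auto simp: \<psi>_def intro!: W.finsum_closed)
    moreover have "\<psi> y (u \<oplus>\<^bsub>mobj PS.D y\<^esub> w) = \<psi> y u \<oplus>\<^bsub>mobj M y\<^esub> \<psi> y w"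
      if u: "u \<in> carrier (mobj PS.D y)" and w: "w \<in> carrier (mobj PS.D y)" for u w
    proof -
      have uw: "u \<oplus>\<^bsub>mobj PS.D y\<^esub> w \<in> carrier (mobj PS.D y)" using u w by simp
      have "(u \<oplus>\<^bsub>mobj PS.D y\<^esub> w) i = u i \<oplus>\<^bsub>free_module K (homset C (x i) y)\<^esub> w i" if "i < n" for i
        using that by (simp add: direct_sum_def sum_module_def principal_projective_def)
      then have "(\<Oplus>\<^bsub>mobj M y\<^esub>i\<in>{..<n}. Y i y ((u \<oplus>\<^bsub>mobj PS.D y\<^esub> w) i))
          = (\<Oplus>\<^bsub>mobj M y\<^esub>i\<in>{..<n}. Y i y (u i) \<oplus>\<^bsub>mobj M y\<^esub> Y i y (w i))"
        using Y[OF _ y] ui[OF u] ui[OF w] Yu[OF u _ y] Yu[OF w _ y]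
        by (intro W.finsum_cong') (auto simp: linear_maps_def)
      also have "\<dots> = (\<Oplus>\<^bsub>mobj M y\<^esub>i\<in>{..<n}. Y i y (u i)) \<oplus>\<^bsub>mobj M y\<^esub> (\<Oplus>\<^bsub>mobj M y\<^esub>i\<in>{..<n}. Y i y (w i))"
        using Yu[OF u _ y] Yu[OF w _ y] by (intro W.finsum_addf) auto
      finally show ?thesis using u w uw by (simp add: \<psi>_def)
    qed
    moreover have "\<psi> y (a \<odot>\<^bsub>mobj PS.D y\<^esub> u) = a \<odot>\<^bsub>mobj M y\<^esub> \<psi> y u"
      if a: "a \<in> carrier K" and u: "u \<in> carrier (mobj PS.D y)" for a u
    proof -
      have au: "a \<odot>\<^bsub>mobj PS.D y\<^esub> u \<in> carrier (mobj PS.D y)" using a u by simp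
      have "(a \<odot>\<^bsub>mobj PS.D y\<^esub> u) i = a \<odot>\<^bsub>free_module K (homset C (x i) y)\<^esub> u i" if "i < n" for i
        using that by (simp add: direct_sum_def sum_module_def principal_projective_def)
      then have "(\<Oplus>\<^bsub>mobj M y\<^esub>i\<in>{..<n}. Y i y ((a \<odot>\<^bsub>mobj PS.D y\<^esub> u) i))
          = (\<Oplus>\<^bsub>mobj M y\<^esub>i\<in>{..<n}. a \<odot>\<^bsub>mobj M y\<^esub> Y i y (u i))"
        using Y[OF _ y] ui[OF u] Yu[OF u _ y] a by (intro W.finsum_cong') (auto simp: linear_maps_def)
      also have "\<dots> = a \<odot>\<^bsub>mobj M y\<^esub> (\<Oplus>\<^bsub>mobj M y\<^esub>i\<in>{..<n}. Y i y (u i))"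
        using Yu[OF u _ y] a by (intro L.smult_finsum[symmetric]) auto
      finally show ?thesis using u au by (simp add: \<psi>_def)
    qed
    moreover have "\<psi> y \<in> extensional (carrier (mobj PS.D y))"
      by (simp add: \<psi>_def)
    ultimately show ?thesis by (auto simp: linear_maps_def PiE_iff)
  qed
  have nat: "\<psi> z (mmap PS.D y z g u) = mmap M y z g (\<psi> y u)"
    if y: "y \<in> obj C" and z: "z \<in> obj C" and g: "g \<in> homset C y z" and u: "u \<in> carrier (mobj PS.D y)" for y z g u
  proof -
    interpret W: module K "mobj M z" by (rule modM[OF z])
    have gu: "mmap PS.D y z g u \<in> carrier (mobj PS.D z)" by (rule PS.mmap_D_closed[OF y z g u])
    have lin_g: "mmap M y z g \<in> linear_maps K (mobj M y) (mobj M z)"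
      using M y z g unfolding is_cat_module_def by blast
    have "\<psi> z (mmap PS.D y z g u) = (\<Oplus>\<^bsub>mobj M z\<^esub>i\<in>{..<n}. Y i z (mmap PS.D y z g u i))"
      using gu by (simp add: \<psi>_def)
    also have "\<dots> = (\<Oplus>\<^bsub>mobj M z\<^esub>i\<in>{..<n}. mmap M y z g (Y i y (u i)))"
    proof (rule W.finsum_cong')
      show "(\<lambda>i. mmap M y z g (Y i y (u i))) \<in> {..<n} \<rightarrow> carrier (mobj M z)"
        using lin_g Yu[OF u _ y] by (auto simp: linear_maps_def)
      fix i assume "i \<in> {..<n}"
      then have i: "i < n" by simp
      show "Y i z (mmap PS.D y z g u i) = mmap M y z g (Y i y (u i))"
        unfolding PS.mmap_D_eq[OF u i] Y_def
        by (rule yoneda.yoneda_map_natural[OF yon[OF i] y z g ui[OF u i]])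
    qed simp
    also have "\<dots> = mmap M y z g (\<Oplus>\<^bsub>mobj M y\<^esub>i\<in>{..<n}. Y i y (u i))"
      using Yu[OF u _ y]
      by (intro linear_maps_finsum[OF left_module_if_module left_module_if_module lin_g, symmetric] modM y z) auto
    finally show ?thesis using u by (simp add: \<psi>_def)
  qed
  have hit: "m j \<in> \<psi> (x j) ` carrier (mobj PS.D (x j))" if j: "j < n" for j
  proof -
    interpret W: module K "mobj M (x j)" by (rule modM[OF x[OF j]])
    obtain c where c: "c \<in> carrier (free_module K (homset C (x j) (x j)))" "m j = Y j (x j) c"
      using yoneda.yoneda_map_hits[OF yon[OF j]] by (auto simp: Y_def)
    define u where "u = (\<lambda>i\<in>{..<n}. if i = j then c else \<zero>\<^bsub>free_module K (homset C (x i) (x j))\<^esub>)"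
    have zero: "\<zero>\<^bsub>free_module K (homset C (x i) (x j))\<^esub> \<in> carrier (free_module K (homset C (x i) (x j)))" for i
      using module_free_module[OF K, of "homset C (x i) (x j)"] by (simp add: module_def abelian_group_def abelian_monoid.zero_closed)
    have u: "u \<in> carrier (mobj PS.D (x j))"
      using c(1) zero by (simp add: PS.carrier_D_iff u_def)
    have "(\<Oplus>\<^bsub>mobj M (x j)\<^esub>i\<in>{..<n}. Y i (x j) (u i))
        = (\<Oplus>\<^bsub>mobj M (x j)\<^esub>i\<in>{..<n}. if j = i then m i else \<zero>\<^bsub>mobj M (x j)\<^esub>)"
    proof (rule W.finsum_cong')
      show "(\<lambda>i. if j = i then m i else \<zero>\<^bsub>mobj M (x j)\<^esub>) \<in> {..<n} \<rightarrow> carrier (mobj M (x j))"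
        using m[OF j] by auto
      show "Y i (x j) (u i) = (if j = i then m i else \<zero>\<^bsub>mobj M (x j)\<^esub>)" if "i \<in> {..<n}" for i
        using that c(2) linear_maps_zero[OF module_free_module[OF K] W.module_axioms Y[OF _ x[OF j]]]
        by (auto simp: u_def)
    qed simp
    also have "\<dots> = m j"
      using j m[OF j] W.finsum_singleton[of j "{..<n}" "\<lambda>i. if i = j then m j else \<zero>\<^bsub>mobj M (x j)\<^esub>"]
      by (simp cong: if_cong)
    finally have "m j = \<psi> (x j) u"
      using u by (simp add: \<psi>_def)
    with u show ?thesis by blast
  qed
  have "\<psi> \<in> cat_module_maps K C PS.D M"
    using lin nat by (simp add: cat_module_maps_def)
  then show ?thesis
    using hit by blast
qed

section \<open>Preimages and images of submodules\<close>

lemma is_cat_submodule_subset: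
  assumes "is_cat_module K C M" "is_cat_submodule K C M N" "y \<in> obj C"
  shows "N y \<subseteq> carrier (mobj M y)"
  by (rule module.submoduleE(1)[of K]) (use assms in \<open>simp_all add: is_cat_module_def is_cat_submodule_def\<close>)

lemma is_cat_submodule_vimage:
  assumes D: "is_cat_module K C D" and M: "is_cat_module K C M" and \<phi>: "\<phi> \<in> cat_module_maps K C D M"
    and N: "is_cat_submodule K C M N"
  shows "is_cat_submodule K C D (\<lambda>y. {u \<in> carrier (mobj D y). \<phi> y u \<in> N y})"
  unfolding is_cat_submodule_def
proof (intro conjI ballI)
  show "submodule {u \<in> carrier (mobj D y). \<phi> y u \<in> N y} K (mobj D y)" if "y \<in> obj C" for y
    using that D M \<phi> N
    by (intro submodule_vimage[of _ _ "mobj M y"])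
      (auto simp: is_cat_module_def cat_module_maps_def is_cat_submodule_def)
  fix y z g assume y: "y \<in> obj C" and z: "z \<in> obj C" and g: "g \<in> homset C y z"
  have "mmap D y z g \<in> linear_maps K (mobj D y) (mobj D z)"
    using D y z g unfolding is_cat_module_def by blast
  moreover have "\<phi> z (mmap D y z g u) = mmap M y z g (\<phi> y u)" if "u \<in> carrier (mobj D y)" for u
    using \<phi> y z g that unfolding cat_module_maps_def by blast
  moreover have "mmap M y z g ` N y \<subseteq> N z"
    using N y z g unfolding is_cat_submodule_def by blast
  ultimately show "mmap D y z g ` {u \<in> carrier (mobj D y). \<phi> y u \<in> N y} \<subseteq> {u \<in> carrier (mobj D z). \<phi> z u \<in> N z}"
    by (auto simp: linear_maps_def)
qed

lemma is_cat_submodule_image: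
  assumes D: "is_cat_module K C D" and M: "is_cat_module K C M" and \<phi>: "\<phi> \<in> cat_module_maps K C D M"
  shows "is_cat_submodule K C M (\<lambda>y. \<phi> y ` carrier (mobj D y))"
  unfolding is_cat_submodule_def
proof (intro conjI ballI)
  show "submodule (\<phi> y ` carrier (mobj D y)) K (mobj M y)" if "y \<in> obj C" for y
    using that D M \<phi> by (intro submodule_image) (auto simp: is_cat_module_def cat_module_maps_def)
  fix y z g assume y: "y \<in> obj C" and z: "z \<in> obj C" and g: "g \<in> homset C y z"
  have "mmap D y z g \<in> linear_maps K (mobj D y) (mobj D z)"
    using D y z g unfolding is_cat_module_def by blast
  then have "mmap D y z g u \<in> carrier (mobj D z)" if "u \<in> carrier (mobj D y)" for u
    using that by (auto simp: linear_maps_def)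
  moreover have "mmap M y z g (\<phi> y u) = \<phi> z (mmap D y z g u)" if "u \<in> carrier (mobj D y)" for u
    using \<phi> y z g that unfolding cat_module_maps_def by simp
  ultimately show "mmap M y z g ` \<phi> y ` carrier (mobj D y) \<subseteq> \<phi> z ` carrier (mobj D z)"
    by auto
qed

lemma cat_module_maps_from_submodule:
  assumes M: "is_cat_module K C M" and N: "is_cat_submodule K C M N"
    and \<psi>: "\<psi> \<in> cat_module_maps K C E (cat_submodule M N)"
  shows "\<psi> \<in> cat_module_maps K C E M"
  unfolding cat_module_maps_def
proof (intro CollectI conjI ballI)
  note NM = is_cat_submodule_subset[OF M N]
  have lin: "\<psi> y \<in> linear_maps K (mobj E y) ((mobj M y)\<lparr>carrier := N y\<rparr>)" if "y \<in> obj C" for y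
    using \<psi> that by (simp add: cat_module_maps_def cat_submodule_def)
  show "\<psi> y \<in> linear_maps K (mobj E y) (mobj M y)" if "y \<in> obj C" for y
    using lin[OF that] NM[OF that] by (auto simp: linear_maps_def PiE_iff)
  show "\<psi> z (mmap E y z g u) = mmap M y z g (\<psi> y u)"
    if y: "y \<in> obj C" and z: "z \<in> obj C" and g: "g \<in> homset C y z" and u: "u \<in> carrier (mobj E y)" for y z g u
  proof -
    have "\<psi> y u \<in> N y"
      using lin[OF y] u by (auto simp: linear_maps_def)
    moreover have "\<psi> z (mmap E y z g u) = mmap (cat_submodule M N) y z g (\<psi> y u)"
      using \<psi> y z g u unfolding cat_module_maps_def by blast
    ultimately show ?thesis by (simp add: cat_submodule_def)
  qed
qed

section \<open>Noetherianity of \<open>OVI(R)\<close>-modules\<close>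

theorem theorem1p5:
  fixes R :: "('r, 'p) ring_scheme"
    and K :: "('k, 'q) ring_scheme"
    and M :: "(('r, 'v, 'i) based_module, ('v \<Rightarrow> 'v) \<times> ('i \<Rightarrow> 'i), 'k, 'a) cat_module"
    and N :: "('r, 'v, 'i) based_module \<Rightarrow> 'a set"
  assumes "ring R" and "\<one>\<^bsub>R\<^esub> \<noteq> \<zero>\<^bsub>R\<^esub>" and "additively_finitely_generated R"
    and "cring K" and "\<one>\<^bsub>K\<^esub> \<noteq> \<zero>\<^bsub>K\<^esub>" and "noetherian_ring K"
    and "is_cat_module K (OVI R) M" and "finitely_generated K (OVI R) M"
    and "is_cat_submodule K (OVI R) M N"
  shows "finitely_generated K (OVI R) (cat_submodule M N)"
proof -
  let ?C = "OVI R :: (('r, 'v, 'i) based_module, _) cat"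
  note M = assms(7) and N = assms(9)
  obtain n p \<phi> where p: "p \<in> {..<n} \<rightarrow> obj ?C"
    and \<phi>: "\<phi> \<in> cat_module_maps K ?C (direct_sum n (\<lambda>i. principal_projective K ?C (p i))) M"
    and surj: "\<And>y. y \<in> obj ?C \<Longrightarrow>
      \<phi> y ` carrier (mobj (direct_sum n (\<lambda>i. principal_projective K ?C (p i))) y) = carrier (mobj M y)"
    using assms(8) unfolding finitely_generated_def by blast
  obtain rk \<alpha> J z idx bound where coords: "ring_coordinates R rk \<alpha> J z idx bound"
    by (rule ring_coordinates_exist[OF assms(1-3)])
  interpret OVI_projective_sum R rk \<alpha> J z idx bound K n p
    using p by (intro OVI_projective_sum.intro coords projective_sum.intro projective_sum_axioms.intro
        category_OVI assms) auto
  interpret WO: well_ordered_projective_sum ?C K n p code "nonneg_keys width" "\<lambda>y. Suc (rank y)"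
    by (rule well_ordered[OF assms(6)])
  define N' where "N' y = {u \<in> carrier (mobj D y). \<phi> y u \<in> N y}" for y
  have N': "is_cat_submodule K ?C D N'"
    unfolding N'_def by (rule is_cat_submodule_vimage[OF D_cat_module M \<phi> N])
  obtain F where F: "finite F" "\<And>y u. (y, u) \<in> F \<Longrightarrow> y \<in> obj ?C \<and> u \<in> N' y"
    and gen: "\<And>y. y \<in> obj ?C \<Longrightarrow> N' y \<subseteq> generated F y"
    using WO.submodule_finitely_generated[OF N'] by blast
  obtain l where l: "set l = F"
    using finite_list[OF F(1)] by blast
  \<comment> \<open>Each generator of the preimage contributes one principal projective, placed at
    the object of the generator and mapped to its image in N.\<close>
  define a m where "a k = fst (l ! k)" and "m k = \<phi> (fst (l ! k)) (snd (l ! k))" for k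
  have lF: "(a k, snd (l ! k)) \<in> F" if "k < length l" for k
    using nth_mem[OF that] l by (simp add: a_def)
  let ?N = "cat_submodule M N"
  have Nmod: "is_cat_module K ?C ?N"
    by (rule cat_submodule_is_cat_module[OF M N category_OVI])
  have "\<exists>\<psi>\<in>cat_module_maps K ?C (direct_sum (length l) (\<lambda>i. principal_projective K ?C (a i))) ?N.
    \<forall>i<length l. m i \<in> \<psi> (a i) `
      carrier (mobj (direct_sum (length l) (\<lambda>i. principal_projective K ?C (a i))) (a i))"
  proof (rule map_from_projectives_exists[OF assms(4) category_OVI Nmod])
    show "a i \<in> obj ?C" if "i < length l" for i
      using F(2)[OF lF[OF that]] by blast
    show "m i \<in> carrier (mobj ?N (a i))" if "i < length l" for i
      using F(2)[OF lF[OF that]] by (simp add: m_def a_def N'_def cat_submodule_def)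
  qed
  then obtain \<psi> where \<psi>: "\<psi> \<in> cat_module_maps K ?C (direct_sum (length l) (\<lambda>i. principal_projective K ?C (a i))) ?N"
    and hit: "\<And>i. i < length l \<Longrightarrow> m i \<in> \<psi> (a i) `
      carrier (mobj (direct_sum (length l) (\<lambda>i. principal_projective K ?C (a i))) (a i))"
    by blast
  define E where "E = direct_sum (length l) (\<lambda>i. principal_projective K ?C (a i))"
  have E: "is_cat_module K ?C E"
    unfolding E_def
    by (intro direct_sum_is_cat_module principal_projective_is_cat_module assms(4) category_OVI)
      (use F(2)[OF lF] in blast)
  have \<psi>M: "\<psi> \<in> cat_module_maps K ?C E M"
    by (rule cat_module_maps_from_submodule[OF M N \<psi>[folded E_def]])
  \<comment> \<open>Surjectivity is proved without expanding elements in generators: the preimage in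
    D of the image of \<psi> is a submodule containing F, hence everything that F generates.\<close>
  have S: "is_cat_submodule K ?C D (\<lambda>y. {u \<in> carrier (mobj D y). \<phi> y u \<in> \<psi> y ` carrier (mobj E y)})"
    by (rule is_cat_submodule_vimage[OF D_cat_module M \<phi> is_cat_submodule_image[OF E M \<psi>M]])
  have "carrier (mobj ?N y) \<subseteq> \<psi> y ` carrier (mobj E y)" if y: "y \<in> obj ?C" for y
  proof
    fix w assume "w \<in> carrier (mobj ?N y)"
    then have w: "w \<in> N y" by (simp add: cat_submodule_def)
    have "w \<in> carrier (mobj M y)"
      using w is_cat_submodule_subset[OF M N y] by blast
    then obtain u where u: "u \<in> carrier (mobj D y)" "w = \<phi> y u"
      using surj[OF y] by blast
    then have "u \<in> generated F y" using gen[OF y] w by (auto simp: N'_def)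
    moreover have "\<forall>(y', u)\<in>F. u \<in> {u \<in> carrier (mobj D y'). \<phi> y' u \<in> \<psi> y' ` carrier (mobj E y')}"
    proof clarify
      fix y' u' assume "(y', u') \<in> F"
      then obtain k where k: "k < length l" "l ! k = (y', u')"
        using l by (metis in_set_conv_nth)
      then show "u' \<in> carrier (mobj D y') \<and> \<phi> y' u' \<in> \<psi> y' ` carrier (mobj E y')"
        using hit[OF k(1)] F(2)[OF lF[OF k(1)]] by (simp add: a_def m_def N'_def E_def)
    qed
    ultimately have "u \<in> {u \<in> carrier (mobj D y). \<phi> y u \<in> \<psi> y ` carrier (mobj E y)}"
      using S unfolding generated_def by blast
    then show "w \<in> \<psi> y ` carrier (mobj E y)" using u(2) by simp
  qed
  moreover have "\<psi> y ` carrier (mobj E y) \<subseteq> carrier (mobj ?N y)" if "y \<in> obj ?C" for y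
    using \<psi> that by (auto simp: E_def cat_module_maps_def linear_maps_def)
  ultimately have "\<psi> y ` carrier (mobj E y) = carrier (mobj ?N y)" if "y \<in> obj ?C" for y
    using that by blast
  then show ?thesis
    unfolding finitely_generated_def using \<psi> F(2)[OF lF]
    by (intro exI[of _ "length l"] exI[of _ a] exI[of _ \<psi>]) (auto simp: E_def)
qed

end
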